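(* Let $n\in\mathbb{N}$, $s>0$, $p\in(1,\infty)$ and $q\in[1,\infty]$. For any $\varrho\in C_c^\infty(\mathbb{R}^n)$ one has $$\|\varrho f\|_{B^s_{pq}(\mathbb{R}^n)}\lesssim\|f\|_{B^s_{pq}(\mathbb{T}^n)},$$ uniformly for all $f\in B^s_{pq}(\mathbb{T}^n)$ (the implicit constant may depend on $\varrho$, but not on $f$).
   Context: $\mathbb{T}^n$ is the $n$-dimensional torus; a function on $\mathbb{T}^n$ is identified with a function on $\mathbb{R}^n$ that is $2\pi$-periodic in each variable, denoted by the same letter (this is how $\varrho f$ is a function on $\mathbb{R}^n$), and $\|f\|_{L_p(\mathbb{T}^n)}=(\int_{-\pi}^{\pi}\cdots\int_{-\pi}^{\pi}|f|^p\,dx)^{1/p}$. For $s>0$ write $s=[s]^-+\{s\}^+$ with $[s]^-$ an integer and $\{s\}^+\in(0,1]$. Let $\Delta_h^1f(x)=f(x+h)-f(x)$ and $\Delta_h^2f=\Delta_h^1(\Delta_h^1f)$. For $\mathbb{F}\in\{\mathbb{R},\mathbb{T}\}$, $p\in(1,\infty)$ and $q\in[1,\infty)$, $B^s_{pq}(\mathbb{F}^n)$ is the space of functions with finite norm $$\|f\|_{B^s_{pq}(\mathbb{F}^n)}=\|f\|_{W^{[s]^-}_p(\mathbb{F}^n)}+\sum_{|\alpha|=[s]^-}\Bigl(\int_{\mathbb{F}^n}|h|^{-\{s\}^+q}\,\|\Delta_h^2\partial^\alpha f\|_{L_p(\mathbb{F}^n)}^q\,\frac{dh}{|h|^n}\Bigr)^{1/q},$$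 where $\|f\|_{W^k_p(\mathbb{F}^n)}=\sum_{|\alpha|\le k}\|\partial^\alpha f\|_{L_p(\mathbb{F}^n)}$; for $q=\infty$ each integral term is replaced by $\sup_{0\neq h\in\mathbb{F}^n}|h|^{-\{s\}^+}\|\Delta_h^2\partial^\alpha f\|_{L_p(\mathbb{F}^n)}$. For $\mathbb{F}=\mathbb{T}$ the variable $h$ ranges over $[-\pi,\pi]^n$. $A\lesssim B$ means $A\le cB$ for some positive constant $c$. *)

theory Defs
  imports "HOL-Analysis.Analysis"
begin

section \<open>Smooth functions and multi-indices\<close>

definition partial :: "'n::finite \<Rightarrow> (real^'n \<Rightarrow> complex) \<Rightarrow> real^'n \<Rightarrow> complex" where
  "partial i f = (\<lambda>x. frechet_derivative f (at x) (axis i 1))"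

definition iter_partial :: "'n::finite list \<Rightarrow> (real^'n \<Rightarrow> complex) \<Rightarrow> real^'n \<Rightarrow> complex" where
  "iter_partial is f = foldr partial is f"

definition C_infinity :: "(real^'n::finite \<Rightarrow> complex) \<Rightarrow> bool" where
  "C_infinity f \<longleftrightarrow> (\<forall>is. iter_partial is f differentiable_on UNIV)"

definition Cc_infinity :: "(real^'n::finite \<Rightarrow> complex) set" where
  "Cc_infinity = {f. C_infinity f \<and> compact (closure {x. f x \<noteq> 0})}"

definition multi_order :: "nat^'n::finite \<Rightarrow> nat" where
  "multi_order \<alpha> = (\<Sum>i\<in>UNIV. \<alpha> $ i)"

text \<open>
  The index type carries no order, so the sequence in which the partial derivatives making up
  \<open>\<partial>\<^sup>\<alpha>\<close> are taken is an arbitrary choice; on smooth functions it is immaterial, because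
  mixed partial derivatives commute.
\<close>

definition multi_partial :: "nat^'n::finite \<Rightarrow> (real^'n \<Rightarrow> complex) \<Rightarrow> real^'n \<Rightarrow> complex" where
  "multi_partial \<alpha> f = iter_partial (SOME is. \<forall>i. count_list is i = \<alpha> $ i) f"


section \<open>Distributional derivatives\<close>

definition locally_integrable :: "(real^'n::finite \<Rightarrow> complex) \<Rightarrow> bool" where
  "locally_integrable f \<longleftrightarrow> (\<forall>K. compact K \<longrightarrow> f absolutely_integrable_on K)"

definition has_weak_partial ::
  "nat^'n::finite \<Rightarrow> (real^'n \<Rightarrow> complex) \<Rightarrow> (real^'n \<Rightarrow> complex) \<Rightarrow> bool" where
  "has_weak_partial \<alpha> f g \<longleftrightarrow> locally_integrable f \<and> locally_integrable g \<and>
     (\<forall>\<phi>\<in>Cc_infinity.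
        integral\<^sup>L lebesgue (\<lambda>x. f x * multi_partial \<alpha> \<phi> x)
          = (-1) ^ multi_order \<alpha> * integral\<^sup>L lebesgue (\<lambda>x. g x * \<phi> x))"

text \<open>The weak derivative is determined almost everywhere only; any representative will do.\<close>

definition weak_partial :: "nat^'n::finite \<Rightarrow> (real^'n \<Rightarrow> complex) \<Rightarrow> real^'n \<Rightarrow> complex" where
  "weak_partial \<alpha> f = (SOME g. has_weak_partial \<alpha> f g)"


section \<open>Norms\<close>

definition ennreal_powr :: "ennreal \<Rightarrow> real \<Rightarrow> ennreal" where
  "ennreal_powr x a = (if x = \<infinity> then \<infinity> else ennreal (enn2real x powr a))"
  \<comment> \<open>intended for exponents \<open>a > 0\<close>\<close>

definition Lp_norm :: "(real^'n::finite) set \<Rightarrow> real \<Rightarrow> (real^'n \<Rightarrow> complex) \<Rightarrow> ennreal" where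
  "Lp_norm \<Omega> p g = ennreal_powr (\<integral>\<^sup>+x\<in>\<Omega>. ennreal (norm (g x) powr p) \<partial>lebesgue) (1 / p)"

definition diff1 :: "real^'n::finite \<Rightarrow> (real^'n \<Rightarrow> complex) \<Rightarrow> real^'n \<Rightarrow> complex" where
  "diff1 h f = (\<lambda>x. f (x + h) - f x)"

definition diff2 :: "real^'n::finite \<Rightarrow> (real^'n \<Rightarrow> complex) \<Rightarrow> real^'n \<Rightarrow> complex" where
  "diff2 h f = diff1 h (diff1 h f)"

text \<open>
  The decomposition of \<open>s > 0\<close> into an integer part and a remainder in \<open>(0,1]\<close>; for integer
  \<open>s\<close> the integer part is \<open>s - 1\<close>.
\<close>

definition int_part :: "real \<Rightarrow> nat" where
  "int_part s = nat (\<lceil>s\<rceil> - 1)"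

definition frac_part :: "real \<Rightarrow> real" where
  "frac_part s = s - of_int (\<lceil>s\<rceil> - 1)"

definition sobolev_norm ::
  "(real^'n::finite) set \<Rightarrow> nat \<Rightarrow> real \<Rightarrow> (real^'n \<Rightarrow> complex) \<Rightarrow> ennreal" where
  "sobolev_norm \<Omega> k p f =
     (if \<forall>\<alpha>. multi_order \<alpha> \<le> k \<longrightarrow> (\<exists>g. has_weak_partial \<alpha> f g)
      then \<Sum>\<alpha> | multi_order \<alpha> \<le> k. Lp_norm \<Omega> p (weak_partial \<alpha> f)
      else \<infinity>)"

definition besov_seminorm ::
  "(real^'n::finite) set \<Rightarrow> real \<Rightarrow> real \<Rightarrow> ennreal \<Rightarrow> (real^'n \<Rightarrow> complex) \<Rightarrow> ennreal" where
  "besov_seminorm \<Omega> \<sigma> p q g =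
     (if q = \<infinity>
      then SUP h \<in> \<Omega> - {0}. ennreal (norm h powr (-\<sigma>)) * Lp_norm \<Omega> p (diff2 h g)
      else ennreal_powr
             (\<integral>\<^sup>+h\<in>\<Omega>. ennreal (norm h powr (-\<sigma> * enn2real q))
                    * ennreal_powr (Lp_norm \<Omega> p (diff2 h g)) (enn2real q)
                    / ennreal (norm h ^ CARD('n)) \<partial>lebesgue)
             (1 / enn2real q))"

text \<open>
  The set \<open>\<Omega>\<close> is both the domain of the \<open>L\<^sub>p\<close> norms and the range of the increment \<open>h\<close>: the whole
  space for functions on \<open>\<real>\<^sup>n\<close>, the cube \<open>[-\<pi>, \<pi>]\<^sup>n\<close> for periodic functions. The functions themselves
  always live on \<open>\<real>\<^sup>n\<close>, so that the differences of a periodic function refer to its periodic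
  extension, and its distributional derivatives are those of the extension (weak
  differentiability is a local property, so they coincide with the derivatives on the torus).
\<close>

definition besov_norm ::
  "(real^'n::finite) set \<Rightarrow> real \<Rightarrow> real \<Rightarrow> ennreal \<Rightarrow> (real^'n \<Rightarrow> complex) \<Rightarrow> ennreal" where
  "besov_norm \<Omega> s p q f =
     sobolev_norm \<Omega> (int_part s) p f
     + (\<Sum>\<alpha> | multi_order \<alpha> = int_part s.
          besov_seminorm \<Omega> (frac_part s) p q (weak_partial \<alpha> f))"

definition torus_cube :: "(real^'n::finite) set" where
  "torus_cube = cbox (\<chi> i. - pi) (\<chi> i. pi)"

definition periodic_2pi :: "(real^'n::finite \<Rightarrow> complex) \<Rightarrow> bool" where
  "periodic_2pi f \<longleftrightarrow> (\<forall>x i. f (x + axis i (2 * pi)) = f x)"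

definition besov_space_Rn :: "real \<Rightarrow> real \<Rightarrow> ennreal \<Rightarrow> (real^'n::finite \<Rightarrow> complex) set" where
  "besov_space_Rn s p q = {f. besov_norm UNIV s p q f < \<infinity>}"

definition besov_space_Tn :: "real \<Rightarrow> real \<Rightarrow> ennreal \<Rightarrow> (real^'n::finite \<Rightarrow> complex) set" where
  "besov_space_Tn s p q = {f. periodic_2pi f \<and> besov_norm torus_cube s p q f < \<infinity>}"

end

theory Submission
  imports Defs "HOL-Probability.Probability_Measure"
begin

text \<open>Let \<open>m\<close> and \<open>\<sigma> \<in> (0, 1]\<close> be the integer part and the remainder of \<open>s\<close>.  A weak derivative of
  order at most \<open>m\<close> of \<open>\<rho> f\<close> is a finite sum of products \<open>r w\<close>, where \<open>r\<close> is a test function depending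
  on \<open>\<rho>\<close> only and \<open>w\<close> is a weak derivative of \<open>f\<close> of order at most \<open>m\<close> (\<open>weak_partial_product\<close>).
  So it is enough to bound, for each such product, the \<open>L\<^sub>p\<close> norm over the whole space and the
  integral of its second differences.  As \<open>w\<close> is periodic and \<open>r\<close> has compact support, norms over
  the space cost only finitely many period cells (\<open>Lp_norm_local\<close>).  The differences are split as
  \<open>\<Delta>\<^sub>h\<^sup>2 (r w) = r \<Delta>\<^sub>h\<^sup>2 w + 2 (\<Delta>\<^sub>h r) (\<Delta>\<^sub>h w)(\<cdot> + h) + (\<Delta>\<^sub>h\<^sup>2 r) w(\<cdot> + 2h)\<close>, where \<open>\<Delta>\<^sub>h r = O(|h|)\<close> and
  \<open>\<Delta>\<^sub>h\<^sup>2 r = O(|h|\<^sup>2)\<close>.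

  For \<open>|h| \<le> 1\<close> the last term is harmless because \<open>\<sigma> < 2\<close>; increments with \<open>|h| > 1\<close> are harmless
  because \<open>\<sigma> > 0\<close>.  The middle term is the delicate one: if \<open>\<sigma> = 1\<close> and \<open>q < \<infinity>\<close>, bounding
  \<open>\<Delta>\<^sub>h w\<close> by \<open>2 w\<close> leaves the divergent integral of \<open>1 / |h|\<^sup>n\<close>.  Here \<open>marchaud\<close> is used: the identity
  \<open>2 \<Delta>\<^sub>h = \<Delta>\<^sub>2\<^sub>h - \<Delta>\<^sub>h\<^sup>2\<close> and the dilation invariance of \<open>dh / |h|\<^sup>n\<close> bound the integral of first
  differences by one half of itself plus the integral of second differences, and the half is absorbed.

  The norm of \<open>f\<close> controls second differences only for derivatives of order exactly \<open>m\<close>.  For a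
  lower-order derivative \<open>w\<close>, the difference \<open>\<Delta>\<^sub>h w\<close> is an average of the translated gradient
  (\<open>diff1_eq_integral_gradient\<close>), whence \<open>\<Delta>\<^sub>h\<^sup>2 w\<close> is bounded by \<open>|h|\<close> times the first difference of
  the gradient, to which \<open>marchaud\<close> applies; a downward induction on the order concludes
  (\<open>smoothness_of_all_orders\<close>).

  All of this is about particular representatives of the weak derivatives.  They are unique almost
  everywhere (\<open>fundamental_lemma_variations\<close>), which lets them be chosen Borel measurable and periodic
  at every point (\<open>periodic_weak_partial\<close>).\<close>

section \<open>Smooth functions\<close>

lemma C_infinity_iter_partial:
  assumes "C_infinity f"
  shows "C_infinity (iter_partial js f)"
proof -
  have "iter_partial is (iter_partial js f) = iter_partial (is @ js) f" for "is"
    by (simp add: iter_partial_def)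
  with assms show ?thesis
    by (simp add: C_infinity_def)
qed

lemma iter_partial_Nil [simp]: "iter_partial [] f = f"
  by (simp add: iter_partial_def)

lemma iter_partial_Cons: "iter_partial (i # is) f = partial i (iter_partial is f)"
  by (simp add: iter_partial_def)

lemma iter_partial_append: "iter_partial (is @ js) f = iter_partial is (iter_partial js f)"
  by (simp add: iter_partial_def)

lemma C_infinity_partial: "C_infinity f \<Longrightarrow> C_infinity (partial i f)"
  using C_infinity_iter_partial[of f "[i]"] by (simp add: iter_partial_Cons)

lemma C_infinity_differentiable: "C_infinity f \<Longrightarrow> f differentiable (at x)"
  unfolding C_infinity_def
  by (metis UNIV_I differentiable_on_eq_differentiable_at iter_partial_Nil open_UNIV)

lemma C_infinity_has_derivative:
  "C_infinity f \<Longrightarrow> (f has_derivative frechet_derivative f (at x)) (at x)"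
  using C_infinity_differentiable frechet_derivative_works by blast

lemma C_infinity_continuous: "C_infinity f \<Longrightarrow> continuous_on UNIV f"
  by (meson C_infinity_differentiable continuous_at_imp_continuous_on
      differentiable_imp_continuous_within)

lemma partial_eqI: "(f has_derivative D) (at x) \<Longrightarrow> partial i f x = D (axis i 1)"
  unfolding partial_def by (metis frechet_derivative_at)

text \<open>Differentiability up to a fixed order is what an induction over products can carry along:
  each summand of the derivative of a product is a product of factors with one derivative less to
  spare.\<close>

definition C_k :: "nat \<Rightarrow> (real^'n::finite \<Rightarrow> complex) \<Rightarrow> bool" where
  "C_k k f \<longleftrightarrow> (\<forall>is. length is \<le> k \<longrightarrow> (\<forall>x. iter_partial is f differentiable (at x)))"

lemma C_infinity_iff_C_k: "C_infinity f \<longleftrightarrow> (\<forall>k. C_k k f)"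
  unfolding C_infinity_def C_k_def differentiable_on_eq_differentiable_at[OF open_UNIV] by auto

lemma C_k_0: "C_k 0 f \<longleftrightarrow> (\<forall>x. f differentiable (at x))"
  by (simp add: C_k_def)

lemma C_k_Suc:
  "C_k (Suc k) f \<longleftrightarrow> (\<forall>x. f differentiable (at x)) \<and> (\<forall>i. C_k k (partial i f))"
proof (intro iffI conjI allI)
  assume *: "C_k (Suc k) f"
  show "f differentiable (at x)" for x
    using *[unfolded C_k_def, rule_format, of "[]"] by simp
  show "C_k k (partial i f)" for i
    unfolding C_k_def
  proof (intro allI impI)
    fix js x assume "length (js :: 'a list) \<le> k"
    then show "iter_partial js (partial i f) differentiable (at x)"
      using *[unfolded C_k_def, rule_format, of "js @ [i]"]
      by (simp add: iter_partial_append iter_partial_Cons)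
  qed
next
  assume *: "(\<forall>x. f differentiable (at x)) \<and> (\<forall>i. C_k k (partial i f))"
  show "C_k (Suc k) f"
    unfolding C_k_def
  proof (intro allI impI)
    fix js x assume "length (js :: 'a list) \<le> Suc k"
    then show "iter_partial js f differentiable (at x)"
      using * by (cases js rule: rev_cases)
        (auto simp: iter_partial_append iter_partial_Cons C_k_def)
  qed
qed

lemma partial_add:
  assumes "\<And>x. f differentiable (at x)" "\<And>x. g differentiable (at x)"
  shows "partial i (\<lambda>x. f x + g x) = (\<lambda>x. partial i f x + partial i g x)"
proof
  fix x
  have "((\<lambda>x. f x + g x) has_derivative
      (\<lambda>h. frechet_derivative f (at x) h + frechet_derivative g (at x) h)) (at x)"
    using assms by (intro has_derivative_add) (auto simp: frechet_derivative_works)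
  from partial_eqI[OF this, of i] show "partial i (\<lambda>x. f x + g x) x = partial i f x + partial i g x"
    by (simp add: partial_def)
qed

lemma partial_mult:
  assumes "\<And>x. f differentiable (at x)" "\<And>x. g differentiable (at x)"
  shows "partial i (\<lambda>x. f x * g x) = (\<lambda>x. partial i f x * g x + f x * partial i g x)"
proof
  fix x
  have "((\<lambda>x. f x * g x) has_derivative
      (\<lambda>h. f x * frechet_derivative g (at x) h + frechet_derivative f (at x) h * g x)) (at x)"
    using assms by (intro has_derivative_mult) (auto simp: frechet_derivative_works)
  from partial_eqI[OF this, of i]
  show "partial i (\<lambda>x. f x * g x) x = partial i f x * g x + f x * partial i g x"
    by (simp add: partial_def)
qed

lemma partial_const: "partial i (\<lambda>x. c) = (\<lambda>x. 0)"
  by (simp add: partial_def fun_eq_iff)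

lemma C_k_add: "C_k k f \<Longrightarrow> C_k k g \<Longrightarrow> C_k k (\<lambda>x. f x + g x)"
proof (induction k arbitrary: f g)
  case 0 then show ?case by (simp add: C_k_0)
next
  case (Suc k)
  then show ?case by (auto simp: C_k_Suc partial_add)
qed

lemma C_k_Suc_imp: "C_k (Suc k) f \<Longrightarrow> C_k k f"
  by (simp add: C_k_def)

lemma C_k_mult: "C_k k f \<Longrightarrow> C_k k g \<Longrightarrow> C_k k (\<lambda>x. f x * g x)"
proof (induction k arbitrary: f g)
  case 0 then show ?case by (simp add: C_k_0)
next
  case (Suc k)
  then have "C_k k f" "C_k k g" by (auto intro: C_k_Suc_imp)
  with Suc show ?case by (auto simp: C_k_Suc partial_mult intro!: C_k_add)
qed

lemma C_infinity_add: "C_infinity f \<Longrightarrow> C_infinity g \<Longrightarrow> C_infinity (\<lambda>x. f x + g x)"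
  by (simp add: C_infinity_iff_C_k C_k_add)

lemma C_infinity_mult: "C_infinity f \<Longrightarrow> C_infinity g \<Longrightarrow> C_infinity (\<lambda>x. f x * g x)"
  by (simp add: C_infinity_iff_C_k C_k_mult)

lemma C_infinity_const: "C_infinity (\<lambda>x::real^'n::finite. c)"
proof -
  have "C_k k (\<lambda>x::real^'n. c)" for k
    by (induction k arbitrary: c) (simp_all add: C_k_0 C_k_Suc partial_const)
  then show ?thesis by (simp add: C_infinity_iff_C_k)
qed

lemma partial_translate: "partial i (\<lambda>x. f (x + h)) = (\<lambda>x. partial i f (x + h))"
proof
  fix x
  have "((\<lambda>x. f (x + h)) has_derivative D) (at x) \<longleftrightarrow> (f has_derivative D) (at (x + h))" for D
  proof
    assume "((\<lambda>x. f (x + h)) has_derivative D) (at x)"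
    then have "((\<lambda>x. f (x + h)) has_derivative D) (at ((x + h) + (- h)))" by simp
    then have "((\<lambda>x. f (x + h)) \<circ> (\<lambda>x. x + (-h)) has_derivative D \<circ> (\<lambda>y. y)) (at (x + h))"
      by (intro diff_chain_at) (auto intro!: derivative_eq_intros)
    then show "(f has_derivative D) (at (x + h))" by (simp add: o_def)
  next
    assume "(f has_derivative D) (at (x + h))"
    then have "(f \<circ> (\<lambda>x. x + h) has_derivative D \<circ> (\<lambda>y. y)) (at x)"
      by (intro diff_chain_at) (auto intro!: derivative_eq_intros)
    then show "((\<lambda>x. f (x + h)) has_derivative D) (at x)" by (simp add: o_def)
  qed
  then show "partial i (\<lambda>x. f (x + h)) x = partial i f (x + h)"
    by (simp add: partial_def frechet_derivative_def)
qed

lemma iter_partial_translate: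
  "iter_partial is (\<lambda>x. f (x + h)) = (\<lambda>x. iter_partial is f (x + h))"
  by (induction "is") (simp_all add: iter_partial_Cons partial_translate)

lemma C_infinity_translate: "C_infinity f \<Longrightarrow> C_infinity (\<lambda>x. f (x + h))"
  unfolding C_infinity_def iter_partial_translate
proof
  fix js assume "\<forall>is. iter_partial is f differentiable_on UNIV"
  then have "iter_partial js f differentiable_on range (\<lambda>x. x + h)"
    by (meson differentiable_on_subset subset_UNIV)
  then show "(\<lambda>x. iter_partial js f (x + h)) differentiable_on UNIV"
    by (intro differentiable_on_compose[where f="iter_partial js f" and g="\<lambda>x. x + h"])
      (rule derivative_intros)+
qed

lemma C_infinity_diff1: "C_infinity f \<Longrightarrow> C_infinity (diff1 h f)"
  using C_infinity_add[OF C_infinity_translate[of f h] C_infinity_mult[OF C_infinity_const[of "-1"], of f]]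
  by (simp add: diff1_def)

lemma partial_diff1:
  assumes "C_infinity f"
  shows "partial i (diff1 h f) = diff1 h (partial i f)"
proof -
  have "partial i (\<lambda>x. f (x + h) + (-1) * f x) = (\<lambda>x. partial i f (x + h) + (-1) * partial i f x)"
    using assms C_infinity_translate[OF assms, of h]
    by (subst partial_add; (subst partial_mult)?)
      (auto simp: C_infinity_differentiable partial_translate partial_const)
  then show ?thesis by (simp add: diff1_def)
qed

lemma frechet_derivative_eq_sum_partial:
  assumes "f differentiable (at x)"
  shows "frechet_derivative f (at x) h = (\<Sum>i\<in>UNIV. (h $ i) *\<^sub>R partial i f x)"
proof -
  have "linear (frechet_derivative f (at x))"
    using assms linear_frechet_derivative by blast
  then have "frechet_derivative f (at x) (\<Sum>i\<in>UNIV. (h $ i) *\<^sub>R axis i 1)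
      = (\<Sum>i\<in>UNIV. (h $ i) *\<^sub>R partial i f x)"
    by (simp add: linear_sum linear_scale partial_def)
  moreover have "(\<Sum>i\<in>UNIV. (h $ i) *\<^sub>R axis i 1) = h"
    using basis_expansion[of h] by (simp add: scalar_mult_eq_scaleR)
  ultimately show ?thesis by simp
qed

lemma C_infinity_along_line:
  assumes "C_infinity f"
  shows "((\<lambda>t. f (x + t *\<^sub>R h)) has_vector_derivative
           (\<Sum>i\<in>UNIV. (h $ i) *\<^sub>R partial i f (x + t *\<^sub>R h))) (at t within A)"
proof -
  have "((\<lambda>t. x + t *\<^sub>R h) has_derivative (\<lambda>s. s *\<^sub>R h)) (at t)"
    by (auto intro!: derivative_eq_intros)
  from diff_chain_at[OF this C_infinity_has_derivative[OF assms]]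
  have 1: "((\<lambda>t. f (x + t *\<^sub>R h)) has_derivative
      (\<lambda>s. frechet_derivative f (at (x + t *\<^sub>R h)) (s *\<^sub>R h))) (at t)"
    by (simp only: o_def)
  have 2: "(\<lambda>s. frechet_derivative f (at (x + t *\<^sub>R h)) (s *\<^sub>R h))
      = (\<lambda>s. s *\<^sub>R (\<Sum>i\<in>UNIV. (h $ i) *\<^sub>R partial i f (x + t *\<^sub>R h)))"
    unfolding frechet_derivative_eq_sum_partial[OF C_infinity_differentiable[OF assms]]
    by (simp add: scaleR_sum_right fun_eq_iff)
  show ?thesis
    unfolding has_vector_derivative_def
    by (rule has_derivative_at_withinI[OF 1[unfolded 2]])
qed

section \<open>Partial derivatives commute\<close>

text \<open>The mixed second difference is symmetric in \<open>i\<close> and \<open>j\<close>, and divided by \<open>t\<^sup>2\<close> it tends to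
  \<open>\<partial>\<^sub>j \<partial>\<^sub>i f\<close>; so it identifies both mixed derivatives.  Differentiability of \<open>\<partial>\<^sub>i f\<close> at \<open>x\<close> makes the
  derivative of \<open>s \<mapsto> f (x + s e\<^sub>i + t e\<^sub>j) - f (x + s e\<^sub>i)\<close> close to the constant \<open>t \<partial>\<^sub>j \<partial>\<^sub>i f (x)\<close>.\<close>

lemma mixed_difference_quotient:
  fixes f :: "real^'n::finite \<Rightarrow> complex"
  assumes f: "C_infinity f" and e: "e > 0"
  shows "\<exists>d>0. \<forall>t. 0 < t \<and> t < d \<longrightarrow>
    norm (f (x + t *\<^sub>R axis i 1 + t *\<^sub>R axis j 1) - f (x + t *\<^sub>R axis i 1)
       - f (x + t *\<^sub>R axis j 1) + f x - (t * t) *\<^sub>R partial j (partial i f) x) \<le> e * (t * t)"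
proof -
  let ?g = "partial i f" and ?D = "frechet_derivative (partial i f) (at x)"
  have g: "C_infinity ?g" by (rule C_infinity_partial[OF f])
  have lin: "linear ?D" by (rule linear_frechet_derivative[OF C_infinity_differentiable[OF g]])
  have "e / 3 > 0" using e by simp
  then obtain d where d: "d > 0"
    "\<And>y. norm (y - x) < d \<Longrightarrow> norm (?g y - ?g x - ?D (y - x)) \<le> e / 3 * norm (y - x)"
    using C_infinity_has_derivative[OF g, of x] unfolding has_derivative_at_alt by blast
  show ?thesis
  proof (intro exI[of _ "d / 2"] conjI allI impI)
    show "d / 2 > 0" using d by simp
    fix t assume t: "0 < t \<and> t < d / 2"
    define \<phi> where "\<phi> = (\<lambda>s. f ((x + t *\<^sub>R axis j 1) + s *\<^sub>R axis i 1) - f (x + s *\<^sub>R axis i 1)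
        - s *\<^sub>R (t *\<^sub>R partial j ?g x))"
    define \<phi>' where "\<phi>' = (\<lambda>s. ?g ((x + t *\<^sub>R axis j 1) + s *\<^sub>R axis i 1) - ?g (x + s *\<^sub>R axis i 1)
        - t *\<^sub>R partial j ?g x)"
    have axis_sum: "(\<Sum>k\<in>UNIV. (axis i 1 $ k) *\<^sub>R partial k f y) = ?g y" for y
    proof -
      have "(\<Sum>k\<in>UNIV. (axis i 1 $ k) *\<^sub>R partial k f y) = (\<Sum>k\<in>UNIV. if k = i then partial k f y else 0)"
        by (intro sum.cong) (auto simp: axis_def)
      then show ?thesis by simp
    qed
    have der: "(\<phi> has_vector_derivative \<phi>' s) (at s within {0..t})" for s
    proof -
      have "((\<lambda>s. s *\<^sub>R (t *\<^sub>R partial j ?g x)) has_vector_derivative t *\<^sub>R partial j ?g x) (at s within {0..t})"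
        by (auto intro!: derivative_eq_intros)
      then show ?thesis
        unfolding \<phi>_def \<phi>'_def
        using C_infinity_along_line[OF f, of _ "axis i 1" s "{0..t}"]
        by (intro has_vector_derivative_diff) (simp_all only: axis_sum)
    qed
    have bd: "norm (\<phi>' s) \<le> e * t" if s: "s \<in> {0..t}" for s
    proof -
      let ?u = "t *\<^sub>R axis j 1 + s *\<^sub>R axis i 1 :: real^'n" and ?v = "s *\<^sub>R axis i 1 :: real^'n"
      have nu: "norm ?u \<le> 2 * t" using s t norm_triangle_ineq[of "t *\<^sub>R axis j (1::real) :: real^'n" "s *\<^sub>R axis i 1"]
        by simp
      have nv: "norm ?v \<le> t" using s by simp
      have D: "?D ?u - ?D ?v = t *\<^sub>R partial j ?g x"
        using lin by (simp add: linear_add linear_scale partial_def)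
      have 1: "norm (?g (x + ?u) - ?g x - ?D ?u) \<le> e / 3 * norm ?u"
        using d(2)[of "x + ?u"] nu t by simp
      have 2: "norm (?g (x + ?v) - ?g x - ?D ?v) \<le> e / 3 * norm ?v"
        using d(2)[of "x + ?v"] nv t by simp
      have "\<phi>' s = (?g (x + ?u) - ?g x - ?D ?u) - (?g (x + ?v) - ?g x - ?D ?v)"
        using D by (simp add: \<phi>'_def add.assoc algebra_simps)
      then have "norm (\<phi>' s) \<le> e / 3 * norm ?u + e / 3 * norm ?v"
        using 1 2 norm_triangle_ineq4[of "?g (x + ?u) - ?g x - ?D ?u" "?g (x + ?v) - ?g x - ?D ?v"]
        by simp
      also have "\<dots> \<le> e / 3 * (2 * t) + e / 3 * t"
        using nu nv e by (intro add_mono mult_left_mono) auto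
      finally show ?thesis by simp
    qed
    have "norm (\<phi> t - \<phi> 0) \<le> (e * t) * norm (t - 0)"
    proof (rule differentiable_bound[of "{0..t}" \<phi> "\<lambda>s h. h *\<^sub>R \<phi>' s"])
      show "convex {0..t}" by simp
      show "(\<phi> has_derivative (\<lambda>h. h *\<^sub>R \<phi>' s)) (at s within {0..t})" for s
        using der[of s] by (simp add: has_vector_derivative_def)
      show "onorm (\<lambda>h. h *\<^sub>R \<phi>' s) \<le> e * t" if "s \<in> {0..t}" for s
        using bd[OF that] by (intro onorm_le) (simp add: mult.commute mult_left_mono)
    qed (use t in auto)
    then show "norm (f (x + t *\<^sub>R axis i 1 + t *\<^sub>R axis j 1) - f (x + t *\<^sub>R axis i 1)
       - f (x + t *\<^sub>R axis j 1) + f x - (t * t) *\<^sub>R partial j (partial i f) x) \<le> e * (t * t)"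
      using t by (simp add: \<phi>_def algebra_simps)
  qed
qed

lemma partial_commute:
  assumes f: "C_infinity f"
  shows "partial i (partial j f) = partial j (partial i f)"
proof
  fix x
  have "norm (partial i (partial j f) x - partial j (partial i f) x) \<le> e" if "e > 0" for e
  proof -
    have e: "e / 2 > 0" using that by simp
    from mixed_difference_quotient[OF f e, of x i j] obtain d1 where d1: "d1 > 0"
      "\<And>t. 0 < t \<Longrightarrow> t < d1 \<Longrightarrow> norm (f (x + t *\<^sub>R axis i 1 + t *\<^sub>R axis j 1) - f (x + t *\<^sub>R axis i 1)
       - f (x + t *\<^sub>R axis j 1) + f x - (t * t) *\<^sub>R partial j (partial i f) x) \<le> e / 2 * (t * t)"
      by blast
    from mixed_difference_quotient[OF f e, of x j i] obtain d2 where d2: "d2 > 0"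
      "\<And>t. 0 < t \<Longrightarrow> t < d2 \<Longrightarrow> norm (f (x + t *\<^sub>R axis j 1 + t *\<^sub>R axis i 1) - f (x + t *\<^sub>R axis j 1)
       - f (x + t *\<^sub>R axis i 1) + f x - (t * t) *\<^sub>R partial i (partial j f) x) \<le> e / 2 * (t * t)"
      by blast
    define t where "t = min d1 d2 / 2"
    have t: "0 < t" "t < d1" "t < d2" using d1 d2 by (auto simp: t_def)
    let ?P = "f (x + t *\<^sub>R axis i 1 + t *\<^sub>R axis j 1) - f (x + t *\<^sub>R axis i 1)
       - f (x + t *\<^sub>R axis j 1) + f x"
    have 1: "norm (?P - (t * t) *\<^sub>R partial j (partial i f) x) \<le> e / 2 * (t * t)"
      using d1 t by blast
    have 2: "norm (?P - (t * t) *\<^sub>R partial i (partial j f) x) \<le> e / 2 * (t * t)"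
      using d2(2)[of t] t by (simp add: algebra_simps)
    have eq: "(t * t) *\<^sub>R (partial i (partial j f) x - partial j (partial i f) x)
        = (?P - (t * t) *\<^sub>R partial j (partial i f) x) - (?P - (t * t) *\<^sub>R partial i (partial j f) x)"
      by (simp add: algebra_simps)
    have "norm ((t * t) *\<^sub>R (partial i (partial j f) x - partial j (partial i f) x))
        \<le> e / 2 * (t * t) + e / 2 * (t * t)"
      unfolding eq by (rule order_trans[OF norm_triangle_ineq4 add_mono[OF 1 2]])
    then have "(t * t) * norm (partial i (partial j f) x - partial j (partial i f) x)
        \<le> (t * t) * e"
      by (simp add: mult.commute)
    then show ?thesis using t by (simp add: mult_le_cancel_left)
  qed
  then have "norm (partial i (partial j f) x - partial j (partial i f) x) \<le> 0"
    by (metis add_0 field_le_epsilon)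
  then show "partial i (partial j f) x = partial j (partial i f) x" by simp
qed

lemma partial_iter_partial:
  assumes "C_infinity f"
  shows "iter_partial js (partial i f) = partial i (iter_partial js f)"
  by (induction js) (simp_all add: iter_partial_Cons partial_commute assms C_infinity_iter_partial)

lemma iter_partial_perm:
  assumes "C_infinity f" "mset xs = mset ys"
  shows "iter_partial xs f = iter_partial ys f"
  using assms(2)
proof (induction xs arbitrary: ys)
  case (Cons x xs)
  then have "x \<in> set ys" by (metis list.set_intros(1) set_mset_mset)
  then obtain ys1 ys2 where ys: "ys = ys1 @ x # ys2" by (meson split_list)
  with Cons have "iter_partial xs f = iter_partial (ys1 @ ys2) f" by simp
  then show ?case
    by (simp add: ys iter_partial_Cons iter_partial_append partial_iter_partial
        C_infinity_iter_partial assms)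
qed simp

section \<open>Multi-indices and lists of directions\<close>

text \<open>Every multi-index arises from a list of directions, so statements about \<open>\<partial>\<^sup>\<alpha>\<close> can be proved by
  induction on lists.\<close>

definition list_index :: "'n::finite list \<Rightarrow> nat^'n" where
  "list_index is = (\<chi> i. count_list is i)"

lemma multi_order_list_index: "multi_order (list_index is) = length is"
  unfolding multi_order_def list_index_def
  by (simp add: sum_count_set)

text \<open>As derivatives commute, the list chosen in the definition of \<open>multi_partial\<close> may be replaced by
  any other with the same multiplicities.\<close>

lemma multi_partial_list_index:
  assumes "C_infinity f"
  shows "multi_partial (list_index is) f = iter_partial is f"
proof -
  define js where "js = (SOME js. \<forall>i. count_list js i = list_index is $ i)"
  have "\<exists>js. \<forall>i. count_list js i = list_index is $ i"
    by (rule exI[of _ "is"]) (simp add: list_index_def)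
  then have "\<forall>i. count_list js i = list_index is $ i"
    unfolding js_def by (rule someI_ex)
  then have "mset js = mset is"
    by (intro multiset_eqI) (simp add: list_index_def count_mset)
  then have "iter_partial js f = iter_partial is f"
    by (rule iter_partial_perm[OF assms])
  then show ?thesis by (simp add: multi_partial_def js_def)
qed

lemma list_index_surj: "\<exists>is. list_index is = \<alpha>"
proof -
  have "\<exists>M. \<forall>i. count M i = \<alpha> $ i"
    by (rule exI[of _ "Abs_multiset (\<lambda>i. \<alpha> $ i)"]) simp
  then obtain M where M: "\<And>i. count M i = \<alpha> $ i" by blast
  obtain js where "mset js = M" using ex_mset by blast
  with M have "list_index js = \<alpha>" by (auto simp: list_index_def vec_eq_iff count_mset)
  then show ?thesis by blast
qed

lemma finite_multi_order: "finite {\<alpha>::nat^'n::finite. multi_order \<alpha> \<le> k}"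
proof -
  have "{\<alpha>::nat^'n. multi_order \<alpha> \<le> k} \<subseteq> list_index ` {is. set is \<subseteq> UNIV \<and> length is \<le> k}"
  proof
    fix \<alpha> :: "nat^'n" assume "\<alpha> \<in> {\<alpha>. multi_order \<alpha> \<le> k}"
    moreover obtain js where "list_index js = \<alpha>" using list_index_surj by blast
    ultimately show "\<alpha> \<in> list_index ` {is. set is \<subseteq> UNIV \<and> length is \<le> k}"
      by (auto simp: multi_order_list_index)
  qed
  then show ?thesis by (rule finite_subset) (intro finite_imageI finite_lists_length_le, simp)
qed

section \<open>Test functions\<close>

lemma Cc_infinity_iff:
  "f \<in> Cc_infinity \<longleftrightarrow> C_infinity f \<and> (\<exists>R. \<forall>x. norm x > R \<longrightarrow> f x = 0)"
proof -
  have "compact (closure {x. f x \<noteq> 0}) \<longleftrightarrow> (\<exists>R. \<forall>x. norm x > R \<longrightarrow> f x = 0)"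
    unfolding compact_closure bounded_iff
  proof (intro iff_exI iffI allI impI ballI)
    fix R and x :: "real^'a" assume "\<forall>x\<in>{x. f x \<noteq> 0}. norm x \<le> R" "R < norm x"
    then show "f x = 0" by (meson linorder_not_le mem_Collect_eq)
  next
    fix R and x :: "real^'a" assume "\<forall>x. R < norm x \<longrightarrow> f x = 0" "x \<in> {x. f x \<noteq> 0}"
    then show "norm x \<le> R" by (meson linorder_not_le mem_Collect_eq)
  qed
  then show ?thesis by (simp add: Cc_infinity_def)
qed

lemma Cc_infinityD: "f \<in> Cc_infinity \<Longrightarrow> C_infinity f"
  by (simp add: Cc_infinity_def)

lemma Cc_infinity_add: "f \<in> Cc_infinity \<Longrightarrow> g \<in> Cc_infinity \<Longrightarrow> (\<lambda>x. f x + g x) \<in> Cc_infinity"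
proof (unfold Cc_infinity_iff, elim conjE exE, intro conjI)
  fix R S assume "\<forall>x. R < norm x \<longrightarrow> f x = 0" "\<forall>x. S < norm x \<longrightarrow> g x = 0"
  then show "\<exists>R. \<forall>x. R < norm x \<longrightarrow> f x + g x = 0"
    by (intro exI[of _ "max R S"]) auto
qed (rule C_infinity_add)

lemma Cc_infinity_mult_left: "f \<in> Cc_infinity \<Longrightarrow> C_infinity g \<Longrightarrow> (\<lambda>x. f x * g x) \<in> Cc_infinity"
  by (auto simp: Cc_infinity_iff C_infinity_mult)

lemma Cc_infinity_cmult: "f \<in> Cc_infinity \<Longrightarrow> (\<lambda>x. c * f x) \<in> Cc_infinity"
  using Cc_infinity_mult_left[OF _ C_infinity_const[of c]] by (simp add: mult.commute)

lemma Cc_infinity_translate: "f \<in> Cc_infinity \<Longrightarrow> (\<lambda>x. f (x + h)) \<in> Cc_infinity"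
proof (unfold Cc_infinity_iff, elim conjE exE, intro conjI)
  fix R assume R: "\<forall>x. R < norm x \<longrightarrow> f x = 0"
  have "R < norm (x + h)" if "R + norm h < norm x" for x
    using that norm_triangle_ineq4[of "x + h" h] by simp
  with R show "\<exists>R. \<forall>x. R < norm x \<longrightarrow> f (x + h) = 0"
    by (intro exI[of _ "R + norm h"]) auto
qed (rule C_infinity_translate)

lemma Cc_infinity_partial:
  assumes "f \<in> Cc_infinity" shows "partial i f \<in> Cc_infinity"
proof -
  from assms obtain R where R: "\<And>x. R < norm x \<Longrightarrow> f x = 0" by (auto simp: Cc_infinity_iff)
  have "partial i f x = 0" if x: "R < norm x" for x
  proof -
    have "open {y::real^'a. R < norm y}" by (intro open_Collect_less continuous_intros)
    then have "(f has_derivative (\<lambda>h. 0)) (at x)"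
      by (rule has_derivative_transform_within_open[OF has_derivative_const[of 0]])
        (use R x in auto)
    from partial_eqI[OF this] show ?thesis by simp
  qed
  with assms show ?thesis by (auto simp: Cc_infinity_iff C_infinity_partial)
qed

lemma Cc_infinity_iter_partial: "f \<in> Cc_infinity \<Longrightarrow> iter_partial js f \<in> Cc_infinity"
  by (induction js) (auto simp: iter_partial_Cons Cc_infinity_partial)

lemma Cc_infinity_bounded:
  assumes "f \<in> Cc_infinity" shows "\<exists>M\<ge>0. \<forall>x. norm (f x) \<le> M"
proof -
  from assms obtain R where R: "\<And>x. R < norm x \<Longrightarrow> f x = 0" by (auto simp: Cc_infinity_iff)
  have "compact (f ` cball 0 R)"
    using C_infinity_continuous[OF Cc_infinityD[OF assms]]
    by (intro compact_continuous_image) (auto intro: continuous_on_subset)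
  then obtain M where M: "\<And>y. y \<in> f ` cball 0 R \<Longrightarrow> norm y \<le> M"
    using compact_imp_bounded bounded_iff by metis
  have "norm (f x) \<le> max M 0" for x
    using M[of "f x"] R[of x] by (cases "R < norm x") (auto simp: le_max_iff_disj)
  then show ?thesis by (intro exI[of _ "max M 0"]) auto
qed

section \<open>Moving a derivative off a test function\<close>

text \<open>The product rule in the form \<open>\<rho> \<partial>\<^sub>i \<psi> = \<partial>\<^sub>i (\<rho> \<psi>) - (\<partial>\<^sub>i \<rho>) \<psi>\<close> moves a smooth factor inside a
  derivative.  Iterating it gives the adjoint form of the Leibniz rule, with coefficients \<open>r\<close> that
  are the same for all \<open>\<phi>\<close>.\<close>

lemma smooth_factor_inside_derivative:
  fixes \<rho> :: "real^'n::finite \<Rightarrow> complex"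
  assumes "\<rho> \<in> Cc_infinity"
  shows "\<exists>L. (\<forall>(js, r)\<in>set L. length js \<le> length is \<and> r \<in> Cc_infinity) \<and>
    (\<forall>\<phi> x. C_infinity \<phi> \<longrightarrow> \<rho> x * iter_partial is \<phi> x
        = (\<Sum>(js, r)\<leftarrow>L. iter_partial js (\<lambda>y. r y * \<phi> y) x))"
  using assms
proof (induction "is" arbitrary: \<rho>)
  case Nil
  then show ?case by (intro exI[of _ "[([], \<rho>)]"]) simp
next
  case (Cons i "is")
  from Cons.IH[OF Cons.prems] obtain L where
    L: "\<forall>(js, r)\<in>set L. length js \<le> length is \<and> r \<in> Cc_infinity"
    "\<And>\<phi> x. C_infinity \<phi> \<Longrightarrow> \<rho> x * iter_partial is \<phi> x
        = (\<Sum>(js, r)\<leftarrow>L. iter_partial js (\<lambda>y. r y * \<phi> y) x)" by blast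
  from Cons.IH[OF Cc_infinity_partial[OF Cons.prems, of i]] obtain L' where
    L': "\<forall>(js, r)\<in>set L'. length js \<le> length is \<and> r \<in> Cc_infinity"
    "\<And>\<phi> x. C_infinity \<phi> \<Longrightarrow> partial i \<rho> x * iter_partial is \<phi> x
        = (\<Sum>(js, r)\<leftarrow>L'. iter_partial js (\<lambda>y. r y * \<phi> y) x)" by blast
  (* The two halves of the list come from the two terms of the product rule. *)
  define M where "M = map (\<lambda>(js, r). (i # js, r)) L @ map (\<lambda>(js, r). (js, \<lambda>y. (-1) * r y)) L'"
  have scale: "iter_partial js (\<lambda>y. (-1) * g y) x = - iter_partial js g x" if "C_infinity g" for js x
    and g :: "real^'n \<Rightarrow> complex"
  proof (induction js arbitrary: x)
    case (Cons j js)
    have "iter_partial js (\<lambda>y. (-1) * g y) = (\<lambda>y. (-1) * iter_partial js g y)"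
      using Cons by auto
    then show ?case
      by (simp only: iter_partial_Cons, subst partial_mult)
        (auto simp: partial_const intro: C_infinity_differentiable[OF C_infinity_iter_partial[OF that]])
  qed simp
  have sum_diff: "partial i (\<lambda>x. \<Sum>(js, r)\<leftarrow>K. iter_partial js (\<lambda>y. r y * \<phi> y) x)
       = (\<lambda>x. \<Sum>(js, r)\<leftarrow>K. iter_partial (i # js) (\<lambda>y. r y * \<phi> y) x) \<and>
      C_infinity (\<lambda>x. \<Sum>(js, r)\<leftarrow>K. iter_partial js (\<lambda>y. r y * \<phi> y) x)"
    if "\<forall>(js, r)\<in>set K. r \<in> Cc_infinity" "C_infinity \<phi>"
    for K and \<phi> :: "real^'n \<Rightarrow> complex"
    using that(1)
  proof (induction K)
    case Nil then show ?case by (simp add: partial_const C_infinity_const)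
  next
    case (Cons a K)
    obtain js r where a: "a = (js, r)" by (cases a)
    have "C_infinity (iter_partial js (\<lambda>y. r y * \<phi> y))"
      using Cons.prems that a
      by (auto intro!: C_infinity_iter_partial C_infinity_mult dest: Cc_infinityD)
    with Cons show ?case
      by (auto simp: a partial_add C_infinity_differentiable iter_partial_Cons C_infinity_add)
  qed
  show ?case
  proof (intro exI[of _ M] conjI allI impI)
    show "\<forall>(js, r)\<in>set M. length js \<le> length (i # is) \<and> r \<in> Cc_infinity"
      using L(1) L'(1) Cc_infinity_cmult[of _ "-1"] by (force simp: M_def)
    fix \<phi> :: "real^'n \<Rightarrow> complex" and x assume \<phi>: "C_infinity \<phi>"
    let ?\<psi> = "iter_partial is \<phi>"
    have \<psi>: "C_infinity ?\<psi>" by (rule C_infinity_iter_partial[OF \<phi>])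
    have L1: "\<forall>(js, r)\<in>set L. r \<in> Cc_infinity" "\<forall>(js, r)\<in>set L'. r \<in> Cc_infinity"
      using L(1) L'(1) by auto
    have "\<rho> x * partial i ?\<psi> x = partial i (\<lambda>x. \<rho> x * ?\<psi> x) x - partial i \<rho> x * ?\<psi> x"
      by (subst partial_mult)
        (auto simp: C_infinity_differentiable \<psi> Cc_infinityD[OF Cons.prems])
    also have "partial i (\<lambda>x. \<rho> x * ?\<psi> x) x = (\<Sum>(js, r)\<leftarrow>L. iter_partial (i # js) (\<lambda>y. r y * \<phi> y) x)"
      using sum_diff[OF L1(1) \<phi>] by (simp add: L(2)[OF \<phi>])
    also have "\<dots> - partial i \<rho> x * ?\<psi> x
        = \<dots> + - (\<Sum>(js, r)\<leftarrow>L'. iter_partial js (\<lambda>y. r y * \<phi> y) x)"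
      by (simp only: L'(2)[OF \<phi>] diff_conv_add_uminus)
    also have "- (\<Sum>(js, r)\<leftarrow>L'. iter_partial js (\<lambda>y. r y * \<phi> y) x) = (\<Sum>(js, r)\<leftarrow>L'. iter_partial js (\<lambda>y. ((-1) * r y) * \<phi> y) x)"
      using L1(2)
    proof (induction L')
      case (Cons a K)
      obtain js r where a: "a = (js, r)" by (cases a)
      have "C_infinity (\<lambda>y. r y * \<phi> y)"
        using Cons.prems \<phi> a by (auto intro!: C_infinity_mult dest: Cc_infinityD)
      from scale[OF this, of js x] Cons show ?case by (simp add: a)
    qed simp
    finally show "\<rho> x * iter_partial (i # is) \<phi> x
        = (\<Sum>(js, r)\<leftarrow>M. iter_partial js (\<lambda>y. r y * \<phi> y) x)"
      by (simp add: M_def iter_partial_Cons o_def case_prod_unfold)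
  qed
qed

section \<open>Bump functions\<close>

lemma poly_times_exp_tendsto_0:
  fixes P :: "real poly"
  assumes "c > 0"
  shows "((\<lambda>u. poly P u * exp (- c * u)) \<longlongrightarrow> 0) at_top"
  using assms
proof (induction P arbitrary: c)
  case 0
  then show ?case by simp
next
  case (pCons a p)
  have lin: "filterlim (\<lambda>u. b * u) at_top at_top" if "b > 0" for b :: real
    using that by (intro filterlim_tendsto_pos_mult_at_top[OF tendsto_const]) (auto simp: filterlim_ident)
  have c2: "c / 2 > 0" using pCons.prems by simp
  have e1: "((\<lambda>u. exp (- c * u)) \<longlongrightarrow> 0) at_top"
    using filterlim_compose[OF exp_at_bot, of "\<lambda>u. - (c * u)" at_top] lin[OF pCons.prems]
    by (simp add: filterlim_uminus_at_top)
  have "((\<lambda>u. (c / 2 * u) ^ 1 / exp (c / 2 * u)) \<longlongrightarrow> 0) at_top"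
    by (rule filterlim_compose[OF tendsto_power_div_exp_0 lin[OF c2]])
  then have "((\<lambda>u. (2 / c) * ((c / 2 * u) ^ 1 / exp (c / 2 * u))) \<longlongrightarrow> (2 / c) * 0) at_top"
    by (intro tendsto_intros)
  moreover have "(2 / c) * ((c / 2 * u) ^ 1 / exp (c / 2 * u)) = u * exp (- (c / 2) * u)" for u
    using pCons.prems by (simp add: exp_minus field_simps)
  ultimately have e2: "((\<lambda>u. u * exp (- (c / 2) * u)) \<longlongrightarrow> 0) at_top" by simp
  have "((\<lambda>u. a * exp (- c * u) + (u * exp (- (c / 2) * u)) * (poly p u * exp (- (c / 2) * u)))
      \<longlongrightarrow> a * 0 + 0 * 0) at_top"
    by (intro tendsto_add tendsto_mult tendsto_const e1 e2 pCons.IH[OF c2])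
  moreover have "exp (- c * u) = exp (- (c / 2) * u) * exp (- (c / 2) * u)" for u
    by (simp add: exp_add[symmetric])
  ultimately show ?case
    by (simp add: algebra_simps)
qed

text \<open>The functions \<open>P(1/t) exp (- c/t)\<close>, extended by zero to \<open>t \<le> 0\<close>, form a class closed under
  differentiation; for \<open>P = 1\<close> this is the classical smooth function that is flat at the origin.\<close>

definition flat :: "real poly \<Rightarrow> real \<Rightarrow> real \<Rightarrow> real" where
  "flat P c t = (if t > 0 then poly P (1 / t) * exp (- c * (1 / t)) else 0)"

definition flat_deriv :: "real \<Rightarrow> real poly \<Rightarrow> real poly" where
  "flat_deriv c P = [:0, 0, 1:] * (smult c P - pderiv P)"

lemma flat_has_derivative:
  assumes c: "c > 0"
  shows "(flat P c has_real_derivative flat (flat_deriv c P) c t) (at t)"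
proof -
  consider "t < 0" | "t = 0" | "t > 0" by linarith
  then show ?thesis
  proof cases
    case 1
    have "((\<lambda>t. 0) has_real_derivative 0) (at t)" by simp
    then have "(flat P c has_real_derivative 0) (at t)"
      by (rule DERIV_cong_ev[THEN iffD1, rotated -1, OF _ refl _ refl])
        (use 1 in \<open>auto simp: flat_def eventually_nhds intro!: exI[of _ "{..<0}"]\<close>)
    then show ?thesis using 1 by (simp add: flat_def)
  next
    case 3
    have d: "((\<lambda>t. poly P (1 / t) * exp (- c * (1 / t))) has_real_derivative
        poly (flat_deriv c P) (1 / t) * exp (- c * (1 / t))) (at t)"
      using 3 by (auto intro!: derivative_eq_intros DERIV_chain2[OF poly_DERIV]
          simp: flat_deriv_def field_simps power2_eq_square)
    have "(flat P c has_real_derivative poly (flat_deriv c P) (1 / t) * exp (- c * (1 / t))) (at t)"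
      by (rule DERIV_cong_ev[THEN iffD1, rotated -1, OF d refl _ refl])
        (use 3 in \<open>auto simp: flat_def eventually_nhds intro!: exI[of _ "{0<..}"]\<close>)
    then show ?thesis using 3 by (simp add: flat_def)
  next
    case 2
    have "((\<lambda>h. poly (P * [:0, 1:]) (inverse h) * exp (- c * inverse h)) \<longlongrightarrow> 0) (at_right 0)"
      by (rule filterlim_compose[OF poly_times_exp_tendsto_0[OF c] filterlim_inverse_at_top_right])
    then have R: "((\<lambda>h. flat P c h / h) \<longlongrightarrow> 0) (at_right 0)"
      by (rule Lim_transform_eventually)
        (auto simp: eventually_at_right_less flat_def inverse_eq_divide field_simps
          intro: eventually_mono[OF eventually_at_right_less[of 0]])
    have "((\<lambda>h. 0) \<longlongrightarrow> (0::real)) (at_left 0)" by simp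
    then have L: "((\<lambda>h. flat P c h / h) \<longlongrightarrow> 0) (at_left 0)"
      by (rule Lim_transform_eventually)
        (auto simp: flat_def eventually_at_left_field intro!: exI[of _ "-1"])
    have "((\<lambda>h. flat P c h / h) \<longlongrightarrow> 0) (at 0)"
      using L R filterlim_at_split by blast
    then show ?thesis
      using 2 by (simp add: DERIV_def flat_def)
  qed
qed

lemma C_infinity_flat:
  fixes i :: "'n::finite"
  assumes "c > 0"
  shows "C_infinity (\<lambda>x::real^'n. of_real (flat P c (\<sigma> * x $ i + b)))"
proof -
  let ?F = "\<lambda>P x. of_real (flat P c (\<sigma> * (x::real^'n) $ i + b)) :: complex"
  have der: "(?F P has_derivative (\<lambda>h. of_real (flat (flat_deriv c P) c (\<sigma> * x $ i + b) * (\<sigma> * h $ i))))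
      (at x)" for P x
  proof -
    have inner: "((\<lambda>x::real^'n. \<sigma> * x $ i + b) has_derivative (\<lambda>h. \<sigma> * h $ i)) (at x)"
      by (auto intro!: derivative_eq_intros bounded_linear_imp_has_derivative)
    have "(flat P c has_derivative (\<lambda>h. flat (flat_deriv c P) c (\<sigma> * x $ i + b) * h)) (at (\<sigma> * x $ i + b))"
      using flat_has_derivative[OF assms] by (simp add: has_field_derivative_def)
    from has_derivative_compose[OF inner this] show ?thesis by (rule has_derivative_of_real)
  qed
  have part: "partial j (?F P) = (\<lambda>x. of_real (if i = j then \<sigma> else 0) * ?F (flat_deriv c P) x)" for j P
    by (rule ext, subst partial_eqI[OF der]) (auto simp: axis_def)
  have "C_k k (?F P)" for k
  proof (induction k arbitrary: P)
    case 0
    then show ?case using der by (auto simp: C_k_0 differentiable_def)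
  next
    case (Suc k)
    show ?case unfolding C_k_Suc
    proof (intro conjI allI)
      show "?F P differentiable (at x)" for x using der by (auto simp: differentiable_def)
      have "C_k k (\<lambda>x::real^'n. complex_of_real (if i = j then \<sigma> else 0))" for j
        using C_infinity_const C_infinity_iff_C_k by blast
      from C_k_mult[OF this Suc.IH] show "C_k k (partial j (?F P))" for j
        unfolding part .
    qed
  qed
  then show ?thesis by (simp add: C_infinity_iff_C_k)
qed

lemma C_infinity_prod:
  "(\<And>i. i \<in> I \<Longrightarrow> C_infinity (f i)) \<Longrightarrow> C_infinity (\<lambda>x. \<Prod>i\<in>I. f i x)"
  by (induction I rule: infinite_finite_induct) (simp_all add: C_infinity_const C_infinity_mult)

text \<open>Letting the decay rate of \<open>exp (- c / t)\<close> tend to zero makes the bump fill up its support.\<close>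

lemma test_functions_approximate_box:
  fixes a b :: "real^'n::finite"
  shows "\<exists>\<phi>. (\<forall>k::nat. \<phi> k \<in> Cc_infinity) \<and> (\<forall>k x. norm (\<phi> k x) \<le> indicator (box a b) x)
    \<and> (\<forall>x. (\<lambda>k. \<phi> k x) \<longlonglongrightarrow> indicator (box a b) x)"
proof -
  define \<phi> :: "nat \<Rightarrow> real^'n \<Rightarrow> complex" where "\<phi> = (\<lambda>k x. \<Prod>i\<in>UNIV.
      of_real (flat 1 (1 / Suc k) (1 * x $ i + (- a $ i))) * of_real (flat 1 (1 / Suc k) ((-1) * x $ i + b $ i)))"
  have outside: "\<phi> k x = 0" if "x \<notin> box a b" for k x
  proof -
    from that obtain i where "\<not> (a $ i < x $ i \<and> x $ i < b $ i)" by (auto simp: mem_box_cart)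
    then have "of_real (flat 1 (1 / Suc k) (1 * x $ i + (- a $ i))) *
        complex_of_real (flat 1 (1 / Suc k) ((-1) * x $ i + b $ i)) = 0"
      by (auto simp: flat_def)
    then show ?thesis unfolding \<phi>_def by (intro prod_zero) auto
  qed
  have smooth: "C_infinity (\<phi> k)" for k
    unfolding \<phi>_def by (intro C_infinity_prod C_infinity_mult C_infinity_flat) auto
  have "bounded (box a b)" by simp
  then obtain R where "\<And>x. x \<in> box a b \<Longrightarrow> norm x \<le> R" unfolding bounded_iff by blast
  with outside have "\<forall>x. R < norm x \<longrightarrow> \<phi> k x = 0" for k by (meson linorder_not_le)
  with smooth have "\<phi> k \<in> Cc_infinity" for k by (auto simp: Cc_infinity_iff)
  moreover have le1: "norm (flat 1 c t) \<le> 1" if "c > 0" for c t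
    using that by (auto simp: flat_def)
  have "norm (\<phi> k x) \<le> 1" for k x
    unfolding \<phi>_def prod_norm[symmetric] norm_mult norm_of_real
    by (intro prod_le_1) (auto simp: norm_mult intro!: mult_le_one le1[simplified])
  then have "norm (\<phi> k x) \<le> indicator (box a b) x" for k x
    using outside by (cases "x \<in> box a b") auto
  moreover have "(\<lambda>k. \<phi> k x) \<longlonglongrightarrow> indicator (box a b) x" for x
  proof (cases "x \<in> box a b")
    case True
    have lim: "(\<lambda>k. flat 1 (1 / Suc k) t) \<longlonglongrightarrow> 1" if "t > 0" for t
    proof -
      have "(\<lambda>k. exp (- (1 / real (Suc k)) * (1 / t))) \<longlonglongrightarrow> exp (- 0 * (1 / t))"
        by (intro tendsto_intros LIMSEQ_Suc[OF lim_1_over_n])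
      then show ?thesis using that by (simp add: flat_def)
    qed
    have "(\<lambda>k. \<phi> k x) \<longlonglongrightarrow> (\<Prod>i\<in>(UNIV::'n set). of_real 1 * of_real 1)"
      unfolding \<phi>_def using True
      by (intro tendsto_prod tendsto_mult tendsto_of_real lim) (auto simp: mem_box_cart)
    then show ?thesis using True by simp
  qed (simp add: outside)
  ultimately show ?thesis by blast
qed

section \<open>Locally integrable functions\<close>

lemma locally_integrable_iff_balls:
  "locally_integrable f \<longleftrightarrow> (\<forall>R. f absolutely_integrable_on cball 0 R)"
proof
  assume *: "\<forall>R. f absolutely_integrable_on cball 0 R"
  show "locally_integrable f"
    unfolding locally_integrable_def
  proof (intro allI impI)
    fix K :: "(real^'a) set" assume K: "compact K"
    then have "bounded K" by (rule compact_imp_bounded)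
    then obtain R where R: "\<And>x. x \<in> K \<Longrightarrow> norm x \<le> R" unfolding bounded_iff by blast
    show "f absolutely_integrable_on K"
    proof (rule set_integrable_subset)
      show "set_integrable lebesgue (cball 0 R) f" using * by blast
      show "K \<in> sets lebesgue" using K by (simp add: compact_imp_closed)
      show "K \<subseteq> cball 0 R" using R by auto
    qed
  qed
qed (simp add: locally_integrable_def)

lemma locally_integrable_measurable:
  assumes "locally_integrable f"
  shows "f \<in> borel_measurable lebesgue"
proof (rule borel_measurable_LIMSEQ_metric)
  show "(\<lambda>x. indicator (cball 0 (real n)) x *\<^sub>R f x) \<in> borel_measurable lebesgue" for n
    using assms unfolding locally_integrable_iff_balls set_integrable_def by (auto dest: borel_measurable_integrable)
  fix x :: "real^'a"
  have "\<forall>\<^sub>F n in sequentially. indicator (cball 0 (real n)) x *\<^sub>R f x = f x"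
    using eventually_ge_at_top[of "nat \<lceil>norm x\<rceil>"]
    by eventually_elim (auto simp: nat_le_iff ceiling_le_iff)
  then show "(\<lambda>n. indicator (cball 0 (real n)) x *\<^sub>R f x) \<longlonglongrightarrow> f x"
    by (rule tendsto_eventually)
qed

lemma locally_integrable_mult_integrable:
  fixes f \<phi> :: "real^'n::finite \<Rightarrow> complex"
  assumes f: "locally_integrable f" and m: "\<phi> \<in> borel_measurable lebesgue"
    and bd: "\<And>x. norm (\<phi> x) \<le> M" and supp: "\<And>x. R < norm x \<Longrightarrow> \<phi> x = 0"
  shows "integrable lebesgue (\<lambda>x. f x * \<phi> x)"
proof (rule Bochner_Integration.integrable_bound)
  show "integrable lebesgue (\<lambda>x. M *\<^sub>R (indicator (cball 0 R) x *\<^sub>R f x))"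
    using f unfolding locally_integrable_iff_balls set_integrable_def by (intro integrable_scaleR_right) auto
  show "(\<lambda>x. f x * \<phi> x) \<in> borel_measurable lebesgue"
    using locally_integrable_measurable[OF f] m by measurable
  have "norm (f x * \<phi> x) \<le> norm (M *\<^sub>R (indicator (cball 0 R) x *\<^sub>R f x))" for x
  proof (cases "R < norm x")
    case False
    have "norm (f x) * norm (\<phi> x) \<le> norm (f x) * \<bar>M\<bar>"
      using bd[of x] by (intro mult_left_mono) auto
    with False show ?thesis by (simp add: norm_mult mult.commute)
  qed (simp add: supp)
  then show "AE x in lebesgue. norm (f x * \<phi> x) \<le> norm (M *\<^sub>R (indicator (cball 0 R) x *\<^sub>R f x))"
    by simp
qed

lemma C_infinity_measurable: "C_infinity f \<Longrightarrow> f \<in> borel_measurable borel"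
  using C_infinity_continuous borel_measurable_continuous_onI by blast

lemma borel_imp_lebesgue_measurable:
  "f \<in> borel_measurable borel \<Longrightarrow> f \<in> borel_measurable lebesgue"
  by (simp add: measurable_completion)

lemma integrable_mult_test:
  assumes "locally_integrable f" "\<phi> \<in> Cc_infinity"
  shows "integrable lebesgue (\<lambda>x. f x * \<phi> x)"
proof -
  obtain M where "\<And>x. norm (\<phi> x) \<le> M" using Cc_infinity_bounded[OF assms(2)] by blast
  moreover obtain R where "\<And>x. R < norm x \<Longrightarrow> \<phi> x = 0" using assms(2) by (auto simp: Cc_infinity_iff)
  ultimately show ?thesis
    using assms C_infinity_measurable[OF Cc_infinityD[OF assms(2)]]
    by (intro locally_integrable_mult_integrable) (auto intro: borel_imp_lebesgue_measurable)
qed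

lemma locally_integrable_mult_test:
  assumes f: "locally_integrable f" and \<phi>: "\<phi> \<in> Cc_infinity"
  shows "locally_integrable (\<lambda>x. \<phi> x * f x)"
  unfolding locally_integrable_iff_balls set_integrable_def
proof
  fix R
  have "integrable lebesgue (\<lambda>x. indicator (cball 0 R) x *\<^sub>R (f x * \<phi> x))"
    using integrable_mult_test[OF assms]
    by (rule integrable_mult_indicator[rotated]) (simp add: lmeasurable_cball fmeasurableD)
  then show "integrable lebesgue (\<lambda>x. indicator (cball 0 R) x *\<^sub>R (\<phi> x * f x))"
    by (simp add: mult.commute)
qed

lemma locally_integrable_cong_AE:
  assumes f: "locally_integrable f" and g: "g \<in> borel_measurable lebesgue"
    and eq: "AE x in lebesgue. f x = g x"
  shows "locally_integrable g"
  unfolding locally_integrable_iff_balls set_integrable_def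
proof
  fix R
  have m: "f \<in> borel_measurable lebesgue" by (rule locally_integrable_measurable[OF f])
  have "(indicator (cball 0 R) :: _ \<Rightarrow> real) \<in> borel_measurable lebesgue"
    by (intro borel_imp_lebesgue_measurable borel_measurable_indicator) auto
  then have "integrable lebesgue (\<lambda>x. indicator (cball 0 R) x *\<^sub>R f x) \<longleftrightarrow>
      integrable lebesgue (\<lambda>x. indicator (cball 0 R) x *\<^sub>R g x)"
    using eq m g by (intro integrable_cong_AE borel_measurable_scaleR) auto
  then show "integrable lebesgue (\<lambda>x. indicator (cball 0 R) x *\<^sub>R g x)"
    using f unfolding locally_integrable_iff_balls set_integrable_def by blast
qed

lemma locally_integrable_add:
  assumes "locally_integrable f" "locally_integrable g"
  shows "locally_integrable (\<lambda>x. f x + g x)"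
  using assms unfolding locally_integrable_iff_balls by (auto intro: set_integral_add(1))

lemma locally_integrable_cmult:
  assumes "locally_integrable f"
  shows "locally_integrable (\<lambda>x. c * f x)"
  using assms unfolding locally_integrable_iff_balls by auto

lemma borel_representative:
  fixes f :: "real^'n::finite \<Rightarrow> complex"
  assumes "f \<in> borel_measurable lebesgue"
  shows "\<exists>g\<in>borel_measurable borel. AE x in lebesgue. f x = g x"
proof -
  have "(\<lambda>x. Re (f x)) \<in> borel_measurable lebesgue" "(\<lambda>x. Im (f x)) \<in> borel_measurable lebesgue"
    using assms by measurable
  from this[THEN completion_ex_borel_measurable_real] obtain r s
    where r: "r \<in> borel_measurable lborel" "AE x in lborel. Re (f x) = r x"
      and s: "s \<in> borel_measurable lborel" "AE x in lborel. Im (f x) = s x" by blast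
  show ?thesis
  proof
    show "(\<lambda>x. Complex (r x) (s x)) \<in> borel_measurable borel"
      using r s by (simp add: borel_measurable_complex_iff)
    from r(2) s(2) have "AE x in lborel. f x = Complex (r x) (s x)"
      by eventually_elim (simp add: complex_eq_iff)
    then show "AE x in lebesgue. f x = Complex (r x) (s x)" by (rule AE_completion)
  qed
qed

section \<open>A function orthogonal to all test functions vanishes\<close>

text \<open>The positive and the negative part of \<open>v\<close> are densities of two measures that agree on boxes,
  which generate the Borel sets and are closed under intersection.\<close>

lemma AE_zero_if_box_integrals_zero:
  fixes v :: "real^'n::finite \<Rightarrow> real"
  assumes v: "v \<in> borel_measurable borel"
    and int: "\<And>a b. integrable lborel (\<lambda>x. indicator (box a b) x * v x)"
    and zero: "\<And>a b. (LINT x|lborel. indicator (box a b) x * v x) = 0"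
  shows "AE x in lborel. v x = 0"
proof -
  let ?P = "density lborel (\<lambda>x. ennreal (v x))" and ?N = "density lborel (\<lambda>x. ennreal (- v x))"
  have emP: "emeasure ?P (box a b) = (\<integral>\<^sup>+x. ennreal (indicator (box a b) x * v x) \<partial>lborel)" for a b
    using v by (subst emeasure_density) (auto intro!: nn_integral_cong simp: indicator_def)
  have emN: "emeasure ?N (box a b) = (\<integral>\<^sup>+x. ennreal (- (indicator (box a b) x * v x)) \<partial>lborel)" for a b
    using v by (subst emeasure_density) (auto intro!: nn_integral_cong simp: indicator_def)
  have fin: "emeasure ?P (box a b) < \<infinity>" "emeasure ?N (box a b) < \<infinity>" for a b
    unfolding emP emN using int[of a b]
    by (auto simp: real_integrable_def less_top)
  have eq: "emeasure ?P (box a b) = emeasure ?N (box a b)" for a b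
  proof -
    have "enn2real (emeasure ?P (box a b)) - enn2real (emeasure ?N (box a b)) = 0"
      unfolding emP emN using zero[of a b] real_lebesgue_integral_def[OF int[of a b]] by simp
    with fin[of a b] show ?thesis
      by (metis eq_iff_diff_eq_0 ennreal_enn2real infinity_ennreal_def)
  qed
  have "?P = ?N"
  proof (rule measure_eqI_generator_eq)
    let ?E = "range (\<lambda>(a, b). box a b::(real^'n) set)"
    show "Int_stable ?E"
      by (auto simp: Int_stable_def box_Int_box)
    show "?E \<subseteq> Pow UNIV" "sets ?P = sigma_sets UNIV ?E" "sets ?N = sigma_sets UNIV ?E"
      by (simp_all add: borel_eq_box)
    let ?A = "\<lambda>n::nat. box (- (real n *\<^sub>R One)) (real n *\<^sub>R One) :: (real^'n) set"
    show "range ?A \<subseteq> ?E" "(\<Union>i. ?A i) = UNIV"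
      unfolding UN_box_eq_UNIV by auto
    show "emeasure ?P (?A i) \<noteq> \<infinity>" for i using fin by (metis less_irrefl)
    show "emeasure ?P X = emeasure ?N X" if "X \<in> ?E" for X
      using that eq by auto
  qed
  then have "AE x in lborel. ennreal (v x) = ennreal (- v x)"
    using v by (intro sigma_finite_measure.density_unique[OF sigma_finite_lborel]) auto
  then show ?thesis
    by eventually_elim (metis ennreal_eq_0_iff ennreal_inj linorder_le_cases neg_0_le_iff_le
        neg_le_0_iff_le order_antisym)
qed

theorem fundamental_lemma_variations:
  fixes u :: "real^'n::finite \<Rightarrow> complex"
  assumes u: "locally_integrable u"
    and orth: "\<And>\<phi>. \<phi> \<in> Cc_infinity \<Longrightarrow> (LINT x|lebesgue. u x * \<phi> x) = 0"
  shows "AE x in lebesgue. u x = 0"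
proof -
  have um: "u \<in> borel_measurable lebesgue" by (rule locally_integrable_measurable[OF u])
  have int: "integrable lebesgue (\<lambda>x. u x * indicator (box a b) x)" for a b
  proof -
    have "bounded (box a b)" by simp
    then obtain R where R: "\<And>x. x \<in> box a b \<Longrightarrow> norm x \<le> R" unfolding bounded_iff by blast
    show ?thesis
    proof (rule locally_integrable_mult_integrable[OF u, where M=1 and R=R])
      show "(indicator (box a b) :: _ \<Rightarrow> complex) \<in> borel_measurable lebesgue"
        by (intro borel_imp_lebesgue_measurable borel_measurable_indicator) auto
      show "norm (indicator (box a b) x :: complex) \<le> 1" for x
        by (simp add: indicator_def)
      show "indicator (box a b) x = (0 :: complex)" if "R < norm x" for x
        using R[of x] that by (force simp: indicator_def)
    qed
  qed
  have zero: "(LINT x|lebesgue. u x * indicator (box a b) x) = 0" for a b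
  proof -
    obtain \<phi> where \<phi>: "\<And>k::nat. \<phi> k \<in> Cc_infinity" "\<And>k x. norm (\<phi> k x) \<le> indicator (box a b) x"
      "\<And>x. (\<lambda>k. \<phi> k x) \<longlonglongrightarrow> indicator (box a b) x"
      using test_functions_approximate_box[of a b] by blast
    have "(\<lambda>k. LINT x|lebesgue. u x * \<phi> k x) \<longlonglongrightarrow> (LINT x|lebesgue. u x * indicator (box a b) x)"
    proof (rule integral_dominated_convergence[where w="\<lambda>x. norm (u x * indicator (box a b) x)"])
      show "(\<lambda>x. u x * indicator (box a b) x) \<in> borel_measurable lebesgue"
        using int by (rule borel_measurable_integrable)
      show "(\<lambda>x. u x * \<phi> k x) \<in> borel_measurable lebesgue" for k
        by (rule borel_measurable_integrable[OF integrable_mult_test[OF u \<phi>(1)]])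
      show "integrable lebesgue (\<lambda>x. norm (u x * indicator (box a b) x))"
        by (rule integrable_norm[OF int])
      show "AE x in lebesgue. (\<lambda>k. u x * \<phi> k x) \<longlonglongrightarrow> u x * indicator (box a b) x"
        by (intro AE_I2 tendsto_mult tendsto_const \<phi>(3))
      have "norm (u x * \<phi> k x) \<le> norm (u x * indicator (box a b) x)" for k x
        using \<phi>(2)[of k x] by (auto simp: norm_mult indicator_def intro!: mult_left_le split: if_splits)
      then show "AE x in lebesgue. norm (u x * \<phi> k x) \<le> norm (u x * indicator (box a b) x)" for k
        by simp
    qed
    moreover have "(LINT x|lebesgue. u x * \<phi> k x) = 0" for k by (rule orth[OF \<phi>(1)])
    ultimately show ?thesis by (simp add: LIMSEQ_const_iff)
  qed
  obtain w where w: "w \<in> borel_measurable borel" "AE x in lebesgue. u x = w x"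
    using borel_representative[OF um] by blast
  have wu: "integrable lborel (\<lambda>x. w x * indicator (box a b) x)"
    "(LINT x|lborel. w x * indicator (box a b) x) = 0" for a b
  proof -
    have wm: "(\<lambda>x. w x * indicator (box a b) x) \<in> borel_measurable lborel" using w(1) by simp
    have ae: "AE x in lebesgue. u x * indicator (box a b) x = w x * indicator (box a b) x"
      using w(2) by eventually_elim simp
    have m1: "(\<lambda>x. u x * indicator (box a b) x) \<in> borel_measurable lebesgue"
      using int by (rule borel_measurable_integrable)
    have m2: "(\<lambda>x. w x * indicator (box a b) x) \<in> borel_measurable lebesgue"
      using wm by (rule measurable_completion)
    show "integrable lborel (\<lambda>x. w x * indicator (box a b) x)"
      using integrable_cong_AE[OF m1 m2 ae] int wm by (simp add: integrable_completion)
    show "(LINT x|lborel. w x * indicator (box a b) x) = 0"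
      using integral_cong_AE[OF m1 m2 ae] zero wm by (simp add: integral_completion)
  qed
  have "AE x in lborel. Re (w x) = 0"
  proof (rule AE_zero_if_box_integrals_zero)
    fix a b
    have *: "Re (w x * indicator (box a b) x) = indicator (box a b) x * Re (w x)" for x
      by (simp add: indicator_def)
    show "integrable lborel (\<lambda>x. indicator (box a b) x * Re (w x))"
      using integrable_Re[OF wu(1)[of a b]] by (simp only: *)
    show "(LINT x|lborel. indicator (box a b) x * Re (w x)) = 0"
      using integral_Re[OF wu(1)[of a b]] wu(2)[of a b] by (simp only: *) simp
  qed (use w in measurable)
  moreover have "AE x in lborel. Im (w x) = 0"
  proof (rule AE_zero_if_box_integrals_zero)
    fix a b
    have *: "Im (w x * indicator (box a b) x) = indicator (box a b) x * Im (w x)" for x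
      by (simp add: indicator_def)
    show "integrable lborel (\<lambda>x. indicator (box a b) x * Im (w x))"
      using integrable_Im[OF wu(1)[of a b]] by (simp only: *)
    show "(LINT x|lborel. indicator (box a b) x * Im (w x)) = 0"
      using integral_Im[OF wu(1)[of a b]] wu(2)[of a b] by (simp only: *) simp
  qed (use w in measurable)
  ultimately have "AE x in lborel. w x = 0"
    by eventually_elim (simp add: complex_eq_iff)
  with w(2) show ?thesis by (auto dest: AE_completion)
qed

section \<open>Uniqueness of weak derivatives\<close>

lemma has_weak_partialD:
  assumes "has_weak_partial \<alpha> f g"
  shows "locally_integrable f" "locally_integrable g"
    "\<phi> \<in> Cc_infinity \<Longrightarrow> (LINT x|lebesgue. f x * multi_partial \<alpha> \<phi> x)
       = (-1) ^ multi_order \<alpha> * (LINT x|lebesgue. g x * \<phi> x)"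
  using assms by (auto simp: has_weak_partial_def)

lemma locally_integrable_AE_eqI:
  assumes g: "locally_integrable g" and h: "locally_integrable h"
    and eq: "\<And>\<phi>. \<phi> \<in> Cc_infinity \<Longrightarrow> (LINT x|lebesgue. g x * \<phi> x) = (LINT x|lebesgue. h x * \<phi> x)"
  shows "AE x in lebesgue. g x = h x"
proof -
  have "AE x in lebesgue. g x + (-1) * h x = 0"
  proof (rule fundamental_lemma_variations)
    show "locally_integrable (\<lambda>x. g x + (-1) * h x)"
      using g h by (intro locally_integrable_add locally_integrable_cmult)
    fix \<phi> :: "real^'a \<Rightarrow> complex" assume \<phi>: "\<phi> \<in> Cc_infinity"
    have "(LINT x|lebesgue. (g x + (-1) * h x) * \<phi> x) = (LINT x|lebesgue. g x * \<phi> x - h x * \<phi> x)"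
      by (simp add: algebra_simps)
    also have "\<dots> = 0"
      using eq[OF \<phi>] integrable_mult_test[OF g \<phi>] integrable_mult_test[OF h \<phi>] by simp
    finally show "(LINT x|lebesgue. (g x + (-1) * h x) * \<phi> x) = 0" .
  qed
  then show ?thesis by eventually_elim simp
qed

lemma has_weak_partial_unique:
  assumes "has_weak_partial \<alpha> f g" "has_weak_partial \<alpha> f h"
  shows "AE x in lebesgue. g x = h x"
  using has_weak_partialD[OF assms(1)] has_weak_partialD[OF assms(2)]
  by (intro locally_integrable_AE_eqI) auto

lemma LINT_cong_AE_mult:
  fixes g h \<phi> :: "real^'n::finite \<Rightarrow> complex"
  assumes "AE x in lebesgue. g x = h x"
    and "g \<in> borel_measurable lebesgue" "h \<in> borel_measurable lebesgue" "\<phi> \<in> borel_measurable borel"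
  shows "(LINT x|lebesgue. g x * \<phi> x) = (LINT x|lebesgue. h x * \<phi> x)"
proof (rule integral_cong_AE)
  show "AE x in lebesgue. g x * \<phi> x = h x * \<phi> x"
    using assms(1) by eventually_elim simp
qed (use assms borel_imp_lebesgue_measurable[OF assms(4)] in measurable)

lemma has_weak_partial_cong_AE:
  assumes w: "has_weak_partial \<alpha> f g" and eq: "AE x in lebesgue. g x = h x"
    and h: "h \<in> borel_measurable lebesgue"
  shows "has_weak_partial \<alpha> f h"
  unfolding has_weak_partial_def
proof (intro conjI ballI)
  note W = has_weak_partialD[OF w]
  show "locally_integrable f" by (rule W)
  show "locally_integrable h" by (rule locally_integrable_cong_AE[OF W(2) h eq])
  fix \<phi> :: "real^'a \<Rightarrow> complex" assume \<phi>: "\<phi> \<in> Cc_infinity"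
  have "(LINT x|lebesgue. g x * \<phi> x) = (LINT x|lebesgue. h x * \<phi> x)"
    by (rule LINT_cong_AE_mult[OF eq locally_integrable_measurable[OF W(2)] h
          C_infinity_measurable[OF Cc_infinityD[OF \<phi>]]])
  then show "(LINT x|lebesgue. f x * multi_partial \<alpha> \<phi> x)
      = (-1) ^ multi_order \<alpha> * (LINT x|lebesgue. h x * \<phi> x)"
    using W(3)[OF \<phi>] by simp
qed

lemma has_weak_partial_weak_partial:
  "has_weak_partial \<alpha> f g \<Longrightarrow> has_weak_partial \<alpha> f (weak_partial \<alpha> f)"
  unfolding weak_partial_def by (rule someI[where P="has_weak_partial \<alpha> f"])

section \<open>Products with test functions\<close>

lemma LINT_sum_list:
  fixes F :: "'b \<Rightarrow> 'a \<Rightarrow> complex"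
  assumes "\<And>z. z \<in> set L \<Longrightarrow> integrable M (F z)"
  shows "(LINT x|M. (\<Sum>z\<leftarrow>L. F z x)) = (\<Sum>z\<leftarrow>L. LINT x|M. F z x)
    \<and> integrable M (\<lambda>x. \<Sum>z\<leftarrow>L. F z x)"
  using assms by (induction L) auto

lemma locally_integrable_sum_list:
  "(\<And>z. z \<in> set L \<Longrightarrow> locally_integrable (F z)) \<Longrightarrow> locally_integrable (\<lambda>x. \<Sum>z\<leftarrow>L. F z x)"
proof (induction L)
  case Nil
  have "locally_integrable (\<lambda>x. 0)" by (simp add: locally_integrable_def set_integrable_def)
  then show ?case by simp
qed (simp add: locally_integrable_add)

text \<open>The shape of a derivative of a product: test functions times weak derivatives.\<close>

abbreviation combination ::
  "('b \<times> ('a \<Rightarrow> complex)) list \<Rightarrow> ('b \<Rightarrow> 'a \<Rightarrow> complex) \<Rightarrow> 'a \<Rightarrow> complex" where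
  "combination L W \<equiv> (\<lambda>x. \<Sum>(\<beta>, r)\<leftarrow>L. r x * W \<beta> x)"

text \<open>Integrating the identity \<open>smooth_factor_inside_derivative\<close> against \<open>f\<close> moves every derivative back
  onto \<open>f\<close>.  The list depends on \<open>\<rho>\<close> and \<open>\<alpha>\<close> only, which makes all later constants independent of \<open>f\<close>.\<close>

theorem weak_partial_product:
  fixes \<rho> :: "real^'n::finite \<Rightarrow> complex"
  assumes \<rho>: "\<rho> \<in> Cc_infinity"
  shows "\<exists>L. (\<forall>(\<beta>, r)\<in>set L. multi_order \<beta> \<le> multi_order \<alpha> \<and> r \<in> Cc_infinity) \<and>
    (\<forall>f W. (\<forall>\<beta>. multi_order \<beta> \<le> multi_order \<alpha> \<longrightarrow> has_weak_partial \<beta> f (W \<beta>)) \<longrightarrow>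
       has_weak_partial \<alpha> (\<lambda>x. \<rho> x * f x) (combination L W))"
proof -
  obtain "is" where ix: "\<alpha> = list_index is" using list_index_surj by metis
  from smooth_factor_inside_derivative[OF \<rho>, of "is"] obtain K where
    K: "\<And>js r. (js, r) \<in> set K \<Longrightarrow> length js \<le> length is"
       "\<And>js r. (js, r) \<in> set K \<Longrightarrow> r \<in> Cc_infinity"
      "\<And>\<phi> x. C_infinity \<phi> \<Longrightarrow> \<rho> x * iter_partial is \<phi> x
        = (\<Sum>(js, r)\<leftarrow>K. iter_partial js (\<lambda>y. r y * \<phi> y) x)" by blast
  define s :: "'n list \<Rightarrow> complex" where "s = (\<lambda>js. (-1) ^ (length is + length js))"
  define L where "L = map (\<lambda>(js, r). (list_index js, \<lambda>x. s js * r x)) K"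
  show ?thesis
  proof (intro exI[of _ L] conjI allI impI)
    show "\<forall>(\<beta>, r)\<in>set L. multi_order \<beta> \<le> multi_order \<alpha> \<and> r \<in> Cc_infinity"
      using K(1,2) by (auto simp: L_def ix multi_order_list_index intro: Cc_infinity_cmult)
    fix f :: "real^'n \<Rightarrow> complex" and W
    assume "\<forall>\<beta>. multi_order \<beta> \<le> multi_order \<alpha> \<longrightarrow> has_weak_partial \<beta> f (W \<beta>)"
    then have W: "has_weak_partial (list_index js) f (W (list_index js))" if "length js \<le> length is" for js
      using that by (auto simp: ix multi_order_list_index)
    have f: "locally_integrable f"
      using has_weak_partialD(1)[OF W[of "[]"]] by simp
    show "has_weak_partial \<alpha> (\<lambda>x. \<rho> x * f x) (combination L W)"
      unfolding has_weak_partial_def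
    proof (intro conjI ballI)
      show "locally_integrable (\<lambda>x. \<rho> x * f x)" by (rule locally_integrable_mult_test[OF f \<rho>])
      have "locally_integrable (\<lambda>x. case z of (\<beta>, r) \<Rightarrow> r x * W \<beta> x)" if "z \<in> set L" for z
        using that K(1,2) has_weak_partialD(2)[OF W]
        by (auto simp: L_def intro!: locally_integrable_mult_test Cc_infinity_cmult)
      then show "locally_integrable (combination L W)"
        by (rule locally_integrable_sum_list)
      fix \<phi> :: "real^'n \<Rightarrow> complex" assume \<phi>: "\<phi> \<in> Cc_infinity"
      have C: "C_infinity \<phi>" by (rule Cc_infinityD[OF \<phi>])
      have r\<phi>: "(\<lambda>y. r y * \<phi> y) \<in> Cc_infinity" if "(js, r) \<in> set K" for js r
        using K(2)[OF that] C by (rule Cc_infinity_mult_left)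
      have "(LINT x|lebesgue. \<rho> x * f x * multi_partial \<alpha> \<phi> x)
          = (LINT x|lebesgue. (\<Sum>z\<leftarrow>K. f x * iter_partial (fst z) (\<lambda>y. snd z y * \<phi> y) x))"
        unfolding ix multi_partial_list_index[OF C]
        by (intro Bochner_Integration.integral_cong refl)
          (use K(3)[OF C] in \<open>simp add: sum_list_const_mult case_prod_unfold algebra_simps\<close>)
      also have "\<dots> = (\<Sum>z\<leftarrow>K. LINT x|lebesgue. f x * iter_partial (fst z) (\<lambda>y. snd z y * \<phi> y) x)"
        by (rule LINT_sum_list[THEN conjunct1])
          (auto intro!: integrable_mult_test[OF f] Cc_infinity_iter_partial r\<phi>)
      also have "\<dots> = (\<Sum>z\<leftarrow>K. (-1) ^ length (fst z) *
          (LINT x|lebesgue. W (list_index (fst z)) x * (snd z x * \<phi> x)))"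
      proof (intro arg_cong[where f=sum_list] map_cong refl)
        fix z assume z: "z \<in> set K"
        obtain js r where zz: "z = (js, r)" by (cases z)
        show "(LINT x|lebesgue. f x * iter_partial (fst z) (\<lambda>y. snd z y * \<phi> y) x)
          = (-1) ^ length (fst z) * (LINT x|lebesgue. W (list_index (fst z)) x * (snd z x * \<phi> x))"
          using has_weak_partialD(3)[OF W[OF K(1)] r\<phi>] z
          by (simp add: zz multi_order_list_index
              multi_partial_list_index[OF Cc_infinityD[OF r\<phi>]])
      qed
      also have "\<dots> = (-1) ^ length is * (\<Sum>z\<leftarrow>K. s (fst z) *
          (LINT x|lebesgue. W (list_index (fst z)) x * (snd z x * \<phi> x)))"
        by (auto simp: s_def power_add sum_list_const_mult[symmetric] mult.assoc[symmetric]
            power_mult_distrib[symmetric] intro!: arg_cong[where f=sum_list] map_cong)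
      also have "(\<Sum>z\<leftarrow>K. s (fst z) * (LINT x|lebesgue. W (list_index (fst z)) x * (snd z x * \<phi> x)))
          = (\<Sum>z\<leftarrow>K. LINT x|lebesgue. s (fst z) * (W (list_index (fst z)) x * (snd z x * \<phi> x)))"
        by simp
      also have "\<dots> = (LINT x|lebesgue. (\<Sum>z\<leftarrow>K. s (fst z) * (W (list_index (fst z)) x * (snd z x * \<phi> x))))"
        by (rule LINT_sum_list[THEN conjunct1, symmetric])
          (auto intro!: integrable_mult_right integrable_mult_test has_weak_partialD(2)[OF W] K(1) r\<phi>)
      also have "\<dots> = (LINT x|lebesgue. (\<Sum>(\<beta>, r)\<leftarrow>L. r x * W \<beta> x) * \<phi> x)"
        unfolding L_def sum_list_mult_const[symmetric] map_map o_def case_prod_unfold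
        by (simp add: mult_ac)
      finally show "(LINT x|lebesgue. \<rho> x * f x * multi_partial \<alpha> \<phi> x)
          = (-1) ^ multi_order \<alpha> * (LINT x|lebesgue. (\<Sum>(\<beta>, r)\<leftarrow>L. r x * W \<beta> x) * \<phi> x)"
        by (simp add: ix multi_order_list_index)
    qed
  qed
qed

section \<open>Weak gradients\<close>

definition weak_gradient :: "(real^'n::finite \<Rightarrow> complex) \<Rightarrow> ('n \<Rightarrow> real^'n \<Rightarrow> complex) \<Rightarrow> bool" where
  "weak_gradient w v \<longleftrightarrow> locally_integrable w \<and> (\<forall>i. locally_integrable (v i)) \<and>
     (\<forall>\<phi>\<in>Cc_infinity. \<forall>i. (LINT x|lebesgue. w x * partial i \<phi> x) = - (LINT x|lebesgue. v i x * \<phi> x))"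

lemma weak_gradient_of_weak_partials:
  assumes w: "has_weak_partial (list_index js) f w"
    and v: "\<And>i. has_weak_partial (list_index (i # js)) f (v i)"
  shows "weak_gradient w v"
  unfolding weak_gradient_def
proof (intro conjI allI ballI)
  show "locally_integrable w" "locally_integrable (v i)" for i
    using has_weak_partialD[OF w] has_weak_partialD[OF v] by blast+
  fix \<phi> :: "real^'a \<Rightarrow> complex" and i assume \<phi>: "\<phi> \<in> Cc_infinity"
  note C = Cc_infinityD[OF \<phi>]
  have "(-1) ^ length js * (LINT x|lebesgue. w x * partial i \<phi> x)
      = (LINT x|lebesgue. f x * iter_partial js (partial i \<phi>) x)"
    using has_weak_partialD(3)[OF w Cc_infinity_partial[OF \<phi>], of i]
    by (simp add: multi_order_list_index multi_partial_list_index[OF C_infinity_partial[OF C]])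
  also have "iter_partial js (partial i \<phi>) = iter_partial (i # js) \<phi>"
    by (simp add: iter_partial_Cons partial_iter_partial[OF C])
  also have "(LINT x|lebesgue. f x * iter_partial (i # js) \<phi> x)
      = (-1) ^ Suc (length js) * (LINT x|lebesgue. v i x * \<phi> x)"
    using has_weak_partialD(3)[OF v \<phi>, of i]
    by (simp add: multi_order_list_index multi_partial_list_index[OF C])
  finally have "(-1) ^ length js * (LINT x|lebesgue. w x * partial i \<phi> x)
      = (-1) ^ length js * (- (LINT x|lebesgue. v i x * \<phi> x))" by simp
  then show "(LINT x|lebesgue. w x * partial i \<phi> x) = - (LINT x|lebesgue. v i x * \<phi> x)"
    by (subst (asm) mult_cancel_left) simp
qed

section \<open>Periodic representatives\<close>

definition lattice :: "int^'n::finite \<Rightarrow> real^'n" where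
  "lattice k = (\<chi> i. 2 * pi * of_int (k $ i))"

text \<open>The index \<open>k\<close> of the half-open cube \<open>[-\<pi>, \<pi>)\<^sup>n + 2 \<pi> k\<close> that contains \<open>x\<close>.\<close>

definition lattice_point :: "real^'n::finite \<Rightarrow> int^'n" where
  "lattice_point x = (\<chi> i. \<lfloor>(x $ i + pi) / (2 * pi)\<rfloor>)"

lemma lattice_uminus: "lattice (- k) = - lattice k"
  by (simp add: lattice_def vec_eq_iff)

lemma periodic_lattice:
  fixes f :: "real^'n::finite \<Rightarrow> complex"
  assumes f: "periodic_2pi f"
  shows "f (x + lattice k) = f x"
proof -
  have f1: "f (y + axis i (2 * pi)) = f y" for y i
    using f by (simp add: periodic_2pi_def)
  have axis_add: "axis i a + axis i b = axis i (a + b)" for i :: 'n and a b :: real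
    by (simp add: axis_def vec_eq_iff)
  have 1: "f (y + axis i (2 * pi * of_int n)) = f y" for y i n
  proof (induction n arbitrary: y rule: int_induct[where k=0])
    case base
    have "axis i 0 = (0 :: real^'n)" by (simp add: axis_def vec_eq_iff)
    then show ?case by (simp del: axis_eq_0_iff)
  next
    case (step1 n)
    have "y + axis i (2 * pi * of_int (n + 1)) = (y + axis i (2 * pi * of_int n)) + axis i (2 * pi)"
      by (simp add: add.assoc axis_add algebra_simps)
    then show ?case using step1 f1 by metis
  next
    case (step2 n)
    have "y + axis i (2 * pi * of_int n) = (y + axis i (2 * pi * of_int (n - 1))) + axis i (2 * pi)"
      by (simp add: add.assoc axis_add algebra_simps)
    then show ?case using step2 f1 by metis
  qed
  have 2: "f (y + (\<Sum>i\<in>I. axis i (2 * pi * of_int (k $ i)))) = f y" for y I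
  proof (induction I arbitrary: y rule: infinite_finite_induct)
    case (insert i I)
    have "y + (\<Sum>i\<in>insert i I. axis i (2 * pi * of_int (k $ i)))
        = (y + (\<Sum>i\<in>I. axis i (2 * pi * of_int (k $ i)))) + axis i (2 * pi * of_int (k $ i))"
      using insert.hyps by (simp add: ac_simps)
    then show ?case by (simp only: 1 insert.IH)
  qed simp_all
  have "lattice k = (\<Sum>i\<in>UNIV. axis i (2 * pi * of_int (k $ i)))"
    by (simp add: lattice_def vec_eq_iff axis_def if_distrib cong: if_cong)
  then show ?thesis using 2 by simp
qed

lemma measurable_lattice_point_component [measurable]:
  "(\<lambda>x::real^'n::finite. lattice_point x $ i) \<in> borel \<rightarrow>\<^sub>M count_space UNIV"
  unfolding lattice_point_def by simp

lemma measurable_vec_lambda: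
  fixes g :: "'n::finite \<Rightarrow> 'a \<Rightarrow> real"
  assumes "\<And>i. g i \<in> borel_measurable M"
  shows "(\<lambda>x. \<chi> i. g i x) \<in> borel_measurable M"
proof -
  have "(\<lambda>x. \<Sum>i\<in>UNIV. g i x *\<^sub>R axis i (1::real)) \<in> borel_measurable M"
    using assms by measurable
  moreover have "(\<Sum>i\<in>UNIV. g i x *\<^sub>R axis i (1::real)) = (\<chi> i. g i x)" for x
    using basis_expansion[of "\<chi> i. g i x"] by (simp add: scalar_mult_eq_scaleR)
  ultimately show ?thesis by simp
qed

lemma measurable_lattice_lattice_point:
  "(\<lambda>x::real^'n::finite. lattice (lattice_point x)) \<in> borel_measurable borel"
  unfolding lattice_def
proof (rule measurable_vec_lambda)
  fix i :: 'n
  have "(\<lambda>x::real^'n. real_of_int (lattice_point x $ i)) \<in> borel_measurable borel"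
    by measurable
  then show "(\<lambda>x::real^'n. 2 * pi * real_of_int (lattice_point x $ i)) \<in> borel_measurable borel"
    by measurable
qed

lemma lattice_point_translate: "lattice_point (x + lattice k) = lattice_point x + k"
proof -
  have "(x $ i + 2 * pi * of_int (k $ i) + pi) / (2 * pi) = (x $ i + pi) / (2 * pi) + of_int (k $ i)" for i
    by (simp add: field_simps)
  then show ?thesis by (simp add: lattice_point_def lattice_def vec_eq_iff)
qed

lemma lattice_add: "lattice (k + l) = lattice k + lattice l"
  by (simp add: lattice_def vec_eq_iff algebra_simps)

lemma lattice_axis: "lattice (axis i 1) = axis i (2 * pi)"
  by (simp add: lattice_def vec_eq_iff axis_def)

lemma AE_lborel_translate:
  fixes h :: "'a::euclidean_space"
  assumes "AE x in lborel. P x"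
  shows "AE x in lborel. P (x + h)"
proof -
  have "AE x in distr lborel borel ((+) h). P x"
    unfolding lborel_distr_plus by (rule assms)
  from AE_distrD[OF _ this] show ?thesis by (simp add: add.commute)
qed

lemma LINT_lborel_translate:
  fixes F :: "'a::euclidean_space \<Rightarrow> complex"
  assumes "F \<in> borel_measurable borel"
  shows "(LINT x|lborel. F (x + h)) = (LINT x|lborel. F x)"
proof -
  have "(LINT x|lborel. F x) = (LINT x|distr lborel borel ((+) h). F x)"
    by (simp add: lborel_distr_plus)
  also have "\<dots> = (LINT x|lborel. F (h + x))"
    using assms by (subst integral_distr) auto
  finally show ?thesis by (simp add: add.commute)
qed

lemma LINT_lebesgue_translate:
  fixes F :: "real^'n::finite \<Rightarrow> complex"
  assumes F: "F \<in> borel_measurable lebesgue" and Fh: "(\<lambda>x. F (x + h)) \<in> borel_measurable lebesgue"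
  shows "(LINT x|lebesgue. F (x + h)) = (LINT x|lebesgue. F x)"
proof -
  obtain G where G: "G \<in> borel_measurable borel" "AE x in lebesgue. F x = G x"
    using borel_representative[OF F] by blast
  then have ae: "AE x in lborel. F x = G x" by (simp add: AE_completion_iff)
  have Gh: "(\<lambda>x. G (x + h)) \<in> borel_measurable borel" using G(1) by measurable
  have "(LINT x|lebesgue. F (x + h)) = (LINT x|lebesgue. G (x + h))"
    using AE_lborel_translate[OF ae, of h]
    by (intro integral_cong_AE Fh borel_imp_lebesgue_measurable Gh) (rule AE_completion)
  also have "\<dots> = (LINT x|lebesgue. G x)"
    using LINT_lborel_translate[OF G(1), of h] G(1) Gh by (simp add: integral_completion)
  also have "\<dots> = (LINT x|lebesgue. F x)"
    using G by (intro integral_cong_AE F borel_imp_lebesgue_measurable) auto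
  finally show ?thesis .
qed

lemma locally_integrable_translate:
  fixes g :: "real^'n::finite \<Rightarrow> complex"
  assumes g: "locally_integrable g" "g \<in> borel_measurable borel"
  shows "locally_integrable (\<lambda>x. g (x + h))"
  unfolding locally_integrable_iff_balls set_integrable_def
proof
  fix R
  let ?F = "\<lambda>x. indicator (cball 0 (R + norm h)) x *\<^sub>R g x"
  have "integrable lebesgue ?F"
    using g(1) unfolding locally_integrable_iff_balls set_integrable_def by blast
  moreover have Fm: "?F \<in> borel_measurable borel"
    using g(2) by (intro borel_measurable_scaleR borel_measurable_indicator) auto
  ultimately have "integrable lborel ?F"
    using Fm by (simp add: integrable_completion)
  then have "integrable (distr lborel borel ((+) h)) ?F" unfolding lborel_distr_plus .
  then have 1: "integrable lborel (\<lambda>x. ?F (h + x))"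
    using Fm by (subst (asm) integrable_distr_eq) auto
  have "(\<lambda>x. g (x + h)) \<in> borel_measurable borel" using g(2) by measurable
  then have m: "(\<lambda>x. indicator (cball 0 R) x *\<^sub>R g (x + h)) \<in> borel_measurable borel"
    by (intro borel_measurable_scaleR borel_measurable_indicator) auto
  have "integrable lborel (\<lambda>x. indicator (cball 0 R) x *\<^sub>R g (x + h))"
  proof (rule Bochner_Integration.integrable_bound[OF 1])
    show "(\<lambda>x. indicator (cball 0 R) x *\<^sub>R g (x + h)) \<in> borel_measurable lborel"
      using m by simp
    have "norm (indicator (cball 0 R) x *\<^sub>R g (x + h)) \<le> norm (?F (h + x))" for x
      using norm_triangle_ineq[of h x] by (auto simp: indicator_def add.commute)
    then show "AE x in lborel. norm (indicator (cball 0 R) x *\<^sub>R g (x + h)) \<le> norm (?F (h + x))"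
      by simp
  qed
  then show "integrable lebesgue (\<lambda>x. indicator (cball 0 R) x *\<^sub>R g (x + h))"
    using m by (simp add: integrable_completion)
qed

lemma has_weak_partial_translate:
  fixes f g :: "real^'n::finite \<Rightarrow> complex"
  assumes w: "has_weak_partial \<alpha> f g" and g: "g \<in> borel_measurable borel"
    and f: "\<And>x. f (x + h) = f x"
  shows "has_weak_partial \<alpha> f (\<lambda>x. g (x + h))"
  unfolding has_weak_partial_def
proof (intro conjI ballI)
  note W = has_weak_partialD[OF w]
  show "locally_integrable f" by (rule W)
  show "locally_integrable (\<lambda>x. g (x + h))" by (rule locally_integrable_translate[OF W(2) g])
  fix \<phi> :: "real^'n \<Rightarrow> complex" assume \<phi>: "\<phi> \<in> Cc_infinity"
  let ?\<psi> = "\<lambda>x. \<phi> (x + (-h))"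
  have \<psi>: "?\<psi> \<in> Cc_infinity" by (rule Cc_infinity_translate[OF \<phi>])
  have mp: "multi_partial \<alpha> ?\<psi> = (\<lambda>x. multi_partial \<alpha> \<phi> (x + (-h)))"
    unfolding multi_partial_def by (rule iter_partial_translate)
  have tf: "multi_partial \<alpha> \<phi> \<in> Cc_infinity" "multi_partial \<alpha> ?\<psi> \<in> Cc_infinity"
    unfolding multi_partial_def by (intro Cc_infinity_iter_partial \<phi> \<psi>)+
  have \<phi>m: "\<phi> \<in> borel_measurable borel" "?\<psi> \<in> borel_measurable borel"
    using \<phi> \<psi> by (auto intro: C_infinity_measurable Cc_infinityD)
  have "(LINT x|lebesgue. f x * multi_partial \<alpha> \<phi> x)
      = (LINT x|lebesgue. f (x + h) * multi_partial \<alpha> ?\<psi> (x + h))"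
    unfolding f mp by simp
  also have "\<dots> = (LINT x|lebesgue. f x * multi_partial \<alpha> ?\<psi> x)"
    using integrable_mult_test[OF W(1) tf(1)] integrable_mult_test[OF W(1) tf(2)]
    by (intro LINT_lebesgue_translate[where F="\<lambda>x. f x * multi_partial \<alpha> ?\<psi> x"])
      (simp_all add: f mp[simplified] borel_measurable_integrable)
  also have "\<dots> = (-1) ^ multi_order \<alpha> * (LINT x|lebesgue. g x * ?\<psi> x)"
    by (rule W(3)[OF \<psi>])
  also have "(LINT x|lebesgue. g x * ?\<psi> x) = (LINT x|lebesgue. g (x + h) * \<phi> x)"
  proof -
    have m: "(\<lambda>x. g x * ?\<psi> x) \<in> borel_measurable borel" using g \<phi>m by measurable
    have m': "(\<lambda>x. g (x + h) * \<phi> x) \<in> borel_measurable borel" using g \<phi>m by measurable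
    show ?thesis
      using LINT_lborel_translate[OF m, of h] m m' by (simp add: integral_completion)
  qed
  finally show "(LINT x|lebesgue. f x * multi_partial \<alpha> \<phi> x)
      = (-1) ^ multi_order \<alpha> * (LINT x|lebesgue. g (x + h) * \<phi> x)" .
qed

text \<open>A weak derivative of a periodic function is periodic only up to null sets.  Reading off its
  values in one period cell repairs this at every point at once.\<close>

theorem periodic_weak_partial:
  fixes f :: "real^'n::finite \<Rightarrow> complex"
  assumes f: "periodic_2pi f" and ex: "has_weak_partial \<alpha> f g"
  shows "\<exists>w. w \<in> borel_measurable borel \<and> periodic_2pi w \<and> has_weak_partial \<alpha> f w"
proof -
  obtain u where u: "u \<in> borel_measurable borel" "AE x in lebesgue. g x = u x"
    using borel_representative[OF locally_integrable_measurable[OF has_weak_partialD(2)[OF ex]]] by blast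
  have wu: "has_weak_partial \<alpha> f u"
    by (rule has_weak_partial_cong_AE[OF ex u(2) borel_imp_lebesgue_measurable[OF u(1)]])
  have "AE x in lebesgue. u (x + lattice k) = u x" for k
    by (rule has_weak_partial_unique[OF has_weak_partial_translate[OF wu u(1)] wu])
      (rule periodic_lattice[OF f])
  then have ae: "AE x in lebesgue. \<forall>k. u (x + lattice k) = u x"
    unfolding AE_all_countable by blast
  define w where "w = (\<lambda>x. u (x - lattice (lattice_point x)))"
  have wm: "w \<in> borel_measurable borel"
    unfolding w_def using u(1) measurable_lattice_lattice_point by measurable
  have "w (x + axis i (2 * pi)) = w x" for x i
    unfolding w_def lattice_axis[symmetric] lattice_point_translate lattice_add by simp
  moreover have "AE x in lebesgue. u x = w x"
    using ae
  proof eventually_elim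
    case (elim x)
    then show ?case using elim[rule_format, of "- lattice_point x"] by (simp add: w_def lattice_uminus)
  qed
  ultimately show ?thesis
    using wm has_weak_partial_cong_AE[OF wu _ borel_imp_lebesgue_measurable[OF wm]]
    by (auto simp: periodic_2pi_def)
qed

section \<open>Powers of extended nonnegative reals\<close>

lemma ennreal_powr_top [simp]: "ennreal_powr \<infinity> a = \<infinity>" "ennreal_powr top a = top"
  by (simp_all add: ennreal_powr_def)

lemma ennreal_powr_ennreal: "0 \<le> r \<Longrightarrow> ennreal_powr (ennreal r) a = ennreal (r powr a)"
  by (simp add: ennreal_powr_def)

lemma ennreal_powr_0 [simp]: "ennreal_powr 0 a = 0"
  by (simp add: ennreal_powr_def)

lemma ennreal_powr_one [simp]: "ennreal_powr x 1 = x"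
  by (cases x) (simp_all add: ennreal_powr_ennreal)

lemma ennreal_powr_less_top [simp]: "ennreal_powr x a < top \<longleftrightarrow> x < top"
  by (cases x) (simp_all add: ennreal_powr_ennreal)

lemma ennreal_powr_mono: "x \<le> y \<Longrightarrow> 0 \<le> a \<Longrightarrow> ennreal_powr x a \<le> ennreal_powr y a"
  by (cases x; cases y) (auto simp: ennreal_powr_ennreal powr_mono2 top_unique)

lemma ennreal_powr_mult: "ennreal_powr (x * y) a = ennreal_powr x a * ennreal_powr y a"
proof (cases x; cases y)
  fix r s assume "0 \<le> r" "0 \<le> s" "x = ennreal r" "y = ennreal s"
  then show ?thesis
    by (simp add: ennreal_powr_ennreal ennreal_mult[symmetric] powr_mult)
next
  fix r assume "0 \<le> r" "x = ennreal r" "y = top"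
  then show ?thesis by (cases "r = 0") (auto simp: ennreal_powr_ennreal ennreal_mult_top)
next
  fix r assume "x = top" "0 \<le> r" "y = ennreal r"
  then show ?thesis by (cases "r = 0") (auto simp: ennreal_powr_ennreal ennreal_top_mult)
qed simp

lemma ennreal_powr_powr: "ennreal_powr (ennreal_powr x a) b = ennreal_powr x (a * b)"
  by (cases x) (simp_all add: ennreal_powr_ennreal powr_powr)

lemma ennreal_powr_add_le:
  assumes "0 \<le> a"
  shows "ennreal_powr (x + y) a \<le> ennreal (2 powr a) * (ennreal_powr x a + ennreal_powr y a)"
proof -
  have *: "ennreal_powr (x + y) a \<le> ennreal (2 powr a) * ennreal_powr y a" if "x \<le> y" for x y
  proof -
    have "x + y \<le> ennreal 2 * y" using add_right_mono[OF that, of y] by (simp add: mult_2)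
    then have "ennreal_powr (x + y) a \<le> ennreal_powr (ennreal 2 * y) a"
      using assms by (rule ennreal_powr_mono)
    also have "\<dots> = ennreal (2 powr a) * ennreal_powr y a"
      by (simp only: ennreal_powr_mult ennreal_powr_ennreal)
    finally show ?thesis .
  qed
  show ?thesis
  proof (cases "x \<le> y")
    case True
    from *[OF this] show ?thesis
      by (rule order_trans) (intro mult_left_mono, auto)
  next
    case False
    then have "y \<le> x" by simp
    from *[OF this] have "ennreal_powr (x + y) a \<le> ennreal (2 powr a) * ennreal_powr x a"
      by (simp add: add.commute)
    then show ?thesis by (rule order_trans) (intro mult_left_mono, auto)
  qed
qed

lemma measurable_ennreal_powr [measurable]:
  assumes F [measurable]: "F \<in> borel_measurable M"
  shows "(\<lambda>x. ennreal_powr (F x) a) \<in> borel_measurable M"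
  unfolding ennreal_powr_def
proof (rule measurable_If)
  have "F -` {\<infinity>} \<inter> space M \<in> sets M" by (rule measurable_sets[OF F]) simp
  then show "{x \<in> space M. F x = \<infinity>} \<in> sets M" by (simp add: vimage_def Int_def conj_commute)
  show "(\<lambda>x. ennreal (enn2real (F x) powr a)) \<in> borel_measurable M"
    by measurable
qed simp

lemma convex_on_powr_abs:
  assumes "p \<ge> 1"
  shows "convex_on UNIV (\<lambda>x::real. \<bar>x\<bar> powr p)"
proof -
  have conv: "(l * x + m * y) powr p \<le> l * x powr p + m * y powr p"
    if "0 \<le> x" "0 \<le> y" "0 < l" "0 < m" "l + m = 1" for x y l m :: real
  proof -
    have small: "l powr p \<le> l" if "0 < l" "l \<le> 1" for l :: real
      using powr_mono'[of 1 p l] that assms by simp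
    show ?thesis
    proof (cases "x = 0 \<or> y = 0")
      case True
      then show ?thesis
        using that small[of l] small[of m]
        by (auto simp: powr_mult intro!: mult_right_mono)
    next
      case False
      have l: "l = 1 - m" using that by simp
      show ?thesis
        using convex_onD[OF powr_convex[OF assms], of m x y] that False unfolding l by simp
    qed
  qed
  show ?thesis
  proof (rule convex_onI)
    fix t x y :: real assume t: "0 < t" "t < 1"
    have "\<bar>(1 - t) *\<^sub>R x + t *\<^sub>R y\<bar> powr p \<le> ((1 - t) * \<bar>x\<bar> + t * \<bar>y\<bar>) powr p"
      using t assms abs_triangle_ineq[of "(1 - t) * x" "t * y"]
      by (intro powr_mono2) (auto simp: abs_mult)
    also have "\<dots> \<le> (1 - t) * \<bar>x\<bar> powr p + t * \<bar>y\<bar> powr p"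
      using t by (intro conv) auto
    finally show "\<bar>(1 - t) *\<^sub>R x + t *\<^sub>R y\<bar> powr p \<le> (1 - t) * \<bar>x\<bar> powr p + t * \<bar>y\<bar> powr p" .
  qed simp
qed

lemma ennreal_half: "x / 2 = ennreal (1 / 2) * (x::ennreal)"
proof (cases x)
  case (real r)
  then have "x / 2 = ennreal (r / 2)" by (metis divide_ennreal ennreal_numeral zero_less_numeral)
  also have "\<dots> = ennreal (1 / 2) * ennreal r"
    using ennreal_mult[of "1 / 2" r] real by simp
  finally show ?thesis using real by simp
next
  case top
  then show ?thesis by (simp add: ennreal_top_divide ennreal_mult_top)
qed

lemma ennreal_double_half: "ennreal 2 * (ennreal (1 / 2) * x) = x"
proof -
  have "ennreal 2 * ennreal (1 / 2) = ennreal (2 * (1 / 2))" by (rule ennreal_mult[symmetric]) auto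
  then show ?thesis by (simp add: mult.assoc[symmetric])
qed

lemma ennreal_powr_convex_half:
  assumes "1 \<le> a"
  shows "ennreal_powr ((x + y) / 2) a \<le> (ennreal_powr x a + ennreal_powr y a) / 2"
proof (cases x; cases y)
  fix r s assume *: "0 \<le> r" "0 \<le> s" "x = ennreal r" "y = ennreal s"
  have half: "ennreal t / 2 = ennreal (t / 2)" if "0 \<le> t" for t
    using that by (metis divide_ennreal ennreal_numeral zero_less_numeral)
  have "\<bar>(1/2) * r + (1/2) * s\<bar> powr a \<le> (1/2) * \<bar>r\<bar> powr a + (1/2) * \<bar>s\<bar> powr a"
    using convex_onD[OF convex_on_powr_abs[OF assms], of "1/2" r s] by simp
  then have "((r + s) / 2) powr a \<le> (r powr a + s powr a) / 2"
    using * by (simp add: field_simps)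
  then show ?thesis
    using * by (simp add: half ennreal_powr_ennreal ennreal_plus[symmetric] del: ennreal_plus)
qed (simp_all add: ennreal_top_divide)

section \<open>The \<open>L\<^sub>p\<close> norm\<close>

lemma Lp_norm_lborel:
  "Lp_norm \<Omega> p g = ennreal_powr (\<integral>\<^sup>+x. ennreal (norm (g x) powr p) * indicator \<Omega> x \<partial>lborel) (1 / p)"
  by (simp add: Lp_norm_def nn_integral_completion)

lemma Lp_norm_cong_AE:
  "AE x in lebesgue. f x = g x \<Longrightarrow> Lp_norm \<Omega> p f = Lp_norm \<Omega> p g"
  unfolding Lp_norm_def
  by (intro arg_cong2[where f=ennreal_powr] nn_integral_cong_AE refl) (auto elim: eventually_mono)

lemma Lp_norm_powr:
  assumes "0 < p"
  shows "ennreal_powr (Lp_norm \<Omega> p g) p = (\<integral>\<^sup>+x. ennreal (norm (g x) powr p) * indicator \<Omega> x \<partial>lborel)"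
  using assms by (simp add: Lp_norm_lborel ennreal_powr_powr)

lemma Lp_norm_le_iff:
  assumes "0 < p"
  shows "Lp_norm \<Omega> p g \<le> A \<longleftrightarrow>
    (\<integral>\<^sup>+x. ennreal (norm (g x) powr p) * indicator \<Omega> x \<partial>lborel) \<le> ennreal_powr A p"
proof
  assume "Lp_norm \<Omega> p g \<le> A"
  from ennreal_powr_mono[OF this, of p] assms
  show "(\<integral>\<^sup>+x. ennreal (norm (g x) powr p) * indicator \<Omega> x \<partial>lborel) \<le> ennreal_powr A p"
    by (simp add: Lp_norm_powr)
next
  assume "(\<integral>\<^sup>+x. ennreal (norm (g x) powr p) * indicator \<Omega> x \<partial>lborel) \<le> ennreal_powr A p"
  from ennreal_powr_mono[OF this, of "1 / p"] assms show "Lp_norm \<Omega> p g \<le> A"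
    by (simp add: Lp_norm_lborel ennreal_powr_powr)
qed

lemma Lp_norm_cmult:
  assumes p: "0 < p" and \<Omega>: "\<Omega> \<in> sets borel" and g: "g \<in> borel_measurable borel"
  shows "Lp_norm \<Omega> p (\<lambda>x. c * g x) = ennreal (norm c) * Lp_norm \<Omega> p g"
proof -
  have "(\<integral>\<^sup>+x. ennreal (norm (c * g x) powr p) * indicator \<Omega> x \<partial>lborel)
      = (\<integral>\<^sup>+x. ennreal (norm c powr p) * (ennreal (norm (g x) powr p) * indicator \<Omega> x) \<partial>lborel)"
    by (intro nn_integral_cong) (simp add: norm_mult powr_mult ennreal_mult mult.assoc)
  also have "\<dots> = ennreal (norm c powr p) * (\<integral>\<^sup>+x. ennreal (norm (g x) powr p) * indicator \<Omega> x \<partial>lborel)"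
    using g \<Omega> by (simp add: nn_integral_cmult)
  finally show ?thesis
    using p by (simp add: Lp_norm_lborel ennreal_powr_mult ennreal_powr_ennreal powr_powr)
qed

text \<open>Minkowski's inequality: convexity of \<open>t \<mapsto> t\<^sup>p\<close> with the weights \<open>a / (a + b)\<close> and
  \<open>b / (a + b)\<close>, where \<open>a\<close> and \<open>b\<close> are positive upper bounds of the two norms.\<close>

lemma Lp_norm_triangle:
  fixes f g :: "real^'n::finite \<Rightarrow> complex"
  assumes p: "1 \<le> p" and \<Omega>: "\<Omega> \<in> sets borel"
    and f: "f \<in> borel_measurable borel" and g: "g \<in> borel_measurable borel"
  shows "Lp_norm \<Omega> p (\<lambda>x. f x + g x) \<le> Lp_norm \<Omega> p f + Lp_norm \<Omega> p g"
proof -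
  have main: "Lp_norm \<Omega> p (\<lambda>x. f x + g x) \<le> ennreal (a + b)"
    if "0 < a" "0 < b" "Lp_norm \<Omega> p f \<le> ennreal a" "Lp_norm \<Omega> p g \<le> ennreal b" for a b
  proof -
    define l m where "l = a / (a + b)" and "m = b / (a + b)"
    have lm: "0 < l" "0 < m" "l + m = 1" "l < 1" "m < 1" using that by (auto simp: l_def m_def add_divide_distrib[symmetric])
    have pw: "norm (f x + g x) powr p
        \<le> (a + b) powr p * (l * (norm (f x) / a) powr p + m * (norm (g x) / b) powr p)" for x
    proof -
      have eq: "norm (f x) + norm (g x) = (a + b) * (l * (norm (f x) / a) + m * (norm (g x) / b))"
      proof -
        have "l * (norm (f x) / a) = norm (f x) / (a + b)" "m * (norm (g x) / b) = norm (g x) / (a + b)"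
          using that by (simp_all add: l_def m_def)
        moreover have "a + b \<noteq> 0" using that by simp
        ultimately show ?thesis by (simp add: distrib_left)
      qed
      have "norm (f x + g x) powr p \<le> (norm (f x) + norm (g x)) powr p"
        using p by (intro powr_mono2 norm_triangle_ineq) auto
      also have "\<dots> = (a + b) powr p * (l * (norm (f x) / a) + m * (norm (g x) / b)) powr p"
        unfolding eq using that lm by (subst powr_mult) auto
      also have "(l * (norm (f x) / a) + m * (norm (g x) / b)) powr p
          \<le> l * (norm (f x) / a) powr p + m * (norm (g x) / b) powr p"
      proof -
        have l: "l = 1 - m" using lm by simp
        show ?thesis
          using convex_onD[OF convex_on_powr_abs[OF p], of m "norm (f x) / a" "norm (g x) / b"] lm that
          unfolding l by simp
      qed
      finally show ?thesis using that by (simp add: mult_left_mono)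
    qed
    have If: "(\<integral>\<^sup>+x. ennreal (norm (f x) powr p) * indicator \<Omega> x \<partial>lborel) \<le> ennreal (a powr p)"
      using that p Lp_norm_le_iff[of p \<Omega> f "ennreal a"] by (simp add: ennreal_powr_ennreal)
    have Ig: "(\<integral>\<^sup>+x. ennreal (norm (g x) powr p) * indicator \<Omega> x \<partial>lborel) \<le> ennreal (b powr p)"
      using that p Lp_norm_le_iff[of p \<Omega> g "ennreal b"] by (simp add: ennreal_powr_ennreal)
    let ?c = "ennreal ((a + b) powr p * l / a powr p)" and ?d = "ennreal ((a + b) powr p * m / b powr p)"
    have "(\<integral>\<^sup>+x. ennreal (norm (f x + g x) powr p) * indicator \<Omega> x \<partial>lborel)
        \<le> (\<integral>\<^sup>+x. ?c * (ennreal (norm (f x) powr p) * indicator \<Omega> x)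
             + ?d * (ennreal (norm (g x) powr p) * indicator \<Omega> x) \<partial>lborel)"
    proof (intro nn_integral_mono)
      fix x
      have "ennreal (norm (f x + g x) powr p)
          \<le> ennreal (((a + b) powr p * l / a powr p) * norm (f x) powr p
               + ((a + b) powr p * m / b powr p) * norm (g x) powr p)"
        using pw[of x] that by (intro ennreal_leI) (simp add: powr_divide field_simps)
      also have "\<dots> = ?c * ennreal (norm (f x) powr p) + ?d * ennreal (norm (g x) powr p)"
      proof -
        have "0 \<le> (a + b) powr p * l / a powr p" "0 \<le> (a + b) powr p * m / b powr p"
          using lm(1,2) by simp_all
        moreover have "ennreal (c * F + d * G) = ennreal c * ennreal F + ennreal d * ennreal G"
          if "0 \<le> c" "0 \<le> d" "0 \<le> F" "0 \<le> G" for c d F G :: real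
          using that by (simp add: ennreal_mult)
        ultimately show ?thesis by (simp only: powr_ge_zero)
      qed
      finally show "ennreal (norm (f x + g x) powr p) * indicator \<Omega> x
          \<le> ?c * (ennreal (norm (f x) powr p) * indicator \<Omega> x)
             + ?d * (ennreal (norm (g x) powr p) * indicator \<Omega> x)"
        by (simp add: indicator_def)
    qed
    also have "\<dots> = ?c * (\<integral>\<^sup>+x. ennreal (norm (f x) powr p) * indicator \<Omega> x \<partial>lborel)
        + ?d * (\<integral>\<^sup>+x. ennreal (norm (g x) powr p) * indicator \<Omega> x \<partial>lborel)"
      using f g \<Omega> by (simp add: nn_integral_add nn_integral_cmult)
    also have "\<dots> \<le> ?c * ennreal (a powr p) + ?d * ennreal (b powr p)"
      by (intro add_mono mult_left_mono If Ig) auto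
    also have "\<dots> = ennreal ((a + b) powr p * l + (a + b) powr p * m)"
      using that lm by (simp add: ennreal_mult[symmetric] ennreal_plus[symmetric] del: ennreal_plus)
    also have "(a + b) powr p * l + (a + b) powr p * m = (a + b) powr p"
      using lm(3) by (simp add: distrib_left[symmetric])
    finally show ?thesis
      using that p by (simp add: Lp_norm_le_iff ennreal_powr_ennreal del: ennreal_plus)
  qed
  show ?thesis
  proof (cases "Lp_norm \<Omega> p f = top \<or> Lp_norm \<Omega> p g = top")
    case False
    then obtain A B where AB: "0 \<le> A" "0 \<le> B" "Lp_norm \<Omega> p f = ennreal A" "Lp_norm \<Omega> p g = ennreal B"
      by (metis ennreal_cases)
    have "Lp_norm \<Omega> p (\<lambda>x. f x + g x) \<le> ennreal (A + B)"
    proof (rule ennreal_le_epsilon)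
      fix e :: real assume that: "0 < e"
      have "Lp_norm \<Omega> p (\<lambda>x. f x + g x) \<le> ennreal ((A + e / 2) + (B + e / 2))"
        using AB that by (intro main) (auto intro!: ennreal_leI)
      then show "Lp_norm \<Omega> p (\<lambda>x. f x + g x) \<le> ennreal (A + B) + ennreal e"
        using AB that by (simp add: ennreal_plus[symmetric] ac_simps del: ennreal_plus)
    qed
    then show ?thesis using AB by simp
  qed auto
qed

lemma Lp_norm_0 [simp]: "Lp_norm \<Omega> p (\<lambda>x. 0) = 0"
  by (simp add: Lp_norm_lborel)

lemma Lp_norm_sum:
  fixes f :: "'i \<Rightarrow> real^'n::finite \<Rightarrow> complex"
  assumes "1 \<le> p" "\<Omega> \<in> sets borel" "\<And>i. i \<in> I \<Longrightarrow> f i \<in> borel_measurable borel"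
  shows "Lp_norm \<Omega> p (\<lambda>x. \<Sum>i\<in>I. f i x) \<le> (\<Sum>i\<in>I. Lp_norm \<Omega> p (f i))"
  using assms(3)
proof (induction I rule: infinite_finite_induct)
  case (insert i I)
  have "Lp_norm \<Omega> p (\<lambda>x. f i x + (\<Sum>i\<in>I. f i x)) \<le> Lp_norm \<Omega> p (f i) + Lp_norm \<Omega> p (\<lambda>x. \<Sum>i\<in>I. f i x)"
    using insert.prems by (intro Lp_norm_triangle assms(1,2) borel_measurable_sum) auto
  also have "\<dots> \<le> Lp_norm \<Omega> p (f i) + (\<Sum>i\<in>I. Lp_norm \<Omega> p (f i))"
    using insert by (intro add_left_mono) auto
  finally show ?case using insert.hyps by simp
qed simp_all

section \<open>Integrals of periodic functions\<close>

text \<open>The half-open cube, unlike \<open>torus_cube\<close>, has lattice translates that partition the space; the two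
  differ by a null set.\<close>

abbreviation cell :: "(real^'n::finite) set" where
  "cell \<equiv> {x. lattice_point x = 0}"

lemma sets_cell [measurable]: "(cell :: (real^'n::finite) set) \<in> sets borel"
proof -
  have "(cell :: (real^'n) set) = (\<Inter>i\<in>UNIV. (\<lambda>x. lattice_point x $ i) -` {0} \<inter> space borel)"
    by (auto simp: vec_eq_iff)
  also have "\<dots> \<in> sets borel"
    by (intro sets.finite_INT measurable_sets[OF measurable_lattice_point_component]) auto
  finally show ?thesis .
qed

lemma mem_cell: "x \<in> cell \<longleftrightarrow> (\<forall>i. - pi \<le> x $ i \<and> x $ i < pi)"
proof -
  have "\<lfloor>(t + pi) / (2 * pi)\<rfloor> = 0 \<longleftrightarrow> - pi \<le> t \<and> t < pi" for t
    by (auto simp: floor_eq_iff field_simps)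
  then show ?thesis by (simp add: lattice_point_def vec_eq_iff)
qed

lemma torus_cube_eq_cell_AE: "AE x in lborel. indicator torus_cube x = indicator (cell :: (real^'n::finite) set) x"
proof -
  let ?a = "(\<chi> i. - pi) :: real^'n" and ?b = "(\<chi> i. pi) :: real^'n"
  have "negligible (cbox ?a ?b - box ?a ?b)" by (rule negligible_frontier_interval)
  then have "AE x in lebesgue. x \<notin> cbox ?a ?b - box ?a ?b"
    by (intro AE_not_in) (simp add: negligible_iff_null_sets)
  then have "AE x in lborel. x \<notin> cbox ?a ?b - box ?a ?b" by (simp add: AE_completion_iff)
  then show ?thesis
  proof eventually_elim
    case (elim x)
    have "x \<in> box ?a ?b \<Longrightarrow> x \<in> cell" "x \<in> cell \<Longrightarrow> x \<in> cbox ?a ?b"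
      unfolding mem_cell by (auto simp: mem_box_cart less_imp_le)
    with elim show ?case by (auto simp: torus_cube_def indicator_def)
  qed
qed

lemma Lp_norm_torus_cube: "Lp_norm torus_cube p g = Lp_norm cell p g"
  unfolding Lp_norm_lborel using torus_cube_eq_cell_AE
  by (intro arg_cong2[where f=ennreal_powr] nn_integral_cong_AE refl) (auto elim!: eventually_mono simp: indicator_def split: if_splits)

lemma nn_integral_lborel_translate:
  fixes F :: "'a::euclidean_space \<Rightarrow> ennreal"
  assumes "F \<in> borel_measurable borel"
  shows "(\<integral>\<^sup>+x. F (x + h) \<partial>lborel) = (\<integral>\<^sup>+x. F x \<partial>lborel)"
proof -
  have "(\<integral>\<^sup>+x. F x \<partial>lborel) = (\<integral>\<^sup>+x. F x \<partial>distr lborel borel ((+) h))"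
    unfolding lborel_distr_plus ..
  also have "\<dots> = (\<integral>\<^sup>+x. F (h + x) \<partial>lborel)"
    using assms by (subst nn_integral_distr) auto
  finally show ?thesis by (simp add: add.commute)
qed

text \<open>The space is the disjoint union of the lattice translates of \<open>cell\<close>.\<close>

lemma unfold_integral:
  fixes v :: "real^'n::finite \<Rightarrow> ennreal"
  assumes v: "v \<in> borel_measurable borel"
  shows "(\<integral>\<^sup>+x. v x \<partial>lborel) = (\<integral>\<^sup>+x. (\<integral>\<^sup>+k. v (x + lattice k) \<partial>count_space UNIV) * indicator cell x \<partial>lborel)"
proof -
  have ind: "(\<integral>\<^sup>+k. v x * indicator {lattice_point x} k \<partial>count_space UNIV) = v x" for x
    by (simp add: nn_integral_cmult)
  have meas: "(\<lambda>x. v x * indicator {lattice_point x} k) \<in> borel_measurable borel" for k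
  proof -
    have "{x. lattice_point x = k} = (\<Inter>i\<in>UNIV. (\<lambda>x. lattice_point x $ i) -` {k $ i} \<inter> space borel)"
      by (auto simp: vec_eq_iff)
    also have "\<dots> \<in> sets borel"
      by (intro sets.finite_INT measurable_sets[OF measurable_lattice_point_component]) auto
    finally have "(\<lambda>x. v x * indicator {x. lattice_point x = k} x) \<in> borel_measurable borel"
      using v by measurable
    then show ?thesis by (rule measurable_cong[THEN iffD1, rotated]) (auto simp: indicator_def)
  qed
  have "(\<integral>\<^sup>+x. v x \<partial>lborel) = (\<integral>\<^sup>+x. \<integral>\<^sup>+k. v x * indicator {lattice_point x} k \<partial>count_space UNIV \<partial>lborel)"
    by (simp only: ind)
  also have "\<dots> = (\<integral>\<^sup>+k. \<integral>\<^sup>+x. v x * indicator {lattice_point x} k \<partial>lborel \<partial>count_space UNIV)"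
    using meas by (intro nn_integral_count_space_nn_integral) auto
  also have "\<dots> = (\<integral>\<^sup>+k. \<integral>\<^sup>+x. v (x + lattice k) * indicator cell x \<partial>lborel \<partial>count_space UNIV)"
  proof (rule nn_integral_cong)
    fix k :: "int^'n"
    have "(\<integral>\<^sup>+x. v x * indicator {lattice_point x} k \<partial>lborel)
        = (\<integral>\<^sup>+x. v (x + lattice k) * indicator {lattice_point (x + lattice k)} k \<partial>lborel)"
      using nn_integral_lborel_translate[OF meas[of k], of "lattice k"] by simp
    also have "\<dots> = (\<integral>\<^sup>+x. v (x + lattice k) * indicator cell x \<partial>lborel)"
      by (intro nn_integral_cong) (auto simp: lattice_point_translate indicator_def)
    finally show "(\<integral>\<^sup>+x. v x * indicator {lattice_point x} k \<partial>lborel)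
        = (\<integral>\<^sup>+x. v (x + lattice k) * indicator cell x \<partial>lborel)" .
  qed
  also have "\<dots> = (\<integral>\<^sup>+x. \<integral>\<^sup>+k. v (x + lattice k) * indicator cell x \<partial>count_space UNIV \<partial>lborel)"
    using v by (intro nn_integral_count_space_nn_integral[symmetric]) auto
  also have "\<dots> = (\<integral>\<^sup>+x. (\<integral>\<^sup>+k. v (x + lattice k) \<partial>count_space UNIV) * indicator cell x \<partial>lborel)"
    by (intro nn_integral_cong nn_integral_multc) auto
  finally show ?thesis .
qed

text \<open>After unfolding, every point of \<open>cell\<close> has exactly one lattice translate in the shifted cell.\<close>

lemma periodic_integral_translate:
  fixes u :: "real^'n::finite \<Rightarrow> ennreal"
  assumes u: "u \<in> borel_measurable borel" and per: "\<And>x k. u (x + lattice k) = u x"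
  shows "(\<integral>\<^sup>+x. u (x + h) * indicator cell x \<partial>lborel) = (\<integral>\<^sup>+x. u x * indicator cell x \<partial>lborel)"
proof -
  have m: "(\<lambda>x. u x * indicator cell (x - h)) \<in> borel_measurable borel"
    using u by measurable
  have "(\<integral>\<^sup>+x. u (x + h) * indicator cell x \<partial>lborel) = (\<integral>\<^sup>+x. u x * indicator cell (x - h) \<partial>lborel)"
    using nn_integral_lborel_translate[OF m, of h] by simp
  also have "\<dots> = (\<integral>\<^sup>+x. (\<integral>\<^sup>+k. u x * indicator {- lattice_point (x - h)} k \<partial>count_space UNIV)
      * indicator cell x \<partial>lborel)"
    unfolding unfold_integral[OF m] per
  proof (intro nn_integral_cong arg_cong2[where f="(*)"] refl arg_cong2[where f="(*)" and a="u _"])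
    fix x and k :: "int^'n"
    have "x + lattice k - h = (x - h) + lattice k" by simp
    then have "lattice_point (x + lattice k - h) = lattice_point (x - h) + k"
      by (simp only: lattice_point_translate)
    then show "indicator cell (x + lattice k - h) = (indicator {- lattice_point (x - h)} k :: ennreal)"
      by (simp add: indicator_def eq_neg_iff_add_eq_0 add.commute)
  qed
  also have "\<dots> = (\<integral>\<^sup>+x. u x * indicator cell x \<partial>lborel)"
    by (simp add: nn_integral_cmult)
  finally show ?thesis .
qed

lemma finite_int_box: "finite {k::int^'n::finite. \<forall>i. \<bar>k $ i\<bar> \<le> N}"
proof (rule finite_subset)
  show "{k::int^'n. \<forall>i. \<bar>k $ i\<bar> \<le> N} \<subseteq> vec_lambda ` (UNIV \<rightarrow>\<^sub>E {-N..N})"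
  proof
    fix k :: "int^'n" assume "k \<in> {k. \<forall>i. \<bar>k $ i\<bar> \<le> N}"
    then have "\<bar>k $ i\<bar> \<le> N" for i by simp
    then have "- N \<le> k $ i \<and> k $ i \<le> N" for i by (simp add: abs_le_iff minus_le_iff)
    then have "(\<lambda>i. k $ i) \<in> UNIV \<rightarrow>\<^sub>E {-N..N}" by auto
    then show "k \<in> vec_lambda ` (UNIV \<rightarrow>\<^sub>E {-N..N})"
      by (metis image_eqI vec_nth_inverse)
  qed
qed (intro finite_imageI finite_PiE; simp)

text \<open>A ball meets only finitely many lattice translates of \<open>cell\<close>.\<close>

lemma periodic_integral_local:
  "\<exists>C::real. 0 \<le> C \<and> (\<forall>u::real^'n::finite \<Rightarrow> ennreal. u \<in> borel_measurable borel \<longrightarrow> (\<forall>x k. u (x + lattice k) = u x) \<longrightarrow>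
     (\<integral>\<^sup>+x. u x * indicator (cball 0 R) x \<partial>lborel) \<le> ennreal C * (\<integral>\<^sup>+x. u x * indicator cell x \<partial>lborel))"
proof -
  define N where "N = \<lceil>\<bar>R\<bar> + pi\<rceil>"
  define K where "K = {k::int^'n. \<forall>i. \<bar>k $ i\<bar> \<le> N}"
  have fin: "finite K" unfolding K_def by (rule finite_int_box)
  have sub: "k \<in> K" if "x \<in> cell" "x + lattice k \<in> cball 0 R" for x k
    unfolding K_def
  proof (intro CollectI allI)
    fix i
    have "\<bar>(x + lattice k) $ i\<bar> \<le> \<bar>R\<bar>"
      using that(2) component_le_norm_cart[of "x + lattice k" i] by simp
    moreover have "\<bar>x $ i\<bar> \<le> pi" using that(1) unfolding mem_cell by (metis abs_le_iff less_imp_le minus_le_iff)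
    ultimately have "\<bar>2 * pi * of_int (k $ i)\<bar> \<le> \<bar>R\<bar> + pi"
      by (simp add: lattice_def)
    moreover have "1 * \<bar>real_of_int (k $ i)\<bar> \<le> (2 * pi) * \<bar>real_of_int (k $ i)\<bar>"
      using pi_gt3 by (intro mult_right_mono) auto
    ultimately have "\<bar>real_of_int (k $ i)\<bar> \<le> \<bar>R\<bar> + pi"
      by (simp add: abs_mult)
    then show "\<bar>k $ i\<bar> \<le> N" unfolding N_def by linarith
  qed
  show ?thesis
  proof (intro exI[of _ "real (card K)"] conjI allI impI)
    fix u :: "real^'n \<Rightarrow> ennreal"
    assume u: "u \<in> borel_measurable borel" and per: "\<forall>x k. u (x + lattice k) = u x"
    have m: "(\<lambda>x. u x * indicator (cball 0 R) x) \<in> borel_measurable borel"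
      using u by (intro borel_measurable_times_ennreal borel_measurable_indicator) auto
    have "(\<integral>\<^sup>+x. u x * indicator (cball 0 R) x \<partial>lborel)
        = (\<integral>\<^sup>+x. (\<integral>\<^sup>+k. u x * indicator (cball 0 R) (x + lattice k) \<partial>count_space UNIV) * indicator cell x \<partial>lborel)"
      by (subst unfold_integral[OF m]) (simp add: per)
    also have "\<dots> \<le> (\<integral>\<^sup>+x. ennreal (real (card K)) * (u x * indicator cell x) \<partial>lborel)"
    proof (intro nn_integral_mono)
      fix x :: "real^'n"
      show "(\<integral>\<^sup>+k. u x * indicator (cball 0 R) (x + lattice k) \<partial>count_space UNIV) * indicator cell x
          \<le> ennreal (real (card K)) * (u x * indicator cell x)"
      proof (cases "x \<in> cell")
        case True
        have "(\<integral>\<^sup>+k. u x * indicator (cball 0 R) (x + lattice k) \<partial>count_space UNIV)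
            \<le> (\<integral>\<^sup>+k. u x * indicator K k \<partial>count_space UNIV)"
          using sub[OF True] by (intro nn_integral_mono mult_left_mono) (auto simp: indicator_def)
        also have "\<dots> = u x * ennreal (real (card K))"
          using fin by (simp add: nn_integral_cmult emeasure_count_space_finite ennreal_of_nat_eq_real_of_nat)
        finally show ?thesis using True by (simp add: mult.commute)
      qed simp
    qed
    also have "\<dots> = ennreal (real (card K)) * (\<integral>\<^sup>+x. u x * indicator cell x \<partial>lborel)"
      using u by (intro nn_integral_cmult borel_measurable_times_ennreal borel_measurable_indicator) auto
    finally show "(\<integral>\<^sup>+x. u x * indicator (cball 0 R) x \<partial>lborel)
      \<le> ennreal (real (card K)) * (\<integral>\<^sup>+x. u x * indicator cell x \<partial>lborel)" .
  qed simp
qed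

lemma periodic_translate: "periodic_2pi w \<Longrightarrow> periodic_2pi (\<lambda>x. w (x + h))"
  unfolding periodic_2pi_def by (metis add.assoc add.commute)

lemma periodic_diff1: "periodic_2pi w \<Longrightarrow> periodic_2pi (diff1 h w)"
  using periodic_translate[of w h] by (simp add: periodic_2pi_def diff1_def)

lemma measurable_diff1 [measurable]:
  assumes [measurable]: "w \<in> borel_measurable borel"
  shows "diff1 h w \<in> borel_measurable borel"
  unfolding diff1_def by measurable

lemma Lp_norm_translate:
  assumes "periodic_2pi w" "w \<in> borel_measurable borel"
  shows "Lp_norm cell p (\<lambda>x. w (x + h)) = Lp_norm cell p w"
proof -
  have "(\<lambda>x. ennreal (norm (w x) powr p)) \<in> borel_measurable borel"
    using assms(2) by measurable
  from periodic_integral_translate[OF this, of h] show ?thesis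
    using periodic_lattice[OF assms(1)] by (simp add: Lp_norm_lborel)
qed

text \<open>The constant depends on the radius of the support alone and the bound of the multiplier enters
  linearly: the multipliers will be differences of a test function, which are small with the
  increment.\<close>

lemma Lp_norm_local:
  assumes p: "1 \<le> p"
  shows "\<exists>C::real. 0 \<le> C \<and> (\<forall>(w::real^'n::finite \<Rightarrow> complex) b M. w \<in> borel_measurable borel \<longrightarrow> periodic_2pi w \<longrightarrow>
     0 \<le> M \<longrightarrow> (\<forall>x. norm (b x) \<le> M) \<longrightarrow> (\<forall>x. R < norm x \<longrightarrow> b x = 0) \<longrightarrow>
     Lp_norm UNIV p (\<lambda>x. b x * w x) \<le> ennreal (C * M) * Lp_norm cell p w)"
proof -
  obtain C where C: "0 \<le> C" "\<And>u::real^'n \<Rightarrow> ennreal. u \<in> borel_measurable borel \<Longrightarrow>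
      (\<And>x k. u (x + lattice k) = u x) \<Longrightarrow>
     (\<integral>\<^sup>+x. u x * indicator (cball 0 R) x \<partial>lborel) \<le> ennreal C * (\<integral>\<^sup>+x. u x * indicator cell x \<partial>lborel)"
    using periodic_integral_local[of R] by blast
  show ?thesis
  proof (intro exI[of _ "C powr (1 / p)"] conjI allI impI)
    fix w :: "real^'n \<Rightarrow> complex" and b :: "real^'n \<Rightarrow> complex" and M :: real
    assume w: "w \<in> borel_measurable borel" "periodic_2pi w"
      and M: "0 \<le> M" and b: "\<forall>x. norm (b x) \<le> M" "\<forall>x. R < norm x \<longrightarrow> b x = 0"
    let ?u = "\<lambda>x. ennreal (norm (w x) powr p)"
    have um: "?u \<in> borel_measurable borel" using w(1) by measurable
    have "(\<integral>\<^sup>+x. ennreal (norm (b x * w x) powr p) * indicator UNIV x \<partial>lborel)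
        \<le> (\<integral>\<^sup>+x. ennreal (M powr p) * (?u x * indicator (cball 0 R) x) \<partial>lborel)"
    proof (intro nn_integral_mono)
      fix x
      show "ennreal (norm (b x * w x) powr p) * indicator UNIV x \<le> ennreal (M powr p) * (?u x * indicator (cball 0 R) x)"
      proof (cases "R < norm x")
        case False
        have "norm (b x * w x) powr p \<le> (M * norm (w x)) powr p"
          using b p M by (intro powr_mono2) (auto simp: norm_mult intro!: mult_right_mono)
        then show ?thesis using False M
          by (simp add: powr_mult ennreal_mult[symmetric] ennreal_leI)
      qed (simp add: b)
    qed
    also have "\<dots> = ennreal (M powr p) * (\<integral>\<^sup>+x. ?u x * indicator (cball 0 R) x \<partial>lborel)"
      using um by (intro nn_integral_cmult borel_measurable_times_ennreal borel_measurable_indicator) auto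
    also have "\<dots> \<le> ennreal (M powr p) * (ennreal C * (\<integral>\<^sup>+x. ?u x * indicator cell x \<partial>lborel))"
      using periodic_lattice[OF w(2)] by (intro mult_left_mono C(2) um) auto
    also have "\<dots> = ennreal_powr (ennreal (C powr (1/p) * M) * Lp_norm cell p w) p"
      using p C(1) M by (simp add: ennreal_powr_mult Lp_norm_powr ennreal_powr_ennreal powr_mult powr_powr ennreal_mult mult_ac)
    finally show "Lp_norm UNIV p (\<lambda>x. b x * w x) \<le> ennreal (C powr (1/p) * M) * Lp_norm cell p w"
      using p by (simp add: Lp_norm_le_iff)
  qed simp
qed

section \<open>Differences and weak gradients\<close>

text \<open>Jensen's inequality for \<open>t \<mapsto> t\<^sup>p\<close>; a non-integrable \<open>g\<close> has integral zero by convention.\<close>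

lemma (in prob_space) norm_integral_powr_le:
  fixes g :: "'a \<Rightarrow> complex"
  assumes p: "1 \<le> p" and g [measurable]: "g \<in> borel_measurable M"
  shows "ennreal (norm (LINT t|M. g t) powr p) \<le> (\<integral>\<^sup>+t. ennreal (norm (g t) powr p) \<partial>M)"
proof (cases "integrable M g \<and> (\<integral>\<^sup>+t. ennreal (norm (g t) powr p) \<partial>M) < top")
  case True
  then have g1: "integrable M (\<lambda>t. norm (g t))" by (simp add: integrable_norm)
  have gp: "integrable M (\<lambda>t. norm (g t) powr p)"
    using True by (intro integrableI_nonneg) auto
  have "norm (LINT t|M. g t) powr p \<le> (LINT t|M. norm (g t)) powr p"
    using p by (intro powr_mono2 integral_norm_bound) auto
  also have "\<dots> = \<bar>LINT t|M. norm (g t)\<bar> powr p"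
    by (simp add: integral_nonneg_AE)
  also have "\<dots> \<le> (LINT t|M. \<bar>norm (g t)\<bar> powr p)"
    by (rule jensens_inequality[where I=UNIV, OF g1 _ _ _ convex_on_powr_abs[OF p]]) (use gp in auto)
  also have "ennreal \<dots> = (\<integral>\<^sup>+t. ennreal (norm (g t) powr p) \<partial>M)"
    using gp by (subst nn_integral_eq_integral) auto
  finally show ?thesis by (simp add: ennreal_leI)
next
  case False
  then show ?thesis
    by (auto simp: not_integrable_integral_eq top_unique not_less)
qed

definition unit_interval :: "real measure" where
  "unit_interval = density lborel (\<lambda>t. ennreal (indicator {0..1} t))"

lemma sets_unit_interval [measurable_cong, simp]: "sets unit_interval = sets borel"
  by (simp add: unit_interval_def)

lemma space_unit_interval [simp]: "space unit_interval = UNIV"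
  by (simp add: unit_interval_def)

lemma prob_space_unit_interval: "prob_space unit_interval"
proof
  have "emeasure unit_interval (space unit_interval)
      = (\<integral>\<^sup>+t. indicator {0..1::real} t \<partial>lborel)"
    unfolding unit_interval_def by (subst emeasure_density) (auto simp: ennreal_indicator)
  then show "emeasure unit_interval (space unit_interval) = 1" by simp
qed

lemma AE_unit_interval: "AE t in unit_interval. 0 \<le> t \<and> t \<le> 1"
  unfolding unit_interval_def by (subst AE_density) (auto intro!: AE_I2 simp: indicator_def split: if_splits)

lemma pair_sigma_finite_unit_interval:
  "pair_sigma_finite (lborel :: 'a::euclidean_space measure) unit_interval"
proof -
  interpret prob_space unit_interval by (rule prob_space_unit_interval)
  show ?thesis by (intro pair_sigma_finite.intro) (auto intro: sigma_finite_lborel sigma_finite_measure_axioms)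
qed

lemma integral_unit_interval_FTC:
  fixes F :: "real \<Rightarrow> complex"
  assumes "\<And>t. (F has_vector_derivative f t) (at t within {0..1})" "continuous_on {0..1} f"
    "f \<in> borel_measurable borel"
  shows "(LINT t|unit_interval. f t) = F 1 - F 0"
proof -
  have "(LINT t|unit_interval. f t) = (LINT t|lborel. indicator {0..1} t *\<^sub>R f t)"
    unfolding unit_interval_def using assms(3) by (subst integral_density) auto
  also have "\<dots> = F 1 - F 0"
    using assms(1,2) by (intro integral_FTC_Icc) auto
  finally show ?thesis .
qed

lemma integrable_pair_unit_interval:
  fixes F :: "(real^'n::finite) \<times> real \<Rightarrow> complex"
  assumes F [measurable]: "F \<in> borel_measurable (lborel \<Otimes>\<^sub>M unit_interval)"
    and bd: "\<And>t. 0 \<le> t \<Longrightarrow> t \<le> 1 \<Longrightarrow> (\<integral>\<^sup>+x. ennreal (norm (F (x, t))) \<partial>lborel) \<le> B"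
    and B: "B < top"
  shows "integrable (lborel \<Otimes>\<^sub>M unit_interval) F"
proof (rule integrableI_bounded[OF F])
  interpret prob_space unit_interval by (rule prob_space_unit_interval)
  interpret pair_sigma_finite "lborel :: (real^'n) measure" unit_interval
    by (rule pair_sigma_finite_unit_interval)
  have "(\<integral>\<^sup>+z. ennreal (norm (F z)) \<partial>(lborel \<Otimes>\<^sub>M unit_interval))
      = (\<integral>\<^sup>+t. \<integral>\<^sup>+x. ennreal (norm (F (x, t))) \<partial>lborel \<partial>unit_interval)"
    by (rule nn_integral_snd[symmetric]) measurable
  also have "\<dots> \<le> (\<integral>\<^sup>+t. B \<partial>unit_interval)"
    by (rule nn_integral_mono_AE, rule eventually_mono[OF AE_unit_interval]) (use bd in auto)
  also have "\<dots> = B" using emeasure_space_1 by simp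
  finally show "(\<integral>\<^sup>+z. ennreal (norm (F z)) \<partial>(lborel \<Otimes>\<^sub>M unit_interval)) < \<infinity>"
    using B by simp
qed

lemma integrable_lborel_mult_test:
  assumes f: "locally_integrable f" "f \<in> borel_measurable borel" and \<phi>: "\<phi> \<in> Cc_infinity"
  shows "integrable lborel (\<lambda>x. f x * \<phi> x)"
proof -
  have "(\<lambda>x. f x * \<phi> x) \<in> borel_measurable lborel"
    using f(2) C_infinity_measurable[OF Cc_infinityD[OF \<phi>]] by simp
  from integrable_completion[OF this] integrable_mult_test[OF f(1) \<phi>] show ?thesis by simp
qed

lemma locally_integrable_nn_integral:
  assumes "locally_integrable g" "g \<in> borel_measurable borel"
  shows "(\<integral>\<^sup>+x. ennreal (norm (g x)) * indicator (cball 0 R) x \<partial>lborel) < top"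
proof -
  have "integrable lebesgue (\<lambda>x. indicator (cball 0 R) x *\<^sub>R g x)"
    using assms(1) unfolding locally_integrable_iff_balls set_integrable_def by blast
  then have "(\<integral>\<^sup>+x. ennreal (norm (indicator (cball 0 R) x *\<^sub>R g x)) \<partial>lebesgue) < \<infinity>"
    by (simp add: integrable_iff_bounded)
  also have "(\<integral>\<^sup>+x. ennreal (norm (indicator (cball 0 R) x *\<^sub>R g x)) \<partial>lebesgue)
      = (\<integral>\<^sup>+x. ennreal (norm (g x)) * indicator (cball 0 R) x \<partial>lborel)"
    unfolding nn_integral_completion by (intro nn_integral_cong) (auto simp: indicator_def)
  finally show ?thesis by simp
qed

text \<open>The fundamental theorem of calculus for weak gradients, proved by pairing both sides with a
  test function and moving the difference onto it.\<close>

theorem diff1_eq_integral_gradient: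
  fixes w :: "real^'n::finite \<Rightarrow> complex"
  assumes wg: "weak_gradient w v"
    and w [measurable]: "w \<in> borel_measurable borel" and v [measurable]: "\<And>i. v i \<in> borel_measurable borel"
  shows "AE x in lebesgue. diff1 h w x = (LINT t|unit_interval. (\<Sum>i\<in>UNIV. (h $ i) *\<^sub>R v i (x + t *\<^sub>R h)))"
proof -
  interpret prob_space unit_interval by (rule prob_space_unit_interval)
  interpret P: pair_sigma_finite "lborel :: (real^'n) measure" unit_interval
    by (rule pair_sigma_finite_unit_interval)
  define u where "u = (\<lambda>x. \<Sum>i\<in>UNIV. (h $ i) *\<^sub>R v i x)"
  have u [measurable]: "u \<in> borel_measurable borel" unfolding u_def by measurable
  have li: "locally_integrable w" "locally_integrable (v i)" for i
    using wg by (auto simp: weak_gradient_def)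
  have ui: "locally_integrable u"
  proof -
    have "locally_integrable (\<lambda>x. \<Sum>i\<in>I. (h $ i) *\<^sub>R v i x)" for I
    proof (induction I rule: infinite_finite_induct)
      case (insert i I)
      then show ?case
        using locally_integrable_add[OF locally_integrable_cmult[OF li(2)[of i], of "of_real (h $ i)"] insert.IH]
        by (simp add: scaleR_conv_of_real)
    qed (simp_all add: locally_integrable_def set_integrable_def)
    then show ?thesis unfolding u_def .
  qed
  define G where "G = (\<lambda>x. LINT t|unit_interval. u (x + t *\<^sub>R h))"
  have Vm [measurable]: "(\<lambda>(x, t). u (x + t *\<^sub>R h)) \<in> borel_measurable (lborel \<Otimes>\<^sub>M unit_interval)"
    by measurable
  have Gm: "G \<in> borel_measurable borel"
    using borel_measurable_lebesgue_integral[OF Vm] unfolding G_def by simp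
  (* Local integrability survives in both variables jointly because, for t in [0,1], the shift
     by t h enlarges the support of the weight by at most norm h. *)
  have pair: "integrable (lborel \<Otimes>\<^sub>M unit_interval) (\<lambda>(x, t). u (x + t *\<^sub>R h) * b x)"
    if b [measurable]: "b \<in> borel_measurable borel" and M: "\<And>x. norm (b x) \<le> M"
      and R: "\<And>x. R < norm x \<Longrightarrow> b x = 0" for b :: "real^'n \<Rightarrow> complex" and M R
  proof (rule integrable_pair_unit_interval)
    let ?B = "ennreal M * (\<integral>\<^sup>+x. ennreal (norm (u x)) * indicator (cball 0 (R + norm h)) x \<partial>lborel)"
    show "?B < top"
      using locally_integrable_nn_integral[OF ui u] by (simp add: ennreal_mult_less_top)
    fix t :: real assume t: "0 \<le> t" "t \<le> 1"
    have M0: "0 \<le> M" using M[of 0] norm_ge_zero order_trans by blast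
    have "(\<integral>\<^sup>+x. ennreal (norm (case (x, t) of (x, t) \<Rightarrow> u (x + t *\<^sub>R h) * b x)) \<partial>lborel)
        \<le> (\<integral>\<^sup>+x. ennreal M * (ennreal (norm (u (x + t *\<^sub>R h))) * indicator (cball 0 (R + norm h)) (x + t *\<^sub>R h)) \<partial>lborel)"
    proof (rule nn_integral_mono)
      fix x :: "real^'n"
      show "ennreal (norm (case (x, t) of (x, t) \<Rightarrow> u (x + t *\<^sub>R h) * b x))
        \<le> ennreal M * (ennreal (norm (u (x + t *\<^sub>R h))) * indicator (cball 0 (R + norm h)) (x + t *\<^sub>R h))"
      proof (cases "R < norm x")
        case False
        have "norm (t *\<^sub>R h) \<le> norm h" using t by (simp add: mult_left_le_one_le)
        then have "norm (x + t *\<^sub>R h) \<le> R + norm h"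
          using False norm_triangle_ineq[of x "t *\<^sub>R h"] by simp
        then show ?thesis
          using mult_left_mono[OF M[of x], of "norm (u (x + t *\<^sub>R h))"] M0
          by (simp add: norm_mult ennreal_mult[symmetric] ennreal_leI mult.commute)
      qed (simp add: R)
    qed
    also have "\<dots> = (\<integral>\<^sup>+x. ennreal M * (ennreal (norm (u x)) * indicator (cball 0 (R + norm h)) x) \<partial>lborel)"
      by (rule nn_integral_lborel_translate[where F="\<lambda>x. ennreal M * (ennreal (norm (u x)) * indicator (cball 0 (R + norm h)) x)"])
        (intro borel_measurable_times_ennreal borel_measurable_indicator; simp)
    also have "\<dots> = ?B"
      by (intro nn_integral_cmult borel_measurable_times_ennreal borel_measurable_indicator) auto
    finally show "(\<integral>\<^sup>+x. ennreal (norm (case (x, t) of (x, t) \<Rightarrow> u (x + t *\<^sub>R h) * b x)) \<partial>lborel) \<le> ?B" .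
  qed measurable
  have Gi: "locally_integrable G"
    unfolding locally_integrable_iff_balls set_integrable_def
  proof
    fix R
    have "integrable (lborel \<Otimes>\<^sub>M unit_interval) (\<lambda>(x, t). u (x + t *\<^sub>R h) * indicator (cball 0 R) x)"
    proof (rule pair)
      show "norm (indicator (cball 0 R) x :: complex) \<le> 1" for x :: "real^'n"
        by (simp add: indicator_def)
      show "indicator (cball 0 R) x = (0 :: complex)" if "R < norm x" for x :: "real^'n"
        using that by simp
    qed (intro borel_measurable_indicator, simp)
    from P.integrable_fst'[OF this]
    have "integrable lborel (\<lambda>x. LINT t|unit_interval. u (x + t *\<^sub>R h) * indicator (cball 0 R) x)" by simp
    also have "(\<lambda>x. LINT t|unit_interval. u (x + t *\<^sub>R h) * indicator (cball 0 R) x)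
        = (\<lambda>x. indicator (cball 0 R) x *\<^sub>R G x)"
      unfolding G_def by (auto simp: indicator_def)
    finally show "integrable lebesgue (\<lambda>x. indicator (cball 0 R) x *\<^sub>R G x)"
      by (subst integrable_completion) (auto dest: borel_measurable_integrable)
  qed
  have whi: "locally_integrable (diff1 h w)"
    using locally_integrable_add[OF locally_integrable_translate[OF li(1) w, of h]
        locally_integrable_cmult[OF li(1), of "-1"]] by (simp add: diff1_def)
  have "AE x in lebesgue. diff1 h w x = G x"
  proof (rule locally_integrable_AE_eqI[OF whi Gi])
    fix \<phi> :: "real^'n \<Rightarrow> complex" assume \<phi>: "\<phi> \<in> Cc_infinity"
    note C = Cc_infinityD[OF \<phi>]
    have \<phi>m [measurable]: "\<phi> \<in> borel_measurable borel" by (rule C_infinity_measurable[OF C])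
    obtain M where M: "\<And>x. norm (\<phi> x) \<le> M" using Cc_infinity_bounded[OF \<phi>] by blast
    obtain R where R: "\<And>x. R < norm x \<Longrightarrow> \<phi> x = 0" using \<phi> by (auto simp: Cc_infinity_iff)
    define D where "D = (\<lambda>x. \<Sum>i\<in>UNIV. (h $ i) *\<^sub>R partial i \<phi> x)"
    have Dc: "continuous_on UNIV D"
      unfolding D_def by (intro continuous_intros C_infinity_continuous[OF C_infinity_partial[OF C]])
    then have Dm [measurable]: "D \<in> borel_measurable borel" by (rule borel_measurable_continuous_onI)
    have Dcc: "D \<in> Cc_infinity"
    proof -
      have "(\<lambda>x. \<Sum>i\<in>I. (h $ i) *\<^sub>R partial i \<phi> x) \<in> Cc_infinity" for I
      proof (induction I rule: infinite_finite_induct)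
        case (insert i I)
        then show ?case
          using Cc_infinity_add[OF Cc_infinity_cmult[OF Cc_infinity_partial[OF \<phi>, of i], of "of_real (h $ i)"] insert.IH]
          by (simp add: scaleR_conv_of_real)
      qed (auto simp: Cc_infinity_iff C_infinity_const)
      then show ?thesis unfolding D_def .
    qed
    obtain MD where MD: "\<And>x. norm (D x) \<le> MD" using Cc_infinity_bounded[OF Dcc] by blast
    obtain RD where RD: "\<And>x. RD < norm x \<Longrightarrow> D x = 0" using Dcc by (auto simp: Cc_infinity_iff)
    have MD0: "0 \<le> MD" using MD[of 0] norm_ge_zero order_trans by blast

    have per_t: "(LINT x|lborel. u (x + t *\<^sub>R h) * \<phi> x) = - (LINT x|lborel. w x * D (x - t *\<^sub>R h))" for t
    proof -
      let ?\<psi> = "\<lambda>x. \<phi> (x + (- (t *\<^sub>R h)))"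
      have \<psi>: "?\<psi> \<in> Cc_infinity" by (rule Cc_infinity_translate[OF \<phi>])
      have \<psi>m [measurable]: "?\<psi> \<in> borel_measurable borel" by measurable
      have pm [measurable]: "partial i \<phi> \<in> borel_measurable borel" for i
        by (rule C_infinity_measurable[OF C_infinity_partial[OF C]])
      have vi: "integrable lborel (\<lambda>x. v i x * ?\<psi> x)" for i
        by (rule integrable_lborel_mult_test[OF li(2) v \<psi>])
      have wi: "integrable lborel (\<lambda>x. w x * partial i ?\<psi> x)" for i
        by (rule integrable_lborel_mult_test[OF li(1) w Cc_infinity_partial[OF \<psi>]])
      have eq: "(LINT x|lborel. w x * partial i ?\<psi> x) = - (LINT x|lborel. v i x * ?\<psi> x)" for i
      proof -
        have "(LINT x|lebesgue. w x * partial i ?\<psi> x) = - (LINT x|lebesgue. v i x * ?\<psi> x)"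
          using wg \<psi> unfolding weak_gradient_def by blast
        moreover have "(LINT x|lebesgue. w x * partial i ?\<psi> x) = (LINT x|lborel. w x * partial i ?\<psi> x)"
          using wi by (intro integral_completion) (auto dest: borel_measurable_integrable)
        moreover have "(LINT x|lebesgue. v i x * ?\<psi> x) = (LINT x|lborel. v i x * ?\<psi> x)"
          using vi by (intro integral_completion) (auto dest: borel_measurable_integrable)
        ultimately show ?thesis by simp
      qed
      have um: "(\<lambda>x. u x * ?\<psi> x) \<in> borel_measurable borel" by measurable
      have "(LINT x|lborel. u (x + t *\<^sub>R h) * \<phi> x) = (LINT x|lborel. u x * ?\<psi> x)"
        using LINT_lborel_translate[OF um, of "t *\<^sub>R h"] by simp
      also have "\<dots> = (LINT x|lborel. (\<Sum>i\<in>UNIV. (h $ i) *\<^sub>R (v i x * ?\<psi> x)))"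
        by (simp add: u_def sum_distrib_right)
      also have "\<dots> = (\<Sum>i\<in>UNIV. (h $ i) *\<^sub>R (LINT x|lborel. v i x * ?\<psi> x))"
        using vi by simp
      also have "\<dots> = - (\<Sum>i\<in>UNIV. (h $ i) *\<^sub>R (LINT x|lborel. w x * partial i ?\<psi> x))"
        by (simp only: eq scaleR_minus_right sum_negf minus_minus)
      also have "(\<Sum>i\<in>UNIV. (h $ i) *\<^sub>R (LINT x|lborel. w x * partial i ?\<psi> x))
          = (LINT x|lborel. (\<Sum>i\<in>UNIV. (h $ i) *\<^sub>R (w x * partial i ?\<psi> x)))"
        using wi by simp
      also have "\<dots> = (LINT x|lborel. w x * D (x - t *\<^sub>R h))"
        unfolding partial_translate by (simp add: D_def sum_distrib_left)
      finally show ?thesis .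
    qed

    have pairD: "integrable (lborel \<Otimes>\<^sub>M unit_interval) (\<lambda>(x, t). w x * D (x - t *\<^sub>R h))"
    proof (rule integrable_pair_unit_interval)
      let ?B = "ennreal MD * (\<integral>\<^sup>+x. ennreal (norm (w x)) * indicator (cball 0 (RD + norm h)) x \<partial>lborel)"
      show "?B < top"
        using locally_integrable_nn_integral[OF li(1) w] by (simp add: ennreal_mult_less_top)
      fix t :: real assume t: "0 \<le> t" "t \<le> 1"
      have "(\<integral>\<^sup>+x. ennreal (norm (case (x, t) of (x, t) \<Rightarrow> w x * D (x - t *\<^sub>R h))) \<partial>lborel)
          \<le> (\<integral>\<^sup>+x. ennreal MD * (ennreal (norm (w x)) * indicator (cball 0 (RD + norm h)) x) \<partial>lborel)"
      proof (rule nn_integral_mono)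
        fix x :: "real^'n"
        show "ennreal (norm (case (x, t) of (x, t) \<Rightarrow> w x * D (x - t *\<^sub>R h)))
          \<le> ennreal MD * (ennreal (norm (w x)) * indicator (cball 0 (RD + norm h)) x)"
        proof (cases "RD < norm (x - t *\<^sub>R h)")
          case False
          have "norm (t *\<^sub>R h) \<le> norm h" using t by (simp add: mult_left_le_one_le)
          then have "norm x \<le> RD + norm h"
            using False norm_triangle_ineq[of "x - t *\<^sub>R h" "t *\<^sub>R h"] by simp
          then show ?thesis
            using mult_left_mono[OF MD[of "x - t *\<^sub>R h"], of "norm (w x)"] MD0
            by (simp add: norm_mult ennreal_mult[symmetric] ennreal_leI mult.commute)
        qed (simp add: RD)
      qed
      also have "\<dots> = ?B"
        by (intro nn_integral_cmult borel_measurable_times_ennreal borel_measurable_indicator) auto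
      finally show "(\<integral>\<^sup>+x. ennreal (norm (case (x, t) of (x, t) \<Rightarrow> w x * D (x - t *\<^sub>R h))) \<partial>lborel) \<le> ?B" .
    qed measurable

    have FTC: "(LINT t|unit_interval. D (x - t *\<^sub>R h)) = \<phi> x - \<phi> (x - h)" for x
    proof -
      have "((\<lambda>t. - \<phi> (x + t *\<^sub>R (- h))) has_vector_derivative D (x - t *\<^sub>R h)) (at t within {0..1})" for t
        using has_vector_derivative_minus[OF C_infinity_along_line[OF C, of x "- h" t "{0..1}"]]
        by (simp add: D_def sum_negf)
      moreover have "continuous_on {0..1} (\<lambda>t. D (x - t *\<^sub>R h))"
        by (rule continuous_on_compose2[OF Dc]) (auto intro!: continuous_intros)
      moreover have "(\<lambda>t. D (x - t *\<^sub>R h)) \<in> borel_measurable borel" by measurable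
      ultimately show ?thesis
        using integral_unit_interval_FTC[of "\<lambda>t. - \<phi> (x + t *\<^sub>R (- h))" "\<lambda>t. D (x - t *\<^sub>R h)"]
        by simp
    qed

    have w1: "integrable lborel (\<lambda>x. w x * \<phi> x)"
      by (rule integrable_lborel_mult_test[OF li(1) w \<phi>])
    have w2: "integrable lborel (\<lambda>x. w x * \<phi> (x + (- h)))"
      by (rule integrable_lborel_mult_test[OF li(1) w Cc_infinity_translate[OF \<phi>]])
    have w3: "integrable lborel (\<lambda>x. w (x + h) * \<phi> x)"
      by (rule integrable_lborel_mult_test[OF locally_integrable_translate[OF li(1) w] _ \<phi>]) measurable
    have m2: "(\<lambda>x. w x * \<phi> (x + (- h))) \<in> borel_measurable borel" by measurable
    have "(LINT x|lborel. G x * \<phi> x) = (LINT x|lborel. LINT t|unit_interval. u (x + t *\<^sub>R h) * \<phi> x)"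
      by (simp add: G_def)
    also have "\<dots> = (LINT t|unit_interval. LINT x|lborel. u (x + t *\<^sub>R h) * \<phi> x)"
      by (rule P.Fubini_integral[symmetric]) (rule pair[OF \<phi>m M R])
    also have "\<dots> = - (LINT t|unit_interval. LINT x|lborel. w x * D (x - t *\<^sub>R h))"
      by (simp add: per_t)
    also have "(LINT t|unit_interval. LINT x|lborel. w x * D (x - t *\<^sub>R h))
        = (LINT x|lborel. LINT t|unit_interval. w x * D (x - t *\<^sub>R h))"
      by (rule P.Fubini_integral) (rule pairD)
    also have "\<dots> = (LINT x|lborel. w x * \<phi> x - w x * \<phi> (x + (- h)))"
      by (simp add: FTC algebra_simps)
    also have "- \<dots> = (LINT x|lborel. w x * \<phi> (x + (- h))) - (LINT x|lborel. w x * \<phi> x)"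
      using w1 w2 by simp
    also have "(LINT x|lborel. w x * \<phi> (x + (- h))) = (LINT x|lborel. w (x + h) * \<phi> x)"
      using LINT_lborel_translate[OF m2, of h] by simp
    also have "\<dots> - (LINT x|lborel. w x * \<phi> x) = (LINT x|lborel. diff1 h w x * \<phi> x)"
      using w1 w3 by (simp add: diff1_def left_diff_distrib)
    finally have main: "(LINT x|lborel. G x * \<phi> x) = (LINT x|lborel. diff1 h w x * \<phi> x)" .
    have gm: "(\<lambda>x. G x * \<phi> x) \<in> borel_measurable lborel" "(\<lambda>x. diff1 h w x * \<phi> x) \<in> borel_measurable lborel"
      using Gm by measurable
    show "(LINT x|lebesgue. diff1 h w x * \<phi> x) = (LINT x|lebesgue. G x * \<phi> x)"
      using main by (simp only: integral_completion[OF gm(1)] integral_completion[OF gm(2)])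
  qed
  then show ?thesis by (simp only: G_def u_def)
qed

text \<open>The difference is an average of translates of the gradient along \<open>h\<close>.  By Jensen and Tonelli its norm
  is at most the average of their norms, and periodicity makes all of these equal.\<close>

lemma Lp_norm_diff1_le_gradient:
  fixes w :: "real^'n::finite \<Rightarrow> complex"
  assumes p: "1 \<le> p" and wg: "weak_gradient w v"
    and w: "w \<in> borel_measurable borel" and v [measurable]: "\<And>i. v i \<in> borel_measurable borel"
    and per: "\<And>i. periodic_2pi (v i)"
  shows "Lp_norm cell p (diff1 h w) \<le> ennreal (norm h) * (\<Sum>i\<in>UNIV. Lp_norm cell p (v i))"
proof -
  interpret prob_space unit_interval by (rule prob_space_unit_interval)
  interpret P: pair_sigma_finite "lborel :: (real^'n) measure" unit_interval
    by (rule pair_sigma_finite_unit_interval)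
  define u where "u = (\<lambda>x. \<Sum>i\<in>UNIV. (h $ i) *\<^sub>R v i x)"
  have u [measurable]: "u \<in> borel_measurable borel" unfolding u_def by measurable
  have perU: "periodic_2pi u"
    using per unfolding u_def periodic_2pi_def by simp
  have "Lp_norm cell p (diff1 h w) = Lp_norm cell p (\<lambda>x. LINT t|unit_interval. u (x + t *\<^sub>R h))"
    unfolding u_def by (rule Lp_norm_cong_AE[OF diff1_eq_integral_gradient[OF wg w v]])
  also have "\<dots> \<le> Lp_norm cell p u"
  proof -
    have "(\<integral>\<^sup>+x. ennreal (norm (LINT t|unit_interval. u (x + t *\<^sub>R h)) powr p) * indicator cell x \<partial>lborel)
        \<le> (\<integral>\<^sup>+x. \<integral>\<^sup>+t. ennreal (norm (u (x + t *\<^sub>R h)) powr p) * indicator cell x \<partial>unit_interval \<partial>lborel)"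
    proof (rule nn_integral_mono)
      fix x
      have "ennreal (norm (LINT t|unit_interval. u (x + t *\<^sub>R h)) powr p)
          \<le> (\<integral>\<^sup>+t. ennreal (norm (u (x + t *\<^sub>R h)) powr p) \<partial>unit_interval)"
        by (rule norm_integral_powr_le[OF p]) measurable
      then show "ennreal (norm (LINT t|unit_interval. u (x + t *\<^sub>R h)) powr p) * indicator cell x
          \<le> (\<integral>\<^sup>+t. ennreal (norm (u (x + t *\<^sub>R h)) powr p) * indicator cell x \<partial>unit_interval)"
        by (auto simp: indicator_def)
    qed
    also have "\<dots> = (\<integral>\<^sup>+t. \<integral>\<^sup>+x. ennreal (norm (u (x + t *\<^sub>R h)) powr p) * indicator cell x \<partial>lborel \<partial>unit_interval)"
    proof (rule P.Fubini'[symmetric])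
      have [measurable]: "(\<lambda>z::(real^'n) \<times> real. indicator cell (fst z) :: ennreal) \<in> borel_measurable (lborel \<Otimes>\<^sub>M unit_interval)"
        by (rule measurable_compose[OF measurable_fst]) simp
      show "(\<lambda>(x, t). ennreal (norm (u (x + t *\<^sub>R h)) powr p) * indicator cell x)
          \<in> borel_measurable (lborel \<Otimes>\<^sub>M unit_interval)"
        unfolding case_prod_unfold by measurable
    qed
    also have "\<dots> = (\<integral>\<^sup>+t. (\<integral>\<^sup>+x. ennreal (norm (u x) powr p) * indicator cell x \<partial>lborel) \<partial>unit_interval)"
      using periodic_lattice[OF perU]
      by (intro nn_integral_cong periodic_integral_translate[where u="\<lambda>x. ennreal (norm (u x) powr p)"]) auto
    also have "\<dots> = (\<integral>\<^sup>+x. ennreal (norm (u x) powr p) * indicator cell x \<partial>lborel)"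
      using emeasure_space_1 by simp
    also have "\<dots> = ennreal_powr (Lp_norm cell p u) p"
      using p by (simp add: Lp_norm_powr)
    finally show ?thesis using p by (simp add: Lp_norm_le_iff)
  qed
  also have "\<dots> \<le> (\<Sum>i\<in>UNIV. Lp_norm cell p (\<lambda>x. of_real (h $ i) * v i x))"
    unfolding u_def scaleR_conv_of_real using p sets_cell by (intro Lp_norm_sum) auto
  also have "\<dots> = (\<Sum>i\<in>UNIV. ennreal \<bar>h $ i\<bar> * Lp_norm cell p (v i))"
    using p by (intro sum.cong refl) (simp add: Lp_norm_cmult sets_cell)
  also have "\<dots> \<le> (\<Sum>i\<in>UNIV. ennreal (norm h) * Lp_norm cell p (v i))"
    by (intro sum_mono mult_right_mono ennreal_leI component_le_norm_cart) auto
  finally show ?thesis by (simp add: sum_distrib_left)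
qed

lemma weak_gradient_diff1:
  fixes w :: "real^'n::finite \<Rightarrow> complex"
  assumes wg: "weak_gradient w v"
    and w [measurable]: "w \<in> borel_measurable borel" and v [measurable]: "\<And>i. v i \<in> borel_measurable borel"
  shows "weak_gradient (diff1 h w) (\<lambda>i. diff1 h (v i))"
  unfolding weak_gradient_def
proof (intro conjI allI ballI)
  have li: "locally_integrable w" "locally_integrable (v i)" for i
    using wg by (auto simp: weak_gradient_def)
  have d: "locally_integrable (diff1 h g)" if "locally_integrable g" "g \<in> borel_measurable borel" for g
    using locally_integrable_add[OF locally_integrable_translate[OF that, of h]
        locally_integrable_cmult[OF that(1), of "-1"]] by (simp add: diff1_def)
  show "locally_integrable (diff1 h w)" "locally_integrable (diff1 h (v i))" for i
    using li by (auto intro: d)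
  fix \<phi> :: "real^'n \<Rightarrow> complex" and i assume \<phi>: "\<phi> \<in> Cc_infinity"
  let ?\<psi> = "\<lambda>x. \<phi> (x + (- h))"
  have \<psi>: "?\<psi> \<in> Cc_infinity" by (rule Cc_infinity_translate[OF \<phi>])
  have move: "(LINT x|lebesgue. diff1 h g x * \<eta> x)
      = (LINT x|lebesgue. g x * \<eta> (x + (- h))) - (LINT x|lebesgue. g x * \<eta> x)"
    if g: "locally_integrable g" and gm [measurable]: "g \<in> borel_measurable borel"
      and \<eta>: "\<eta> \<in> Cc_infinity" for g \<eta>
  proof -
    have [measurable]: "\<eta> \<in> borel_measurable borel" by (rule C_infinity_measurable[OF Cc_infinityD[OF \<eta>]])
    have "(LINT x|lebesgue. diff1 h g x * \<eta> x) = (LINT x|lebesgue. g (x + h) * \<eta> x - g x * \<eta> x)"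
      by (simp add: diff1_def left_diff_distrib)
    also have "\<dots> = (LINT x|lebesgue. g (x + h) * \<eta> x) - (LINT x|lebesgue. g x * \<eta> x)"
      by (intro Bochner_Integration.integral_diff integrable_mult_test[OF locally_integrable_translate[OF g gm] \<eta>]
          integrable_mult_test[OF g \<eta>])
    also have "(LINT x|lebesgue. g (x + h) * \<eta> x) = (LINT x|lebesgue. g x * \<eta> (x + (- h)))"
    proof -
      have "(\<lambda>x. g x * \<eta> (x + (- h))) \<in> borel_measurable borel" "(\<lambda>x. g (x + h) * \<eta> x) \<in> borel_measurable borel"
        by measurable
      then show ?thesis
        using LINT_lebesgue_translate[where F="\<lambda>x. g x * \<eta> (x + (- h))" and h=h]
        by (simp add: borel_imp_lebesgue_measurable)
    qed
    finally show ?thesis .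
  qed
  have E: "(LINT x|lebesgue. w x * partial i \<eta> x) = - (LINT x|lebesgue. v i x * \<eta> x)" if "\<eta> \<in> Cc_infinity" for \<eta>
    using wg that by (simp add: weak_gradient_def)
  show "(LINT x|lebesgue. diff1 h w x * partial i \<phi> x) = - (LINT x|lebesgue. diff1 h (v i) x * \<phi> x)"
    using E[OF \<psi>] E[OF \<phi>]
    unfolding move[OF li(1) w Cc_infinity_partial[OF \<phi>]] move[OF li(2) v \<phi>] partial_translate by simp
qed

section \<open>The dilation-invariant measure\<close>

text \<open>The measure \<open>dh / |h|\<^sup>n\<close>.\<close>

definition dilation_measure :: "(real^'n::finite) measure" where
  "dilation_measure = density lborel (\<lambda>h. ennreal (1 / norm h ^ CARD('n)))"

lemma sets_dilation_measure [measurable_cong, simp]: "sets dilation_measure = sets borel"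
  by (simp add: dilation_measure_def)

lemma space_dilation_measure [simp]: "space dilation_measure = UNIV"
  by (simp add: dilation_measure_def)

lemma nn_integral_dilation_measure:
  fixes F :: "real^'n::finite \<Rightarrow> ennreal"
  assumes "F \<in> borel_measurable borel"
  shows "(\<integral>\<^sup>+h. F h \<partial>dilation_measure) = (\<integral>\<^sup>+h. ennreal (1 / norm h ^ CARD('n)) * F h \<partial>lborel)"
  unfolding dilation_measure_def using assms by (intro nn_integral_density) auto

lemma dilation_measure_scale:
  fixes F :: "real^'n::finite \<Rightarrow> ennreal"
  assumes F [measurable]: "F \<in> borel_measurable borel" and c: "0 < c"
  shows "(\<integral>\<^sup>+h. F (c *\<^sub>R h) \<partial>dilation_measure) = (\<integral>\<^sup>+h. F h \<partial>dilation_measure)"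
proof -
  let ?w = "\<lambda>h::real^'n. ennreal (1 / norm h ^ CARD('n))"
  have "(\<integral>\<^sup>+h. F h \<partial>dilation_measure) = (\<integral>\<^sup>+h. ?w h * F h \<partial>lborel)"
    by (rule nn_integral_dilation_measure[OF F])
  also have "\<dots> = (\<integral>\<^sup>+h. ?w h * F h \<partial>density (distr lborel borel (\<lambda>x. 0 + c *\<^sub>R x)) (\<lambda>_. ennreal (\<bar>c\<bar> ^ DIM(real^'n))))"
    using lborel_affine[of c "0::real^'n"] c by simp
  also have "\<dots> = (\<integral>\<^sup>+h. ennreal (\<bar>c\<bar> ^ DIM(real^'n)) * (?w (c *\<^sub>R h) * F (c *\<^sub>R h)) \<partial>lborel)"
    by (subst nn_integral_density, simp, simp, subst nn_integral_distr) simp_all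
  also have "\<dots> = (\<integral>\<^sup>+h. ?w h * F (c *\<^sub>R h) \<partial>lborel)"
  proof (rule nn_integral_cong)
    fix h :: "real^'n"
    have "ennreal (\<bar>c\<bar> ^ DIM(real^'n)) * ?w (c *\<^sub>R h) = ennreal (\<bar>c\<bar> ^ DIM(real^'n) * (1 / norm (c *\<^sub>R h) ^ CARD('n)))"
      by (rule ennreal_mult[symmetric]) auto
    also have "\<bar>c\<bar> ^ DIM(real^'n) * (1 / norm (c *\<^sub>R h) ^ CARD('n)) = 1 / norm h ^ CARD('n)"
      using c by (simp add: power_mult_distrib)
    finally show "ennreal (\<bar>c\<bar> ^ DIM(real^'n)) * (?w (c *\<^sub>R h) * F (c *\<^sub>R h)) = ?w h * F (c *\<^sub>R h)"
      by (simp add: mult.assoc[symmetric])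
  qed
  also have "\<dots> = (\<integral>\<^sup>+h. F (c *\<^sub>R h) \<partial>dilation_measure)"
    by (rule nn_integral_dilation_measure[symmetric]) measurable
  finally show ?thesis by simp
qed

definition annulus :: "real \<Rightarrow> real \<Rightarrow> (real^'n::finite) set" where
  "annulus a b = {h. a < norm h \<and> norm h \<le> b}"

lemma sets_annulus [measurable, simp]: "annulus a b \<in> sets borel"
  unfolding annulus_def by measurable

lemma emeasure_annulus_finite:
  assumes "0 < a"
  shows "emeasure dilation_measure (annulus a b :: (real^'n::finite) set) < top"
proof -
  have "emeasure dilation_measure (annulus a b :: (real^'n) set)
      = (\<integral>\<^sup>+h. ennreal (1 / norm h ^ CARD('n)) * indicator (annulus a b) h \<partial>(lborel :: (real^'n) measure))"
    unfolding dilation_measure_def by (subst emeasure_density) auto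
  also have "\<dots> \<le> (\<integral>\<^sup>+h. ennreal (1 / a ^ CARD('n)) * indicator (cball 0 b) h \<partial>(lborel :: (real^'n) measure))"
  proof (intro nn_integral_mono)
    fix h :: "real^'n"
    have "1 / norm h ^ CARD('n) \<le> 1 / a ^ CARD('n)" if "a < norm h"
      using that assms by (intro divide_left_mono power_mono mult_pos_pos zero_less_power) auto
    then show "ennreal (1 / norm h ^ CARD('n)) * indicator (annulus a b) h
        \<le> ennreal (1 / a ^ CARD('n)) * indicator (cball 0 b) h"
      by (auto simp: indicator_def annulus_def intro!: ennreal_leI)
  qed
  also have "\<dots> = ennreal (1 / a ^ CARD('n)) * emeasure lborel (cball (0::real^'n) b)"
    by (simp add: nn_integral_cmult_indicator)
  also have "\<dots> < top"
    using emeasure_lborel_cball_finite[of "0::real^'n" b] by (simp add: ennreal_mult_less_top)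
  finally show ?thesis .
qed

text \<open>The self-improving inequality behind every integral in the increment: if \<open>\<Phi> h\<close> is controlled
  by a fraction of its value at the dilated point \<open>c h\<close>, dilation invariance lets the
  left-hand side absorb that fraction.  Truncation to the sets \<open>U k\<close> makes it finite first.\<close>

lemma dilation_absorption:
  fixes \<Phi> \<Psi> :: "real^'n::finite \<Rightarrow> ennreal" and U :: "nat \<Rightarrow> (real^'n) set"
  assumes [measurable]: "\<Phi> \<in> borel_measurable borel" "\<Psi> \<in> borel_measurable borel"
    and U: "\<And>k. U k \<in> sets borel" "incseq U" and S: "S \<in> sets borel"
    and c: "0 < c" and \<theta>: "0 \<le> \<theta>" "\<theta> < 1"
    and move: "\<And>k h. h \<in> U k \<Longrightarrow> c *\<^sub>R h \<in> U k \<union> S"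
    and fin: "\<And>k. (\<integral>\<^sup>+h. \<Phi> h * indicator (U k) h \<partial>dilation_measure) < top"
    and le: "\<And>k h. h \<in> U k \<Longrightarrow> \<Phi> h \<le> ennreal \<theta> * \<Phi> (c *\<^sub>R h) + \<Psi> h"
  shows "ennreal (1 - \<theta>) * (\<integral>\<^sup>+h. \<Phi> h * indicator (\<Union>k. U k) h \<partial>dilation_measure)
    \<le> (\<integral>\<^sup>+h. \<Psi> h * indicator (\<Union>k. U k) h \<partial>dilation_measure) + ennreal \<theta> * (\<integral>\<^sup>+h. \<Phi> h * indicator S h \<partial>dilation_measure)"
proof -
  let ?X = "(\<integral>\<^sup>+h. \<Psi> h * indicator (\<Union>k. U k) h \<partial>dilation_measure) + ennreal \<theta> * (\<integral>\<^sup>+h. \<Phi> h * indicator S h \<partial>dilation_measure)"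
  let ?J = "\<lambda>k. \<integral>\<^sup>+h. \<Phi> h * indicator (U k) h \<partial>dilation_measure"
  have [measurable]: "U k \<in> sets borel" "S \<in> sets borel" "(\<Union>k. U k) \<in> sets borel" for k using U S by auto
  have step: "ennreal (1 - \<theta>) * ?J k \<le> ?X" for k
  proof -
    have "?J k \<le> (\<integral>\<^sup>+h. ennreal \<theta> * (\<Phi> (c *\<^sub>R h) * indicator (U k \<union> S) (c *\<^sub>R h))
        + \<Psi> h * indicator (\<Union>k. U k) h \<partial>dilation_measure)"
    proof (intro nn_integral_mono)
      fix h
      show "\<Phi> h * indicator (U k) h \<le> ennreal \<theta> * (\<Phi> (c *\<^sub>R h) * indicator (U k \<union> S) (c *\<^sub>R h))
          + \<Psi> h * indicator (\<Union>k. U k) h"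
      proof (cases "h \<in> U k")
        case True
        then have "h \<in> (\<Union>k. U k)" by blast
        with True show ?thesis using le[OF True] move[OF True] by (simp only: indicator_simps mult_1_right)
      qed simp
    qed
    also have "\<dots> = ennreal \<theta> * (\<integral>\<^sup>+h. \<Phi> (c *\<^sub>R h) * indicator (U k \<union> S) (c *\<^sub>R h) \<partial>dilation_measure)
        + (\<integral>\<^sup>+h. \<Psi> h * indicator (\<Union>k. U k) h \<partial>dilation_measure)"
      by (subst nn_integral_add) (auto simp: nn_integral_cmult)
    finally have 1: "?J k \<le> ennreal \<theta> * (\<integral>\<^sup>+h. \<Phi> (c *\<^sub>R h) * indicator (U k \<union> S) (c *\<^sub>R h) \<partial>dilation_measure)
        + (\<integral>\<^sup>+h. \<Psi> h * indicator (\<Union>k. U k) h \<partial>dilation_measure)" .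
    have "(\<integral>\<^sup>+h. \<Phi> (c *\<^sub>R h) * indicator (U k \<union> S) (c *\<^sub>R h) \<partial>dilation_measure) = (\<integral>\<^sup>+h. \<Phi> h * indicator (U k \<union> S) h \<partial>dilation_measure)"
      by (rule dilation_measure_scale[where F="\<lambda>h. \<Phi> h * indicator (U k \<union> S) h", OF _ c]) measurable
    also have "\<dots> \<le> (\<integral>\<^sup>+h. \<Phi> h * indicator (U k) h + \<Phi> h * indicator S h \<partial>dilation_measure)"
      by (intro nn_integral_mono) (auto simp: indicator_def)
    also have "\<dots> = ?J k + (\<integral>\<^sup>+h. \<Phi> h * indicator S h \<partial>dilation_measure)"
      by (rule nn_integral_add) measurable
    finally have "?J k \<le> ennreal \<theta> * (?J k + (\<integral>\<^sup>+h. \<Phi> h * indicator S h \<partial>dilation_measure))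
        + (\<integral>\<^sup>+h. \<Psi> h * indicator (\<Union>k. U k) h \<partial>dilation_measure)"
      by (rule order_trans[OF 1 add_right_mono[OF mult_left_mono]]) simp
    then have *: "?J k \<le> ennreal \<theta> * ?J k + ?X"
      by (simp only: distrib_left ac_simps)
    show ?thesis
    proof (cases "?X = top")
      case False
      obtain j where j: "0 \<le> j" "?J k = ennreal j" using fin[of k] by (cases "?J k") auto
      obtain x where x: "0 \<le> x" "?X = ennreal x" using False by (cases "?X") auto
      have "ennreal j \<le> ennreal (\<theta> * j + x)"
        using * unfolding j(2) x(2) using j(1) x(1) \<theta> by (simp add: ennreal_mult)
      then have "j \<le> \<theta> * j + x" using j(1) x(1) \<theta> by (subst (asm) ennreal_le_iff) auto
      then have "ennreal ((1 - \<theta>) * j) \<le> ennreal x" by (intro ennreal_leI) (simp add: algebra_simps)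
      then show ?thesis unfolding j(2) x(2) using j(1) \<theta> by (simp add: ennreal_mult)
    next
      case True
      show ?thesis by (simp only: True top_greatest)
    qed
  qed
  have "(\<integral>\<^sup>+h. \<Phi> h * indicator (\<Union>k. U k) h \<partial>dilation_measure) = (\<integral>\<^sup>+h. (SUP k. \<Phi> h * indicator (U k) h) \<partial>dilation_measure)"
  proof (rule nn_integral_cong)
    fix h
    have "(SUP k. \<Phi> h * indicator (U k) h) = \<Phi> h * (SUP k. indicator (U k) h)"
      by (rule SUP_mult_left_ennreal[symmetric])
    also have "(SUP k. indicator (U k) h) = (indicator (\<Union>k. U k) h :: ennreal)"
      by (rule antisym) (auto intro!: SUP_least simp: indicator_def intro: SUP_upper2)
    finally show "\<Phi> h * indicator (\<Union>k. U k) h = (SUP k. \<Phi> h * indicator (U k) h)" by simp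
  qed
  also have "\<dots> = (SUP k. ?J k)"
    using U(2) by (intro nn_integral_monotone_convergence_SUP)
      (auto simp: incseq_def le_fun_def indicator_def subset_eq)
  finally have "ennreal (1 - \<theta>) * (\<integral>\<^sup>+h. \<Phi> h * indicator (\<Union>k. U k) h \<partial>dilation_measure) = (SUP k. ennreal (1 - \<theta>) * ?J k)"
    by (simp add: SUP_mult_left_ennreal)
  also have "\<dots> \<le> ?X" by (intro SUP_least step)
  finally show ?thesis .
qed

abbreviation near :: "(real^'n::finite) set" where "near \<equiv> annulus 0 1"
abbreviation far :: "(real^'n::finite) set" where "far \<equiv> {h. 1 < norm h}"

lemma near_eq_UN: "(near :: (real^'n::finite) set) = (\<Union>k. annulus (1 / 2 ^ k) 1)"
proof
  show "near \<subseteq> (\<Union>k. annulus (1 / 2 ^ k) 1 :: (real^'n) set)"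
  proof
    fix h :: "real^'n" assume h: "h \<in> near"
    then obtain k where "(1 / 2) ^ k < norm h"
      using real_arch_pow_inv[of "norm h" "1 / 2"] by (auto simp: annulus_def)
    with h show "h \<in> (\<Union>k. annulus (1 / 2 ^ k) 1)"
      by (auto simp: annulus_def power_one_over intro!: exI[of _ k])
  qed
  show "(\<Union>k. annulus (1 / 2 ^ k) 1 :: (real^'n) set) \<subseteq> near"
  proof
    fix h :: "real^'n" assume "h \<in> (\<Union>k. annulus (1 / 2 ^ k) 1)"
    then obtain k where k: "1 / 2 ^ k < norm h" "norm h \<le> 1" by (auto simp: annulus_def)
    have "(0::real) < 1 / 2 ^ k" by simp
    from less_trans[OF this k(1)] have "0 < norm h" .
    with \<open>norm h \<le> 1\<close> show "h \<in> near" by (simp add: annulus_def)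
  qed
qed

lemma far_eq_UN: "(far :: (real^'n::finite) set) = (\<Union>k. annulus 1 (2 ^ k))"
proof -
  have "\<exists>k. norm h \<le> 2 ^ k" for h :: "real^'n"
    using real_arch_pow[of 2 "norm h"] less_imp_le by fastforce
  then show ?thesis by (auto simp: annulus_def)
qed

text \<open>Small increments are doubled, and those that leave the unit ball land in the shell \<open>1 < |h| \<le> 2\<close>.\<close>

lemma absorption_near:
  fixes \<Phi> \<Psi> :: "real^'n::finite \<Rightarrow> ennreal"
  assumes m: "\<Phi> \<in> borel_measurable borel" "\<Psi> \<in> borel_measurable borel"
    and \<theta>: "0 \<le> \<theta>" "\<theta> < 1"
    and bd: "\<And>h. norm h \<le> 2 \<Longrightarrow> \<Phi> h \<le> B" and B: "B < top"
    and le: "\<And>h. h \<in> near \<Longrightarrow> \<Phi> h \<le> ennreal \<theta> * \<Phi> (2 *\<^sub>R h) + \<Psi> h"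
  shows "ennreal (1 - \<theta>) * (\<integral>\<^sup>+h. \<Phi> h * indicator near h \<partial>dilation_measure)
    \<le> (\<integral>\<^sup>+h. \<Psi> h * indicator near h \<partial>dilation_measure) + ennreal \<theta> * (B * emeasure dilation_measure (annulus 1 2 :: (real^'n) set))"
proof -
  have bound: "(\<integral>\<^sup>+h. \<Phi> h * indicator (annulus a b) h \<partial>dilation_measure) \<le> B * emeasure dilation_measure (annulus a b :: (real^'n) set)"
    if "b \<le> 2" for a b
  proof -
    have "(\<integral>\<^sup>+h. \<Phi> h * indicator (annulus a b) h \<partial>dilation_measure) \<le> (\<integral>\<^sup>+h. B * indicator (annulus a b :: (real^'n) set) h \<partial>dilation_measure)"
      using bd that by (intro nn_integral_mono) (auto simp: indicator_def annulus_def)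
    then show ?thesis by (simp add: nn_integral_cmult_indicator)
  qed
  have "ennreal (1 - \<theta>) * (\<integral>\<^sup>+h. \<Phi> h * indicator near h \<partial>dilation_measure)
    \<le> (\<integral>\<^sup>+h. \<Psi> h * indicator near h \<partial>dilation_measure) + ennreal \<theta> * (\<integral>\<^sup>+h. \<Phi> h * indicator (annulus 1 2) h \<partial>dilation_measure)"
    unfolding near_eq_UN
  proof (rule dilation_absorption[where c=2])
    show "incseq (\<lambda>k. annulus (1 / 2 ^ k) 1 :: (real^'n) set)"
    proof (rule incseq_SucI)
      fix k
      have "(1::real) / 2 ^ Suc k \<le> 1 / 2 ^ k" by (simp add: field_simps)
      then show "annulus (1 / 2 ^ k) 1 \<subseteq> (annulus (1 / 2 ^ Suc k) 1 :: (real^'n) set)"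
        unfolding annulus_def by (auto simp del: power_Suc)
    qed
    fix k and h :: "real^'n" assume h: "h \<in> annulus (1 / 2 ^ k) 1"
    then have "1 / 2 ^ k < norm h" "norm h \<le> 1" by (auto simp: annulus_def)
    moreover from this have "1 / 2 ^ k < 2 * norm h" using norm_ge_zero[of h] by linarith
    ultimately show "2 *\<^sub>R h \<in> annulus (1 / 2 ^ k) 1 \<union> annulus 1 2"
      by (cases "2 * norm h \<le> 1") (auto simp: annulus_def)
    show "\<Phi> h \<le> ennreal \<theta> * \<Phi> (2 *\<^sub>R h) + \<Psi> h"
      using h unfolding near_eq_UN[symmetric] by (intro le) (use near_eq_UN in blast)
  next
    fix k
    have "B * emeasure dilation_measure (annulus (1 / 2 ^ k) 1 :: (real^'n) set) < top"
      using B emeasure_annulus_finite[of "1 / 2 ^ k" 1, where 'n='n] by (simp add: ennreal_mult_less_top)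
    with bound[of 1 "1 / 2 ^ k"] show "(\<integral>\<^sup>+h. \<Phi> h * indicator (annulus (1 / 2 ^ k) 1) h \<partial>dilation_measure) < top"
      by (simp add: le_less_trans)
  qed (use m \<theta> in auto)
  also have "\<dots> \<le> (\<integral>\<^sup>+h. \<Psi> h * indicator near h \<partial>dilation_measure) + ennreal \<theta> * (B * emeasure dilation_measure (annulus 1 2 :: (real^'n) set))"
    by (intro add_left_mono mult_left_mono bound) auto
  finally show ?thesis .
qed

text \<open>Both power integrals satisfy the absorption inequality with \<open>\<theta> = 2 powr (- a)\<close> and \<open>\<Psi> = 0\<close>;
  large increments are halved instead of doubled.\<close>

lemma dilation_integral_powr_near:
  assumes a: "0 < a"
  shows "(\<integral>\<^sup>+h. ennreal (norm h powr a) * indicator near h \<partial>(dilation_measure :: (real^'n::finite) measure)) < top"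
proof -
  let ?I = "\<integral>\<^sup>+h. ennreal (norm h powr a) * indicator near h \<partial>(dilation_measure :: (real^'n) measure)"
  define \<theta> where "\<theta> = 2 powr (- a)"
  have \<theta>: "0 \<le> \<theta>" "\<theta> < 1" using a by (auto simp: \<theta>_def intro!: powr_less_one)
  have "ennreal (1 - \<theta>) * ?I
      \<le> (\<integral>\<^sup>+h. 0 * indicator near h \<partial>(dilation_measure :: (real^'n) measure))
        + ennreal \<theta> * (ennreal (2 powr a) * emeasure dilation_measure (annulus 1 2 :: (real^'n) set))"
  proof (rule absorption_near)
    show "ennreal (norm h powr a) \<le> ennreal (2 powr a)" if "norm h \<le> 2" for h :: "real^'n"
      using that a by (intro ennreal_leI powr_mono2) auto
    fix h :: "real^'n"
    have "\<theta> * norm (2 *\<^sub>R h) powr a = norm h powr a"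
      by (simp add: \<theta>_def powr_mult powr_minus field_simps)
    then have "ennreal \<theta> * ennreal (norm (2 *\<^sub>R h) powr a) = ennreal (norm h powr a)"
      using \<theta> by (metis ennreal_mult powr_ge_zero)
    then show "ennreal (norm h powr a) \<le> ennreal \<theta> * ennreal (norm (2 *\<^sub>R h) powr a) + 0"
      by simp
  next
  qed (use \<theta> in \<open>auto\<close>)
  also have "\<dots> < top"
    using emeasure_annulus_finite[of 1 2, where 'n='n] by (simp add: ennreal_mult_less_top)
  finally show ?thesis using \<theta> by (auto simp: ennreal_mult_less_top)
qed

lemma dilation_integral_powr_far:
  assumes a: "0 < a"
  shows "(\<integral>\<^sup>+h. ennreal (norm h powr (- a)) * indicator far h \<partial>(dilation_measure :: (real^'n::finite) measure)) < top"
proof -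
  let ?I = "\<integral>\<^sup>+h. ennreal (norm h powr (- a)) * indicator far h \<partial>(dilation_measure :: (real^'n) measure)"
  define \<theta> where "\<theta> = 2 powr (- a)"
  have \<theta>: "0 \<le> \<theta>" "\<theta> < 1" using a by (auto simp: \<theta>_def intro!: powr_less_one)
  have bound: "(\<integral>\<^sup>+h. ennreal (norm h powr (- a)) * indicator (annulus c b) h \<partial>(dilation_measure :: (real^'n) measure)) < top"
    if "0 < c" for c b
  proof -
    have "(\<integral>\<^sup>+h. ennreal (norm h powr (- a)) * indicator (annulus c b) h \<partial>(dilation_measure :: (real^'n) measure))
       \<le> (\<integral>\<^sup>+h. ennreal (c powr (- a)) * indicator (annulus c b) h \<partial>(dilation_measure :: (real^'n) measure))"
      using that a by (intro nn_integral_mono) (auto simp: indicator_def annulus_def intro!: ennreal_leI powr_mono2')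
    also have "\<dots> = ennreal (c powr (- a)) * emeasure dilation_measure (annulus c b :: (real^'n) set)"
      by (simp add: nn_integral_cmult_indicator)
    also have "\<dots> < top"
      using emeasure_annulus_finite[OF that, of b, where 'n='n] by (simp add: ennreal_mult_less_top)
    finally show ?thesis .
  qed
  have "ennreal (1 - \<theta>) * ?I
      \<le> (\<integral>\<^sup>+h. 0 * indicator (\<Union>k. annulus 1 (2 ^ k)) h \<partial>(dilation_measure :: (real^'n) measure))
        + ennreal \<theta> * (\<integral>\<^sup>+h. ennreal (norm h powr (- a)) * indicator (annulus (1 / 2) 1) h \<partial>(dilation_measure :: (real^'n) measure))"
    unfolding far_eq_UN
  proof (rule dilation_absorption[where c="1 / 2"])
    show "incseq (\<lambda>k. annulus 1 (2 ^ k) :: (real^'n) set)"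
    proof (rule incseq_SucI)
      fix k
      have "(2::real) ^ k \<le> 2 ^ Suc k" by simp
      then show "annulus 1 (2 ^ k) \<subseteq> (annulus 1 (2 ^ Suc k) :: (real^'n) set)"
        unfolding annulus_def by (auto simp del: power_Suc intro: order_trans)
    qed
    fix k and h :: "real^'n" assume h: "h \<in> annulus 1 (2 ^ k)"
    then show "(1 / 2) *\<^sub>R h \<in> annulus 1 (2 ^ k) \<union> annulus (1 / 2) 1"
      by (auto simp: annulus_def)
    have "\<theta> * norm ((1 / 2) *\<^sub>R h) powr (- a) = norm h powr (- a)"
      by (simp add: \<theta>_def powr_divide)
    then have "ennreal \<theta> * ennreal (norm ((1 / 2) *\<^sub>R h) powr (- a)) = ennreal (norm h powr (- a))"
      using \<theta> by (metis ennreal_mult powr_ge_zero)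
    then show "ennreal (norm h powr (- a)) \<le> ennreal \<theta> * ennreal (norm ((1 / 2) *\<^sub>R h) powr (- a)) + 0"
      by simp
  qed (use bound \<theta> in auto)
  also have "\<dots> < top"
    using bound[of "1 / 2" 1] by (simp add: ennreal_mult_less_top)
  finally show ?thesis using \<theta> by (auto simp: ennreal_mult_less_top)
qed

section \<open>Measuring a function of the increment\<close>

text \<open>The outer norm in the Besov seminorm, as a functional of an arbitrary function of the increment.
  Its monotonicity, homogeneity and quasi-additivity cover \<open>q = \<infinity>\<close> and \<open>q < \<infinity>\<close> at once.\<close>

definition inc_norm :: "ennreal \<Rightarrow> (real^'n::finite) set \<Rightarrow> (real^'n \<Rightarrow> ennreal) \<Rightarrow> ennreal" where
  "inc_norm q U F = (if q = \<infinity> then SUP h\<in>U. F h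
     else ennreal_powr (\<integral>\<^sup>+h. ennreal_powr (F h) (enn2real q) * indicator U h \<partial>dilation_measure) (1 / enn2real q))"

lemma enn2real_ge_1: "1 \<le> q \<Longrightarrow> q \<noteq> \<infinity> \<Longrightarrow> 1 \<le> enn2real q"
  by (cases q) auto

lemma inc_norm_mono:
  assumes "1 \<le> q" "\<And>h. h \<in> U \<Longrightarrow> F h \<le> G h"
  shows "inc_norm q U F \<le> inc_norm q U G"
proof (cases "q = \<infinity>")
  case True
  then show ?thesis using assms by (auto simp: inc_norm_def intro!: SUP_mono)
next
  case False
  have "(\<integral>\<^sup>+h. ennreal_powr (F h) (enn2real q) * indicator U h \<partial>dilation_measure)
      \<le> (\<integral>\<^sup>+h. ennreal_powr (G h) (enn2real q) * indicator U h \<partial>dilation_measure)"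
    using assms by (intro nn_integral_mono) (auto simp: indicator_def intro!: ennreal_powr_mono)
  then show ?thesis using False by (auto simp: inc_norm_def intro!: ennreal_powr_mono)
qed

lemma inc_norm_subset:
  assumes "U \<subseteq> V"
  shows "inc_norm q U F \<le> inc_norm q V F"
proof (cases "q = \<infinity>")
  case True
  then show ?thesis using assms by (auto simp: inc_norm_def intro!: SUP_subset_mono)
next
  case False
  have "(\<integral>\<^sup>+h. ennreal_powr (F h) (enn2real q) * indicator U h \<partial>dilation_measure)
      \<le> (\<integral>\<^sup>+h. ennreal_powr (F h) (enn2real q) * indicator V h \<partial>dilation_measure)"
    using assms by (intro nn_integral_mono) (auto simp: indicator_def)
  then show ?thesis using False by (auto simp: inc_norm_def intro!: ennreal_powr_mono)
qed

lemma ennreal_root_add_le: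
  assumes "1 \<le> r"
  shows "ennreal_powr (x + y) (1 / r) \<le> 2 * (ennreal_powr x (1 / r) + ennreal_powr y (1 / r))"
proof -
  have "2 powr (1 / r) \<le> 2 powr 1" using assms by (intro powr_mono) auto
  then have "ennreal (2 powr (1 / r)) \<le> 2" using ennreal_leI by fastforce
  then have "ennreal (2 powr (1 / r)) * (ennreal_powr x (1 / r) + ennreal_powr y (1 / r))
      \<le> 2 * (ennreal_powr x (1 / r) + ennreal_powr y (1 / r))"
    by (intro mult_right_mono) auto
  with ennreal_powr_add_le[of "1 / r" x y] assms show ?thesis by (simp add: order_trans)
qed

lemma inc_norm_add:
  assumes q: "1 \<le> q" and U [measurable]: "U \<in> sets borel"
    and [measurable]: "F \<in> borel_measurable borel" "G \<in> borel_measurable borel"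
  shows "inc_norm q U (\<lambda>h. F h + G h) \<le> 4 * (inc_norm q U F + inc_norm q U G)"
proof (cases "q = \<infinity>")
  case True
  have "(SUP h\<in>U. F h + G h) \<le> (SUP h\<in>U. F h) + (SUP h\<in>U. G h)"
    by (intro SUP_least add_mono SUP_upper)
  also have "\<dots> \<le> 4 * ((SUP h\<in>U. F h) + (SUP h\<in>U. G h))"
    using mult_right_mono[of 1 4 "(SUP h\<in>U. F h) + (SUP h\<in>U. G h) :: ennreal"] by simp
  finally show ?thesis using True by (simp add: inc_norm_def)
next
  case False
  define r where "r = enn2real q"
  have r: "1 \<le> r" using enn2real_ge_1[OF q False] by (simp add: r_def)
  let ?I = "\<lambda>F. \<integral>\<^sup>+h. ennreal_powr (F h) r * indicator U h \<partial>dilation_measure"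
  have "?I (\<lambda>h. F h + G h) \<le> (\<integral>\<^sup>+h. ennreal (2 powr r) * (ennreal_powr (F h) r * indicator U h
        + ennreal_powr (G h) r * indicator U h) \<partial>dilation_measure)"
    using ennreal_powr_add_le[of r "F _" "G _"] r by (intro nn_integral_mono) (auto simp: indicator_def)
  also have "\<dots> = ennreal (2 powr r) * (?I F + ?I G)"
    by (subst nn_integral_cmult, measurable, subst nn_integral_add) measurable
  finally have "ennreal_powr (?I (\<lambda>h. F h + G h)) (1 / r) \<le> ennreal_powr (ennreal (2 powr r) * (?I F + ?I G)) (1 / r)"
    using r by (intro ennreal_powr_mono) auto
  also have "\<dots> = 2 * ennreal_powr (?I F + ?I G) (1 / r)"
    using r by (simp add: ennreal_powr_mult ennreal_powr_ennreal powr_powr)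
  also have "\<dots> \<le> 2 * (2 * (ennreal_powr (?I F) (1 / r) + ennreal_powr (?I G) (1 / r)))"
    by (intro mult_left_mono ennreal_root_add_le r) auto
  finally show ?thesis using False by (simp add: inc_norm_def r_def mult.assoc[symmetric])
qed

lemma inc_norm_cmult:
  assumes q: "1 \<le> q" and U [measurable]: "U \<in> sets borel"
    and [measurable]: "F \<in> borel_measurable borel"
  shows "inc_norm q U (\<lambda>h. c * F h) = c * inc_norm q U F"
proof (cases "q = \<infinity>")
  case True
  then show ?thesis by (simp add: inc_norm_def SUP_mult_left_ennreal)
next
  case False
  have r: "1 \<le> enn2real q" using enn2real_ge_1[OF q False] .
  have "(\<integral>\<^sup>+h. ennreal_powr (c * F h) (enn2real q) * indicator U h \<partial>dilation_measure)
      = ennreal_powr c (enn2real q) * (\<integral>\<^sup>+h. ennreal_powr (F h) (enn2real q) * indicator U h \<partial>dilation_measure)"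
    unfolding ennreal_powr_mult mult.assoc by (rule nn_integral_cmult) measurable
  then show ?thesis
    using False r by (simp add: inc_norm_def ennreal_powr_mult ennreal_powr_powr)
qed

lemma inc_norm_Un:
  assumes q: "1 \<le> q" and [measurable]: "U \<in> sets borel" "V \<in> sets borel" "F \<in> borel_measurable borel"
  shows "inc_norm q (U \<union> V) F \<le> 2 * (inc_norm q U F + inc_norm q V F)"
proof (cases "q = \<infinity>")
  case True
  have "(SUP h\<in>U\<union>V. F h) \<le> (SUP h\<in>U. F h) + (SUP h\<in>V. F h)"
    by (auto simp: SUP_union intro: add_increasing2 add_increasing)
  also have "\<dots> \<le> 2 * ((SUP h\<in>U. F h) + (SUP h\<in>V. F h))"
    using mult_right_mono[of 1 2 "(SUP h\<in>U. F h) + (SUP h\<in>V. F h) :: ennreal"] by simp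
  finally show ?thesis using True by (simp add: inc_norm_def)
next
  case False
  define r where "r = enn2real q"
  have r: "1 \<le> r" using enn2real_ge_1[OF q False] by (simp add: r_def)
  let ?I = "\<lambda>U. \<integral>\<^sup>+h. ennreal_powr (F h) r * indicator U h \<partial>dilation_measure"
  have "?I (U \<union> V) \<le> (\<integral>\<^sup>+h. ennreal_powr (F h) r * indicator U h + ennreal_powr (F h) r * indicator V h \<partial>dilation_measure)"
    by (intro nn_integral_mono) (auto simp: indicator_def)
  also have "\<dots> = ?I U + ?I V" by (rule nn_integral_add) measurable
  finally have "ennreal_powr (?I (U \<union> V)) (1 / r) \<le> ennreal_powr (?I U + ?I V) (1 / r)"
    using r by (intro ennreal_powr_mono) auto
  also have "\<dots> \<le> 2 * (ennreal_powr (?I U) (1 / r) + ennreal_powr (?I V) (1 / r))"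
    by (rule ennreal_root_add_le[OF r])
  finally show ?thesis using False by (simp add: inc_norm_def r_def)
qed

lemma inc_norm_0: "inc_norm q U (\<lambda>h. 0) = 0"
proof -
  have "(SUP h\<in>U. 0::ennreal) = 0" using SUP_bot[of U, where 'a=ennreal] by (simp add: bot_ennreal)
  then show ?thesis by (simp add: inc_norm_def)
qed

lemma inc_norm_powr_near:
  assumes q: "1 \<le> q" and a: "0 < a"
  shows "inc_norm q near (\<lambda>h::real^'n::finite. ennreal (norm h powr a)) < top"
proof (cases "q = \<infinity>")
  case True
  have "(SUP h\<in>near. ennreal (norm (h::real^'n) powr a)) \<le> 1"
    using a by (intro SUP_least) (auto simp: annulus_def powr_le1)
  then have "(SUP h\<in>near. ennreal (norm (h::real^'n) powr a)) < top" by (rule le_less_trans) simp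
  then show ?thesis using True by (simp add: inc_norm_def)
next
  case False
  have r: "1 \<le> enn2real q" using enn2real_ge_1[OF q False] .
  then show ?thesis
    using dilation_integral_powr_near[of "a * enn2real q", where 'n='n] a False
    by (simp add: inc_norm_def ennreal_powr_ennreal powr_powr)
qed

lemma inc_norm_powr_far:
  assumes q: "1 \<le> q" and a: "0 < a"
  shows "inc_norm q far (\<lambda>h::real^'n::finite. ennreal (norm h powr (- a))) < top"
proof (cases "q = \<infinity>")
  case True
  have "norm h powr (- a) \<le> 1" if "1 < norm h" for h :: "real^'n"
    using powr_mono2'[of "- a" 1 "norm h"] that a by simp
  then have "(SUP h\<in>far. ennreal (norm (h::real^'n) powr (- a))) \<le> 1"
    by (intro SUP_least) auto
  then have "(SUP h\<in>far. ennreal (norm (h::real^'n) powr (- a))) < top" by (rule le_less_trans) simp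
  then show ?thesis using True by (simp add: inc_norm_def)
next
  case False
  have r: "1 \<le> enn2real q" using enn2real_ge_1[OF q False] .
  then show ?thesis
    using dilation_integral_powr_far[of "a * enn2real q", where 'n='n] a False
    by (simp add: inc_norm_def ennreal_powr_ennreal powr_powr)
qed

section \<open>The modulus of smoothness\<close>

lemma measurable_Lp_norm_diff:
  fixes w :: "real^'n::finite \<Rightarrow> complex"
  assumes w [measurable]: "w \<in> borel_measurable borel" and \<Omega> [measurable]: "\<Omega> \<in> sets borel"
  shows "(\<lambda>h. Lp_norm \<Omega> p (diff1 h w)) \<in> borel_measurable borel"
    "(\<lambda>h. Lp_norm \<Omega> p (diff2 h w)) \<in> borel_measurable borel"
proof -
  have ind [measurable]: "(\<lambda>z::(real^'n) \<times> (real^'n). indicator \<Omega> (snd z) :: ennreal) \<in> borel_measurable (borel \<Otimes>\<^sub>M lborel)"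
    by (rule measurable_compose[OF measurable_snd]) simp
  have 1: "(\<lambda>z::(real^'n) \<times> (real^'n). ennreal (norm (diff1 (fst z) w (snd z)) powr p) * indicator \<Omega> (snd z))
      \<in> borel_measurable (borel \<Otimes>\<^sub>M lborel)"
    unfolding diff1_def by measurable
  have 2: "(\<lambda>z::(real^'n) \<times> (real^'n). ennreal (norm (diff2 (fst z) w (snd z)) powr p) * indicator \<Omega> (snd z))
      \<in> borel_measurable (borel \<Otimes>\<^sub>M lborel)"
    unfolding diff1_def diff2_def by measurable
  show "(\<lambda>h. Lp_norm \<Omega> p (diff1 h w)) \<in> borel_measurable borel"
    unfolding Lp_norm_lborel
    using lborel.borel_measurable_nn_integral[of "\<lambda>h x. ennreal (norm (diff1 h w x) powr p) * indicator \<Omega> x" borel] 1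
    by (intro measurable_ennreal_powr) (simp add: case_prod_unfold)
  show "(\<lambda>h. Lp_norm \<Omega> p (diff2 h w)) \<in> borel_measurable borel"
    unfolding Lp_norm_lborel
    using lborel.borel_measurable_nn_integral[of "\<lambda>h x. ennreal (norm (diff2 h w x) powr p) * indicator \<Omega> x" borel] 2
    by (intro measurable_ennreal_powr) (simp add: case_prod_unfold)
qed

lemma Lp_norm_diff1_le:
  assumes p: "1 \<le> p" and w [measurable]: "w \<in> borel_measurable borel" and per: "periodic_2pi w"
  shows "Lp_norm cell p (diff1 h w) \<le> 2 * Lp_norm cell p w"
proof -
  have "Lp_norm cell p (\<lambda>x. w (x + h) + (-1) * w x)
      \<le> Lp_norm cell p (\<lambda>x. w (x + h)) + Lp_norm cell p (\<lambda>x. (-1) * w x)"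
    by (intro Lp_norm_triangle p sets_cell) measurable
  also have "\<dots> = Lp_norm cell p w + ennreal (norm (-1::complex)) * Lp_norm cell p w"
    using p per by (subst Lp_norm_cmult) (auto simp: Lp_norm_translate sets_cell)
  finally show ?thesis by (simp add: diff1_def mult_2)
qed

text \<open>This is the identity \<open>2 \<Delta>\<^sub>h = \<Delta>\<^sub>2\<^sub>h - \<Delta>\<^sub>h\<^sup>2\<close>.\<close>

lemma diff1_le_half:
  assumes p: "1 \<le> p" and w [measurable]: "w \<in> borel_measurable borel"
  shows "Lp_norm cell p (diff1 h w) \<le> (Lp_norm cell p (diff1 (2 *\<^sub>R h) w) + Lp_norm cell p (diff2 h w)) / 2"
proof -
  have m: "diff1 h w \<in> borel_measurable borel" "diff1 (2 *\<^sub>R h) w \<in> borel_measurable borel"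
    "diff2 h w \<in> borel_measurable borel"
    unfolding diff2_def by measurable
  have "ennreal (norm (2::complex)) * Lp_norm cell p (diff1 h w) = Lp_norm cell p (\<lambda>x. 2 * diff1 h w x)"
    using p m by (subst Lp_norm_cmult) (auto simp: sets_cell)
  also have "(\<lambda>x. 2 * diff1 h w x) = (\<lambda>x. diff1 (2 *\<^sub>R h) w x + (-1) * diff2 h w x)"
    by (auto simp: diff2_def diff1_def scaleR_2 add.assoc)
  also have "Lp_norm cell p \<dots> \<le> Lp_norm cell p (diff1 (2 *\<^sub>R h) w) + Lp_norm cell p (\<lambda>x. (-1) * diff2 h w x)"
    using m by (intro Lp_norm_triangle p sets_cell) auto
  also have "Lp_norm cell p (\<lambda>x. (-1) * diff2 h w x) = Lp_norm cell p (diff2 h w)"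
    using p m by (subst Lp_norm_cmult) (auto simp: sets_cell)
  finally have "2 * Lp_norm cell p (diff1 h w) \<le> Lp_norm cell p (diff1 (2 *\<^sub>R h) w) + Lp_norm cell p (diff2 h w)"
    by simp
  from divide_right_mono_ennreal[OF this, of 2] show ?thesis
    by (simp add: ennreal_mult_divide_eq mult.commute[of 2])
qed

text \<open>The Besov seminorm of a periodic function, restricted to increments \<open>|h| \<le> 1\<close>.\<close>

definition smoothness :: "ennreal \<Rightarrow> real \<Rightarrow> real \<Rightarrow> (real^'n::finite \<Rightarrow> complex) \<Rightarrow> ennreal" where
  "smoothness q \<sigma> p w = inc_norm q near (\<lambda>h. ennreal (norm h powr (- \<sigma>)) * Lp_norm cell p (diff2 h w))"

abbreviation cell_norm :: "ennreal \<Rightarrow> real \<Rightarrow> real \<Rightarrow> (real^'n::finite \<Rightarrow> complex) \<Rightarrow> ennreal" where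
  "cell_norm q \<sigma> p w \<equiv> Lp_norm cell p w + smoothness q \<sigma> p w"

text \<open>Marchaud's inequality in the limiting form: \<open>2 \<Delta>\<^sub>h = \<Delta>\<^sub>2\<^sub>h - \<Delta>\<^sub>h\<^sup>2\<close> bounds the first
  difference by one half of itself at the dilated increment plus one half of the second difference.  The
  factor one half is what is absorbed, so the bound survives for \<open>\<sigma> = 1\<close>, where the weight
  gives nothing.\<close>

theorem marchaud:
  assumes q: "1 \<le> q" and p: "1 \<le> p" and \<sigma>: "0 < \<sigma>" "\<sigma> \<le> 1"
  shows "\<exists>C::real. 0 \<le> C \<and> (\<forall>w::real^'n::finite \<Rightarrow> complex. w \<in> borel_measurable borel \<longrightarrow> periodic_2pi w \<longrightarrow>
    inc_norm q near (\<lambda>h. ennreal (norm h powr (1 - \<sigma>)) * Lp_norm cell p (diff1 h w))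
      \<le> ennreal C * (cell_norm q \<sigma> p w))"
proof (cases "q = \<infinity>")
  case True
  show ?thesis
  proof (intro exI[of _ 2] conjI allI impI)
    fix w :: "real^'n \<Rightarrow> complex" assume w: "w \<in> borel_measurable borel" "periodic_2pi w"
    have "ennreal (norm h powr (1 - \<sigma>)) * Lp_norm cell p (diff1 h w) \<le> 1 * (2 * Lp_norm cell p w)"
      if "h \<in> near" for h
      using that \<sigma> by (intro mult_mono Lp_norm_diff1_le p w) (auto simp: annulus_def powr_le1)
    then have "inc_norm q near (\<lambda>h. ennreal (norm h powr (1 - \<sigma>)) * Lp_norm cell p (diff1 h w)) \<le> 2 * Lp_norm cell p w"
      using True by (auto simp: inc_norm_def intro!: SUP_least)
    also have "\<dots> \<le> ennreal 2 * (cell_norm q \<sigma> p w)"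
      by (auto intro!: mult_left_mono)
    finally show "inc_norm q near (\<lambda>h. ennreal (norm h powr (1 - \<sigma>)) * Lp_norm cell p (diff1 h w))
        \<le> ennreal 2 * (cell_norm q \<sigma> p w)" .
  qed simp
next
  case False
  define r where "r = enn2real q"
  have r: "1 \<le> r" using enn2real_ge_1[OF q False] by (simp add: r_def)
  (* The part of the integral that dilation pushes out of the unit ball lives on this shell. *)
  define \<mu> where "\<mu> = ennreal_powr (emeasure dilation_measure (annulus 1 2 :: (real^'n) set)) (1 / r)"
  have \<mu>: "\<mu> < top" using emeasure_annulus_finite[of 1 2, where 'n='n] by (simp add: \<mu>_def)
  then obtain m where m: "0 \<le> m" "\<mu> = ennreal m" by (cases \<mu>) auto
  show ?thesis
  proof (intro exI[of _ "2 + 8 * m"] conjI allI impI)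
    fix w :: "real^'n \<Rightarrow> complex" assume w [measurable]: "w \<in> borel_measurable borel" and per: "periodic_2pi w"
    let ?a = "\<lambda>h. Lp_norm cell p (diff1 h w)" and ?b = "\<lambda>h. Lp_norm cell p (diff2 h w)"
    let ?A = "\<lambda>h. ennreal (norm h powr (1 - \<sigma>)) * ?a h" and ?S = "\<lambda>h. ennreal (norm h powr (- \<sigma>)) * ?b h"
    have am [measurable]: "?a \<in> borel_measurable borel" "?b \<in> borel_measurable borel"
      by (rule measurable_Lp_norm_diff[OF w sets_cell])+
    show "inc_norm q near ?A \<le> ennreal (2 + 8 * m) * (cell_norm q \<sigma> p w)"
    proof (cases "Lp_norm cell p w = top")
      case True
      then show ?thesis using m by (simp add: ennreal_mult_top)
    next
      case finite: False
      let ?B = "ennreal_powr (4 * Lp_norm cell p w) r"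
      have half: "?A h \<le> (?A (2 *\<^sub>R h) + ?S h) / 2" if h: "h \<in> near" for h
      proof -
        have n: "0 < norm h" "norm h \<le> 1" using h by (auto simp: annulus_def)
        have 1: "norm h powr (1 - \<sigma>) \<le> norm (2 *\<^sub>R h) powr (1 - \<sigma>)"
          using \<sigma> by (intro powr_mono2) auto
        have 2: "norm h powr (1 - \<sigma>) \<le> norm h powr (- \<sigma>)"
          using n by (intro powr_mono') auto
        have "?A h \<le> ennreal (norm h powr (1 - \<sigma>)) * ((?a (2 *\<^sub>R h) + ?b h) / 2)"
          by (intro mult_left_mono diff1_le_half p w) auto
        also have "\<dots> = (ennreal (norm h powr (1 - \<sigma>)) * ?a (2 *\<^sub>R h) + ennreal (norm h powr (1 - \<sigma>)) * ?b h) / 2"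
          by (simp add: ennreal_times_divide distrib_left)
        also have "\<dots> \<le> (?A (2 *\<^sub>R h) + ?S h) / 2"
          using 1 2 by (intro divide_right_mono_ennreal add_mono mult_right_mono ennreal_leI) auto
        finally show ?thesis .
      qed
      have "ennreal (1 - 1/2) * (\<integral>\<^sup>+h. ennreal_powr (?A h) r * indicator near h \<partial>dilation_measure)
        \<le> (\<integral>\<^sup>+h. (ennreal (1/2) * ennreal_powr (?S h) r) * indicator near h \<partial>dilation_measure)
           + ennreal (1/2) * (?B * emeasure dilation_measure (annulus 1 2 :: (real^'n) set))"
      proof (rule absorption_near)
        fix h :: "real^'n" assume "norm h \<le> 2"
        then have "norm h powr (1 - \<sigma>) \<le> 2 powr (1 - \<sigma>)" using \<sigma> by (intro powr_mono2) auto
        also have "\<dots> \<le> 2 powr 1" using \<sigma> by (intro powr_mono) auto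
        finally have "?A h \<le> ennreal 2 * (2 * Lp_norm cell p w)"
          by (intro mult_mono ennreal_leI Lp_norm_diff1_le p w per) auto
        then show "ennreal_powr (?A h) r \<le> ?B"
          using r by (intro ennreal_powr_mono) (auto simp: mult.assoc[symmetric])
      next
        fix h :: "real^'n" assume h: "h \<in> near"
        have "ennreal_powr (?A h) r \<le> ennreal_powr ((?A (2 *\<^sub>R h) + ?S h) / 2) r"
          using half[OF h] r by (intro ennreal_powr_mono) auto
        also have "\<dots> \<le> (ennreal_powr (?A (2 *\<^sub>R h)) r + ennreal_powr (?S h) r) / 2"
          by (rule ennreal_powr_convex_half[OF r])
        also have "\<dots> = ennreal (1/2) * ennreal_powr (?A (2 *\<^sub>R h)) r + ennreal (1/2) * ennreal_powr (?S h) r"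
          unfolding ennreal_half by (rule distrib_left)
        finally show "ennreal_powr (?A h) r
            \<le> ennreal (1/2) * ennreal_powr (?A (2 *\<^sub>R h)) r + ennreal (1/2) * ennreal_powr (?S h) r" .
      next
        show "?B < top" using finite by (simp add: ennreal_mult_less_top less_top)
      qed (auto, measurable)
      also have "(\<integral>\<^sup>+h. (ennreal (1/2) * ennreal_powr (?S h) r) * indicator near h \<partial>dilation_measure)
          = ennreal (1/2) * (\<integral>\<^sup>+h. ennreal_powr (?S h) r * indicator near h \<partial>dilation_measure)"
        unfolding mult.assoc by (rule nn_integral_cmult) measurable
      finally have "ennreal (1/2) * (\<integral>\<^sup>+h. ennreal_powr (?A h) r * indicator near h \<partial>dilation_measure)
        \<le> ennreal (1/2) * ((\<integral>\<^sup>+h. ennreal_powr (?S h) r * indicator near h \<partial>dilation_measure)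
           + ?B * emeasure dilation_measure (annulus 1 2 :: (real^'n) set))"
        by (simp add: distrib_left)
      then have "ennreal 2 * (ennreal (1/2) * (\<integral>\<^sup>+h. ennreal_powr (?A h) r * indicator near h \<partial>dilation_measure))
        \<le> ennreal 2 * (ennreal (1/2) * ((\<integral>\<^sup>+h. ennreal_powr (?S h) r * indicator near h \<partial>dilation_measure)
           + ?B * emeasure dilation_measure (annulus 1 2 :: (real^'n) set)))"
        by (rule mult_left_mono) simp
      then have "(\<integral>\<^sup>+h. ennreal_powr (?A h) r * indicator near h \<partial>dilation_measure)
        \<le> (\<integral>\<^sup>+h. ennreal_powr (?S h) r * indicator near h \<partial>dilation_measure) + ?B * emeasure dilation_measure (annulus 1 2 :: (real^'n) set)"
        unfolding ennreal_double_half .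
      then have "inc_norm q near ?A
        \<le> ennreal_powr ((\<integral>\<^sup>+h. ennreal_powr (?S h) r * indicator near h \<partial>dilation_measure)
             + ?B * emeasure dilation_measure (annulus 1 2 :: (real^'n) set)) (1 / r)"
        using False r unfolding inc_norm_def r_def[symmetric] by (simp add: ennreal_powr_mono)
      also have "\<dots> \<le> 2 * (smoothness q \<sigma> p w + 4 * Lp_norm cell p w * \<mu>)"
      proof -
        have "r * (1 / r) = 1" using r by simp
        then have "ennreal_powr (?B * emeasure dilation_measure (annulus 1 2 :: (real^'n) set)) (1 / r) = 4 * Lp_norm cell p w * \<mu>"
          unfolding ennreal_powr_mult[of ?B] ennreal_powr_powr \<mu>_def by simp
        moreover have "smoothness q \<sigma> p w = ennreal_powr (\<integral>\<^sup>+h. ennreal_powr (?S h) r * indicator near h \<partial>dilation_measure) (1 / r)"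
          using False by (simp add: smoothness_def inc_norm_def r_def)
        ultimately show ?thesis
          using ennreal_root_add_le[OF r, of "\<integral>\<^sup>+h. ennreal_powr (?S h) r * indicator near h \<partial>dilation_measure"
              "?B * emeasure dilation_measure (annulus 1 2 :: (real^'n) set)"] by simp
      qed
      also have "\<dots> \<le> ennreal (2 + 8 * m) * (cell_norm q \<sigma> p w)"
      proof -
        have "2 * (smoothness q \<sigma> p w + 4 * Lp_norm cell p w * \<mu>)
            = ennreal 2 * smoothness q \<sigma> p w + ennreal (8 * m) * Lp_norm cell p w"
          using m by (simp add: distrib_left ennreal_mult mult_ac)
        also have "\<dots> \<le> ennreal (2 + 8 * m) * smoothness q \<sigma> p w + ennreal (2 + 8 * m) * Lp_norm cell p w"
          using m by (intro add_mono mult_right_mono ennreal_leI) auto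
        finally show ?thesis by (simp add: distrib_left add.commute)
      qed
      finally show ?thesis .
    qed
  qed (use m in simp)
qed

section \<open>Multiplication by a test function\<close>

text \<open>The mean value inequality; applied to \<open>r\<close> it gives \<open>\<Delta>\<^sub>h r = O(|h|)\<close>, and applied to \<open>\<Delta>\<^sub>h r\<close>, whose
  partial derivatives are themselves \<open>O(|h|)\<close>, it gives \<open>\<Delta>\<^sub>h\<^sup>2 r = O(|h|\<^sup>2)\<close>.\<close>

lemma diff1_le_gradient_bound:
  fixes u :: "real^'n::finite \<Rightarrow> complex"
  assumes u: "C_infinity u" and M: "\<And>i x. norm (partial i u x) \<le> M"
  shows "norm (diff1 h u x) \<le> real CARD('n) * M * norm h"
proof -
  let ?g = "\<lambda>t. \<Sum>i\<in>UNIV. (h $ i) *\<^sub>R partial i u (x + t *\<^sub>R h)"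
  have bd: "norm (?g t) \<le> real CARD('n) * M * norm h" for t
  proof -
    have "norm (?g t) \<le> (\<Sum>i\<in>(UNIV::'n set). norm h * M)"
      by (rule sum_norm_le) (auto intro!: mult_mono M component_le_norm_cart)
    then show ?thesis by (simp add: mult_ac)
  qed
  have "norm (u (x + 1 *\<^sub>R h) - u (x + 0 *\<^sub>R h)) \<le> (real CARD('n) * M * norm h) * norm (1 - 0 :: real)"
  proof (rule differentiable_bound[of "{0..1}" "\<lambda>t. u (x + t *\<^sub>R h)" "\<lambda>t s. s *\<^sub>R ?g t"])
    show "((\<lambda>t. u (x + t *\<^sub>R h)) has_derivative (\<lambda>s. s *\<^sub>R ?g t)) (at t within {0..1})" for t
      using C_infinity_along_line[OF u, of x h t "{0..1}"] by (simp add: has_vector_derivative_def)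
    show "onorm (\<lambda>s. s *\<^sub>R ?g t) \<le> real CARD('n) * M * norm h" for t
    proof (rule onorm_le)
      fix s :: real
      show "norm (s *\<^sub>R ?g t) \<le> real CARD('n) * M * norm h * norm s"
        using mult_left_mono[OF bd[of t], of "\<bar>s\<bar>"] by (simp add: mult.commute)
    qed
  qed auto
  then show ?thesis by (simp add: diff1_def)
qed

lemma test_function_diff1_le:
  fixes r :: "real^'n::finite \<Rightarrow> complex"
  assumes r: "r \<in> Cc_infinity"
  shows "\<exists>L\<ge>0. \<forall>h x. norm (diff1 h r x) \<le> L * norm h"
proof -
  have "\<exists>M\<ge>0. \<forall>x. norm (partial i r x) \<le> M" for i
    by (rule Cc_infinity_bounded[OF Cc_infinity_partial[OF r]])
  then obtain M where M: "\<And>i. 0 \<le> M i" "\<And>i x. norm (partial i r x) \<le> M i" by metis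
  have "norm (partial i r x) \<le> sum M UNIV" for i x
    using M(2)[of i x] member_le_sum[of i UNIV M] M(1) by (simp add: order_trans)
  from diff1_le_gradient_bound[OF Cc_infinityD[OF r] this] show ?thesis
    using M(1) by (intro exI[of _ "real CARD('n) * sum M UNIV"]) (auto intro!: sum_nonneg mult_nonneg_nonneg)
qed

lemma test_function_diff2_le:
  fixes r :: "real^'n::finite \<Rightarrow> complex"
  assumes r: "r \<in> Cc_infinity"
  shows "\<exists>L\<ge>0. \<forall>h x. norm (diff2 h r x) \<le> L * (norm h)\<^sup>2"
proof -
  note C = Cc_infinityD[OF r]
  have "\<exists>M\<ge>0. \<forall>h x. norm (diff1 h (partial i r) x) \<le> M * norm h" for i
    by (rule test_function_diff1_le[OF Cc_infinity_partial[OF r]])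
  then obtain M where M: "\<And>i. 0 \<le> M i" "\<And>i h x. norm (diff1 h (partial i r) x) \<le> M i * norm h" by metis
  have "norm (partial i (diff1 h r) x) \<le> sum M UNIV * norm h" for i h x
  proof -
    have "M i * norm h \<le> sum M UNIV * norm h"
      using M(1) by (intro mult_right_mono member_le_sum) auto
    then show ?thesis using M(2)[of h i x] by (simp add: partial_diff1[OF C])
  qed
  from diff1_le_gradient_bound[OF C_infinity_diff1[OF C] this]
  have "norm (diff2 h r x) \<le> (real CARD('n) * sum M UNIV) * (norm h)\<^sup>2" for h x
    by (simp add: diff2_def power2_eq_square mult_ac)
  then show ?thesis
    using M(1) by (intro exI[of _ "real CARD('n) * sum M UNIV"]) (auto intro!: sum_nonneg mult_nonneg_nonneg)
qed

text \<open>Arranged so that a lower-order difference of \<open>w\<close> is always accompanied by a difference of \<open>r\<close> that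
  makes up for it in powers of \<open>|h|\<close>.\<close>

lemma diff2_product:
  "diff2 h (\<lambda>x. r x * w x) x
    = (r x * diff2 h w x + (2 * diff1 h r x) * diff1 h w (x + h)) + diff2 h r x * w (x + (h + h))"
  by (simp add: diff2_def diff1_def algebra_simps)

lemma product_diff2_pointwise:
  fixes r :: "real^'n::finite \<Rightarrow> complex"
  assumes p: "1 \<le> p" and r: "r \<in> Cc_infinity"
  shows "\<exists>K::real. 0 \<le> K \<and> (\<forall>w h. w \<in> borel_measurable borel \<longrightarrow> periodic_2pi w \<longrightarrow> norm h \<le> 1 \<longrightarrow>
    Lp_norm UNIV p (diff2 h (\<lambda>x. r x * w x))
      \<le> ennreal K * (Lp_norm cell p (diff2 h w) + ennreal (norm h) * Lp_norm cell p (diff1 h w)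
          + ennreal ((norm h)\<^sup>2) * Lp_norm cell p w))"
proof -
  have rm [measurable]: "r \<in> borel_measurable borel" by (rule C_infinity_measurable[OF Cc_infinityD[OF r]])
  obtain R where R: "\<And>x. R < norm x \<Longrightarrow> r x = 0" using r by (auto simp: Cc_infinity_iff)
  obtain M where M: "0 \<le> M" "\<And>x. norm (r x) \<le> M" using Cc_infinity_bounded[OF r] by blast
  obtain L1 where L1: "0 \<le> L1" "\<And>h x. norm (diff1 h r x) \<le> L1 * norm h"
    using test_function_diff1_le[OF r] by blast
  obtain L2 where L2: "0 \<le> L2" "\<And>h x. norm (diff2 h r x) \<le> L2 * (norm h)\<^sup>2"
    using test_function_diff2_le[OF r] by blast
  obtain C where C: "0 \<le> C" "\<And>(w::real^'n \<Rightarrow> complex) b M. w \<in> borel_measurable borel \<Longrightarrow> periodic_2pi w \<Longrightarrow>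
     0 \<le> M \<Longrightarrow> (\<And>x. norm (b x) \<le> M) \<Longrightarrow> (\<And>x. R + 2 < norm x \<Longrightarrow> b x = 0) \<Longrightarrow>
     Lp_norm UNIV p (\<lambda>x. b x * w x) \<le> ennreal (C * M) * Lp_norm cell p w"
    using Lp_norm_local[OF p, of "R + 2", where 'n='n] by blast
  define K where "K = C * M + C * (2 * L1) + C * L2"
  have K: "0 \<le> C * M" "0 \<le> C * (2 * L1)" "0 \<le> C * L2" using C M L1 L2 by auto
  show ?thesis
  proof (intro exI[of _ K] conjI allI impI)
    show "0 \<le> K" using K by (simp add: K_def)
    fix w :: "real^'n \<Rightarrow> complex" and h :: "real^'n"
    assume w [measurable]: "w \<in> borel_measurable borel" and per: "periodic_2pi w" and h: "norm h \<le> 1"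
    have dm [measurable]: "diff1 h w \<in> borel_measurable borel" "diff2 h w \<in> borel_measurable borel"
      "diff1 h r \<in> borel_measurable borel" "diff2 h r \<in> borel_measurable borel"
      unfolding diff2_def by measurable
    have far: "R < norm (x + h)" "R < norm (x + h + h)" "R < norm x" if "R + 2 < norm x" for x
    proof -
      have "norm x \<le> norm (x + h) + norm h" "norm (x + h) \<le> norm (x + h + h) + norm h"
        using norm_triangle_ineq4[of "x + h" h] norm_triangle_ineq4[of "x + h + h" h]
        by (simp_all only: add_diff_cancel)
      then show "R < norm (x + h)" "R < norm (x + h + h)" "R < norm x"
        using that h by linarith+
    qed
    have per1: "periodic_2pi (diff1 h w)" "periodic_2pi (diff2 h w)"
      using per by (auto simp: diff2_def intro: periodic_diff1)
    have 1: "Lp_norm UNIV p (\<lambda>x. r x * diff2 h w x) \<le> ennreal (C * M) * Lp_norm cell p (diff2 h w)"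
      using far R M by (intro C(2) dm per1) auto
    have 2: "Lp_norm UNIV p (\<lambda>x. (2 * diff1 h r x) * diff1 h w (x + h))
        \<le> ennreal (C * (2 * L1 * norm h)) * Lp_norm cell p (\<lambda>x. diff1 h w (x + h))"
    proof (rule C(2))
      show "(\<lambda>x. diff1 h w (x + h)) \<in> borel_measurable borel" by measurable
      show "norm (2 * diff1 h r x) \<le> 2 * L1 * norm h" for x
        using L1(2)[of h x] by (simp add: norm_mult)
      show "2 * diff1 h r x = 0" if "R + 2 < norm x" for x
        using far[OF that] R by (simp add: diff1_def)
    qed (use L1 per1 in \<open>auto intro: periodic_translate\<close>)
    have 3: "Lp_norm UNIV p (\<lambda>x. diff2 h r x * w (x + (h + h)))
        \<le> ennreal (C * (L2 * (norm h)\<^sup>2)) * Lp_norm cell p (\<lambda>x. w (x + (h + h)))"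
    proof (rule C(2))
      show "(\<lambda>x. w (x + (h + h))) \<in> borel_measurable borel" by measurable
      show "diff2 h r x = 0" if "R + 2 < norm x" for x
        using far[OF that] R by (simp add: diff2_def diff1_def)
    qed (use L2 per in \<open>auto intro: periodic_translate\<close>)
    have "Lp_norm UNIV p (diff2 h (\<lambda>x. r x * w x))
        = Lp_norm UNIV p (\<lambda>x. (r x * diff2 h w x + (2 * diff1 h r x) * diff1 h w (x + h)) + diff2 h r x * w (x + (h + h)))"
      by (intro arg_cong[where f="Lp_norm UNIV p"] ext diff2_product)
    also have "\<dots> \<le> Lp_norm UNIV p (\<lambda>x. r x * diff2 h w x + (2 * diff1 h r x) * diff1 h w (x + h))
        + Lp_norm UNIV p (\<lambda>x. diff2 h r x * w (x + (h + h)))"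
      by (rule Lp_norm_triangle[OF p]) measurable
    also have "\<dots> \<le> (Lp_norm UNIV p (\<lambda>x. r x * diff2 h w x) + Lp_norm UNIV p (\<lambda>x. (2 * diff1 h r x) * diff1 h w (x + h)))
        + Lp_norm UNIV p (\<lambda>x. diff2 h r x * w (x + (h + h)))"
      by (intro add_right_mono Lp_norm_triangle[OF p]) measurable
    also have "\<dots> \<le> (ennreal (C * M) * Lp_norm cell p (diff2 h w) + ennreal (C * (2 * L1)) * (ennreal (norm h) * Lp_norm cell p (diff1 h w)))
        + ennreal (C * L2) * (ennreal ((norm h)\<^sup>2) * Lp_norm cell p w)"
    proof (intro add_mono 1)
      show "Lp_norm UNIV p (\<lambda>x. (2 * diff1 h r x) * diff1 h w (x + h))
          \<le> ennreal (C * (2 * L1)) * (ennreal (norm h) * Lp_norm cell p (diff1 h w))"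
      proof -
        have "ennreal (C * (2 * L1 * norm h)) = ennreal (C * (2 * L1)) * ennreal (norm h)"
          using K(2) by (subst ennreal_mult[symmetric]) (auto simp: mult.assoc)
        then show ?thesis
          using 2 unfolding Lp_norm_translate[OF per1(1) dm(1)]
          by (simp only: mult.assoc[of "ennreal (C * (2 * L1))"])
      qed
      show "Lp_norm UNIV p (\<lambda>x. diff2 h r x * w (x + (h + h)))
          \<le> ennreal (C * L2) * (ennreal ((norm h)\<^sup>2) * Lp_norm cell p w)"
      proof -
        have "ennreal (C * (L2 * (norm h)\<^sup>2)) = ennreal (C * L2) * ennreal ((norm h)\<^sup>2)"
          using K(3) by (subst ennreal_mult[symmetric]) (auto simp: mult.assoc)
        then show ?thesis
          using 3 unfolding Lp_norm_translate[OF per w]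
          by (simp only: mult.assoc[of "ennreal (C * L2)"])
      qed
    qed
    also have "\<dots> \<le> (ennreal K * Lp_norm cell p (diff2 h w) + ennreal K * (ennreal (norm h) * Lp_norm cell p (diff1 h w)))
        + ennreal K * (ennreal ((norm h)\<^sup>2) * Lp_norm cell p w)"
      using K by (intro add_mono mult_right_mono ennreal_leI) (auto simp: K_def)
    finally show "Lp_norm UNIV p (diff2 h (\<lambda>x. r x * w x))
      \<le> ennreal K * (Lp_norm cell p (diff2 h w) + ennreal (norm h) * Lp_norm cell p (diff1 h w)
          + ennreal ((norm h)\<^sup>2) * Lp_norm cell p w)"
      by (simp add: distrib_left)
  qed
qed

lemma ennreal_less_topE:
  assumes "x < (top::ennreal)" obtains c where "0 \<le> c" "x = ennreal c"
  using assms by (cases x) auto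

text \<open>The three terms are controlled by \<open>smoothness\<close>, by \<open>marchaud\<close>, and by the integrability of
  \<open>|h| powr (2 - \<sigma>)\<close> near the origin.\<close>

lemma product_smoothness_near:
  fixes r :: "real^'n::finite \<Rightarrow> complex"
  assumes q: "1 \<le> q" and p: "1 \<le> p" and \<sigma>: "0 < \<sigma>" "\<sigma> \<le> 1" and r: "r \<in> Cc_infinity"
  shows "\<exists>C::real. 0 \<le> C \<and> (\<forall>w. w \<in> borel_measurable borel \<longrightarrow> periodic_2pi w \<longrightarrow>
    inc_norm q near (\<lambda>h. ennreal (norm h powr (- \<sigma>)) * Lp_norm UNIV p (diff2 h (\<lambda>x. r x * w x)))
      \<le> ennreal C * (cell_norm q \<sigma> p w))"
proof -
  obtain K where K: "0 \<le> K" "\<And>w h. w \<in> borel_measurable borel \<Longrightarrow> periodic_2pi w \<Longrightarrow> norm h \<le> 1 \<Longrightarrow>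
    Lp_norm UNIV p (diff2 h (\<lambda>x. r x * w x))
      \<le> ennreal K * (Lp_norm cell p (diff2 h w) + ennreal (norm h) * Lp_norm cell p (diff1 h w)
          + ennreal ((norm h)\<^sup>2) * Lp_norm cell p w)"
    using product_diff2_pointwise[OF p r] by blast
  obtain A where A: "0 \<le> A" "\<And>w::real^'n \<Rightarrow> complex. w \<in> borel_measurable borel \<Longrightarrow> periodic_2pi w \<Longrightarrow>
    inc_norm q near (\<lambda>h. ennreal (norm h powr (1 - \<sigma>)) * Lp_norm cell p (diff1 h w))
      \<le> ennreal A * (cell_norm q \<sigma> p w)"
    using marchaud[OF q p \<sigma>, where 'n='n] by blast
  obtain B where B: "0 \<le> B" "inc_norm q near (\<lambda>h::real^'n. ennreal (norm h powr (2 - \<sigma>))) = ennreal B"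
    using inc_norm_powr_near[OF q, of "2 - \<sigma>", where 'n='n] \<sigma> by (auto elim: ennreal_less_topE)
  show ?thesis
  (* Quasi-additivity, with factor 4, is used twice for the first two terms and once for the third. *)
  proof (intro exI[of _ "K * (16 + 16 * A + 4 * B)"] conjI allI impI)
    show "0 \<le> K * (16 + 16 * A + 4 * B)" using K A B by simp
    fix w :: "real^'n \<Rightarrow> complex" assume w [measurable]: "w \<in> borel_measurable borel" and per: "periodic_2pi w"
    let ?N = "cell_norm q \<sigma> p w"
    let ?F = "\<lambda>h. ennreal (norm h powr (- \<sigma>)) * Lp_norm cell p (diff2 h w)"
    let ?G = "\<lambda>h. ennreal (norm h powr (1 - \<sigma>)) * Lp_norm cell p (diff1 h w)"
    let ?H = "\<lambda>h::real^'n. Lp_norm cell p w * ennreal (norm h powr (2 - \<sigma>))"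
    note [measurable] = measurable_Lp_norm_diff[OF w sets_cell, of p]
    have "inc_norm q near (\<lambda>h. ennreal (norm h powr (- \<sigma>)) * Lp_norm UNIV p (diff2 h (\<lambda>x. r x * w x)))
        \<le> inc_norm q near (\<lambda>h. ennreal K * ((?F h + ?G h) + ?H h))"
    proof (rule inc_norm_mono[OF q])
      fix h :: "real^'n" assume "h \<in> near"
      then have h: "0 < norm h" "norm h \<le> 1" by (auto simp: annulus_def)
      have e1: "ennreal (norm h powr (- \<sigma>)) * ennreal (norm h) = ennreal (norm h powr (1 - \<sigma>))"
        using h by (simp add: ennreal_mult[symmetric] powr_diff powr_minus divide_inverse mult.commute)
      have e2: "ennreal (norm h powr (- \<sigma>)) * ennreal ((norm h)\<^sup>2) = ennreal (norm h powr (2 - \<sigma>))"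
        using h by (simp add: ennreal_mult[symmetric] powr_diff powr_minus divide_inverse mult.commute)
      have "ennreal (norm h powr (- \<sigma>)) * Lp_norm UNIV p (diff2 h (\<lambda>x. r x * w x))
          \<le> ennreal (norm h powr (- \<sigma>)) * (ennreal K * (Lp_norm cell p (diff2 h w) + ennreal (norm h) * Lp_norm cell p (diff1 h w)
          + ennreal ((norm h)\<^sup>2) * Lp_norm cell p w))"
        by (intro mult_left_mono K(2) w per h) auto
      also have "\<dots> = ennreal K * ((?F h + (ennreal (norm h powr (- \<sigma>)) * ennreal (norm h)) * Lp_norm cell p (diff1 h w))
          + Lp_norm cell p w * (ennreal (norm h powr (- \<sigma>)) * ennreal ((norm h)\<^sup>2)))"
        by (simp only: distrib_left mult_ac)
      also have "\<dots> = ennreal K * ((?F h + ?G h) + ?H h)" unfolding e1 e2 ..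
      finally show "ennreal (norm h powr (- \<sigma>)) * Lp_norm UNIV p (diff2 h (\<lambda>x. r x * w x))
          \<le> ennreal K * ((?F h + ?G h) + ?H h)" .
    qed
    also have "\<dots> = ennreal K * inc_norm q near (\<lambda>h. (?F h + ?G h) + ?H h)"
      by (rule inc_norm_cmult[OF q]) measurable
    also have "inc_norm q near (\<lambda>h. (?F h + ?G h) + ?H h)
        \<le> 4 * (inc_norm q near (\<lambda>h. ?F h + ?G h) + inc_norm q near ?H)"
      by (rule inc_norm_add[OF q]) measurable
    also have "inc_norm q near (\<lambda>h. ?F h + ?G h) \<le> 4 * (inc_norm q near ?F + inc_norm q near ?G)"
      by (rule inc_norm_add[OF q]) measurable
    also have "inc_norm q near ?H = Lp_norm cell p w * ennreal B"
      unfolding B(2)[symmetric] by (rule inc_norm_cmult[OF q]) measurable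
    also have "inc_norm q near ?G \<le> ennreal A * ?N" by (rule A(2)[OF w per])
    also have "inc_norm q near ?F \<le> ?N" by (simp add: smoothness_def)
    also have "Lp_norm cell p w * ennreal B \<le> ?N * ennreal B" by (intro mult_right_mono) auto
    also have "ennreal K * (4 * (4 * (?N + ennreal A * ?N) + ?N * ennreal B))
        = ennreal (K * (16 + 16 * A + 4 * B)) * ?N"
    proof -
      have "ennreal (K * (16 + 16 * A + 4 * B)) = ennreal K * (16 + 16 * ennreal A + 4 * ennreal B)"
        using K A B by (simp add: ennreal_mult)
      then show ?thesis by (simp add: algebra_simps)
    qed
    finally show "inc_norm q near (\<lambda>h. ennreal (norm h powr (- \<sigma>)) * Lp_norm UNIV p (diff2 h (\<lambda>x. r x * w x)))
        \<le> ennreal (K * (16 + 16 * A + 4 * B)) * ?N" by (simp add: mult_left_mono)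
  qed
qed

lemma Lp_norm_UNIV_diff2_le:
  fixes g :: "real^'n::finite \<Rightarrow> complex"
  assumes p: "1 \<le> p" and g [measurable]: "g \<in> borel_measurable borel"
  shows "Lp_norm UNIV p (diff2 h g) \<le> 4 * Lp_norm UNIV p g"
proof -
  have tr: "Lp_norm UNIV p (\<lambda>x. u (x + h)) = Lp_norm UNIV p u" if [measurable]: "u \<in> borel_measurable borel"
    for u :: "real^'n \<Rightarrow> complex"
    using nn_integral_lborel_translate[of "\<lambda>x. ennreal (norm (u x) powr p)" h] by (simp add: Lp_norm_lborel)
  have d: "Lp_norm UNIV p (diff1 h u) \<le> 2 * Lp_norm UNIV p u" if [measurable]: "u \<in> borel_measurable borel"
    for u :: "real^'n \<Rightarrow> complex"
  proof -
    have "Lp_norm UNIV p (\<lambda>x. u (x + h) + (-1) * u x)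
        \<le> Lp_norm UNIV p (\<lambda>x. u (x + h)) + Lp_norm UNIV p (\<lambda>x. (-1) * u x)"
      by (rule Lp_norm_triangle[OF p]) measurable
    also have "\<dots> = 2 * Lp_norm UNIV p u"
      using p tr[OF that] by (subst Lp_norm_cmult) (auto simp: mult_2)
    finally show ?thesis by (simp add: diff1_def)
  qed
  have "Lp_norm UNIV p (diff2 h g) \<le> 2 * Lp_norm UNIV p (diff1 h g)"
    unfolding diff2_def by (rule d) measurable
  also have "\<dots> \<le> 2 * (2 * Lp_norm UNIV p g)" by (intro mult_left_mono d g) auto
  finally show ?thesis by (simp add: mult.assoc[symmetric])
qed

lemma Lp_norm_product:
  fixes r :: "real^'n::finite \<Rightarrow> complex"
  assumes p: "1 \<le> p" and r: "r \<in> Cc_infinity"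
  shows "\<exists>C::real. 0 \<le> C \<and> (\<forall>w. w \<in> borel_measurable borel \<longrightarrow> periodic_2pi w \<longrightarrow>
    Lp_norm UNIV p (\<lambda>x. r x * w x) \<le> ennreal C * Lp_norm cell p w)"
proof -
  obtain R where R: "\<forall>x. R < norm x \<longrightarrow> r x = 0" using r by (auto simp: Cc_infinity_iff)
  obtain M where M: "0 \<le> M" "\<forall>x. norm (r x) \<le> M" using Cc_infinity_bounded[OF r] by blast
  obtain C where "0 \<le> C" "\<And>(w::real^'n \<Rightarrow> complex) b M. w \<in> borel_measurable borel \<Longrightarrow> periodic_2pi w \<Longrightarrow>
     0 \<le> M \<Longrightarrow> \<forall>x. norm (b x) \<le> M \<Longrightarrow> \<forall>x. R < norm x \<longrightarrow> b x = 0 \<Longrightarrow>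
     Lp_norm UNIV p (\<lambda>x. b x * w x) \<le> ennreal (C * M) * Lp_norm cell p w"
    using Lp_norm_local[OF p, of R, where 'n='n] by blast
  then show ?thesis using M R by (intro exI[of _ "C * M"]) auto
qed

abbreviation space_smoothness :: "ennreal \<Rightarrow> real \<Rightarrow> real \<Rightarrow> (real^'n::finite \<Rightarrow> complex) \<Rightarrow> ennreal" where
  "space_smoothness q \<sigma> p g \<equiv>
     inc_norm q (UNIV - {0}) (\<lambda>h. ennreal (norm h powr (- \<sigma>)) * Lp_norm UNIV p (diff2 h g))"

lemma product_bound:
  fixes r :: "real^'n::finite \<Rightarrow> complex"
  assumes q: "1 \<le> q" and p: "1 \<le> p" and \<sigma>: "0 < \<sigma>" "\<sigma> \<le> 1" and r: "r \<in> Cc_infinity"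
  shows "\<exists>C::real. 0 \<le> C \<and> (\<forall>w. w \<in> borel_measurable borel \<longrightarrow> periodic_2pi w \<longrightarrow>
    Lp_norm UNIV p (\<lambda>x. r x * w x) \<le> ennreal C * (cell_norm q \<sigma> p w) \<and>
    space_smoothness q \<sigma> p (\<lambda>x. r x * w x)
      \<le> ennreal C * (cell_norm q \<sigma> p w))"
proof -
  have rm [measurable]: "r \<in> borel_measurable borel" by (rule C_infinity_measurable[OF Cc_infinityD[OF r]])
  obtain A where A: "0 \<le> A" "\<And>w. w \<in> borel_measurable borel \<Longrightarrow> periodic_2pi w \<Longrightarrow>
    inc_norm q near (\<lambda>h. ennreal (norm h powr (- \<sigma>)) * Lp_norm UNIV p (diff2 h (\<lambda>x. r x * w x)))
      \<le> ennreal A * (cell_norm q \<sigma> p w)"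
    using product_smoothness_near[OF q p \<sigma> r] by blast
  obtain B where B: "0 \<le> B" "\<And>w. w \<in> borel_measurable borel \<Longrightarrow> periodic_2pi w \<Longrightarrow>
    Lp_norm UNIV p (\<lambda>x. r x * w x) \<le> ennreal B * Lp_norm cell p w"
    using Lp_norm_product[OF p r] by blast
  obtain D where D: "0 \<le> D" "inc_norm q far (\<lambda>h::real^'n. ennreal (norm h powr (- \<sigma>))) = ennreal D"
    using inc_norm_powr_far[OF q \<sigma>(1), where 'n='n] by (auto elim: ennreal_less_topE)
  define C where "C = 2 * A + 8 * B * D + B"
  have C: "0 \<le> C" using A B D by (simp add: C_def)
  show ?thesis
  proof (intro exI[of _ C] conjI allI impI C)
    fix w :: "real^'n \<Rightarrow> complex" assume w [measurable]: "w \<in> borel_measurable borel" and per: "periodic_2pi w"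
    let ?N = "cell_norm q \<sigma> p w"
    let ?g = "\<lambda>x. r x * w x"
    let ?F = "\<lambda>h. ennreal (norm h powr (- \<sigma>)) * Lp_norm UNIV p (diff2 h ?g)"
    have gm [measurable]: "?g \<in> borel_measurable borel" by measurable
    have Fm [measurable]: "?F \<in> borel_measurable borel"
      using measurable_Lp_norm_diff(2)[OF gm, of UNIV p] by measurable
    have gN: "Lp_norm UNIV p ?g \<le> ennreal B * ?N"
      by (rule order_trans[OF B(2)[OF w per]]) (intro mult_left_mono, auto)
    have "ennreal B * ?N \<le> ennreal C * ?N"
      using A B D by (intro mult_right_mono ennreal_leI) (auto simp: C_def)
    with gN show "Lp_norm UNIV p ?g \<le> ennreal C * ?N" by (rule order_trans)
    have split: "UNIV - {0} = near \<union> (far :: (real^'n) set)"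
      by (auto simp: annulus_def)
    have far: "inc_norm q far ?F \<le> 4 * (ennreal B * ?N) * ennreal D"
    proof -
      have "inc_norm q far ?F \<le> inc_norm q far (\<lambda>h::real^'n. (4 * Lp_norm UNIV p ?g) * ennreal (norm h powr (- \<sigma>)))"
        by (rule inc_norm_mono[OF q]) (subst mult.commute, intro mult_right_mono Lp_norm_UNIV_diff2_le p gm, simp)
      also have "\<dots> = (4 * Lp_norm UNIV p ?g) * ennreal D"
        unfolding D(2)[symmetric] by (rule inc_norm_cmult[OF q]) measurable
      also have "\<dots> \<le> 4 * (ennreal B * ?N) * ennreal D"
        by (intro mult_right_mono mult_left_mono gN) auto
      finally show ?thesis .
    qed
    have "inc_norm q (UNIV - {0}) ?F \<le> 2 * (inc_norm q near ?F + inc_norm q far ?F)"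
      unfolding split by (rule inc_norm_Un[OF q]) measurable
    also have "\<dots> \<le> 2 * (ennreal A * ?N + 4 * (ennreal B * ?N) * ennreal D)"
      by (intro mult_left_mono add_mono A(2)[OF w per] far) auto
    also have "\<dots> = ennreal (2 * A + 8 * B * D) * ?N"
    proof -
      have "ennreal (2 * A + 8 * B * D) = 2 * ennreal A + 8 * (ennreal B * ennreal D)"
        using A B D by (simp add: ennreal_mult mult.assoc)
      then show ?thesis by (simp add: algebra_simps)
    qed
    also have "\<dots> \<le> ennreal C * ?N"
      using A B D by (intro mult_right_mono ennreal_leI) (auto simp: C_def)
    finally show "inc_norm q (UNIV - {0}) ?F \<le> ennreal C * ?N" .
  qed
qed

lemma diff2_add: "diff2 h (\<lambda>x. f x + g x) = (\<lambda>x. diff2 h f x + diff2 h g x)"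
  by (simp add: diff2_def diff1_def fun_eq_iff)

lemma diff2_0: "diff2 h (\<lambda>x. 0) = (\<lambda>x. 0)"
  by (simp add: diff2_def diff1_def fun_eq_iff)

lemma product_sum_bound:
  fixes L :: "((nat^'n::finite) \<times> (real^'n \<Rightarrow> complex)) list"
  assumes q: "1 \<le> q" and p: "1 \<le> p" and \<sigma>: "0 < \<sigma>" "\<sigma> \<le> 1"
    and L: "\<forall>z\<in>set L. snd z \<in> Cc_infinity"
  shows "\<exists>C::real. 0 \<le> C \<and> (\<forall>W N. (\<forall>(\<beta>, r)\<in>set L. W \<beta> \<in> borel_measurable borel \<and> periodic_2pi (W \<beta>) \<and>
        cell_norm q \<sigma> p (W \<beta>) \<le> N) \<longrightarrow>
    (combination L W) \<in> borel_measurable borel \<and>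
    Lp_norm UNIV p (combination L W) \<le> ennreal C * N \<and>
    space_smoothness q \<sigma> p (combination L W)
      \<le> ennreal C * N)"
  using L
proof (induction L)
  case Nil
  show ?case by (intro exI[of _ 0]) (simp add: diff2_0 inc_norm_0)
next
  case (Cons z L)
  obtain \<beta> r where z: "z = (\<beta>, r)" by (cases z)
  have r: "r \<in> Cc_infinity" using Cons.prems z by simp
  have rm [measurable]: "r \<in> borel_measurable borel" by (rule C_infinity_measurable[OF Cc_infinityD[OF r]])
  obtain A where A: "0 \<le> A" "\<And>w. w \<in> borel_measurable borel \<Longrightarrow> periodic_2pi w \<Longrightarrow>
    Lp_norm UNIV p (\<lambda>x. r x * w x) \<le> ennreal A * (cell_norm q \<sigma> p w)"
    "\<And>w. w \<in> borel_measurable borel \<Longrightarrow> periodic_2pi w \<Longrightarrow>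
    space_smoothness q \<sigma> p (\<lambda>x. r x * w x)
      \<le> ennreal A * (cell_norm q \<sigma> p w)"
    using product_bound[OF q p \<sigma> r] by blast
  have "\<forall>z\<in>set L. snd z \<in> Cc_infinity" using Cons.prems by simp
  from Cons.IH[OF this] obtain B where B: "0 \<le> B" "\<And>W N. (\<forall>(\<beta>, r)\<in>set L. W \<beta> \<in> borel_measurable borel \<and> periodic_2pi (W \<beta>) \<and>
        cell_norm q \<sigma> p (W \<beta>) \<le> N) \<Longrightarrow>
    (combination L W) \<in> borel_measurable borel \<and>
    Lp_norm UNIV p (combination L W) \<le> ennreal B * N \<and>
    space_smoothness q \<sigma> p (combination L W)
      \<le> ennreal B * N" by blast
  define C where "C = 4 * (A + B)"
  have C: "0 \<le> C" "ennreal C = 4 * (ennreal A + ennreal B)" using A B by (simp_all add: C_def ennreal_mult)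
  show ?case
  proof (rule exI[of _ C], rule conjI[OF C(1)], intro allI impI)
    fix W :: "nat^'n \<Rightarrow> real^'n \<Rightarrow> complex" and N assume W: "\<forall>(\<beta>, r)\<in>set (z # L). W \<beta> \<in> borel_measurable borel \<and> periodic_2pi (W \<beta>) \<and>
        cell_norm q \<sigma> p (W \<beta>) \<le> N"
    have W0 [measurable]: "W \<beta> \<in> borel_measurable borel" and W1: "periodic_2pi (W \<beta>)"
      "cell_norm q \<sigma> p (W \<beta>) \<le> N"
      using W z by auto
    let ?f = "\<lambda>x. r x * W \<beta> x" and ?g = "combination L W"
    have "\<forall>(\<beta>, r)\<in>set L. W \<beta> \<in> borel_measurable borel \<and> periodic_2pi (W \<beta>) \<and>
        cell_norm q \<sigma> p (W \<beta>) \<le> N" using W by simp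
    note IH = B(2)[OF this]
    have fm [measurable]: "?f \<in> borel_measurable borel" by measurable
    have gm [measurable]: "?g \<in> borel_measurable borel" using IH by blast
    have eq: "(combination (z # L) W) = (\<lambda>x. ?f x + ?g x)" by (simp add: z)
    have Af: "Lp_norm UNIV p ?f \<le> ennreal A * N"
      by (rule order_trans[OF A(2)[OF W0 W1(1)] mult_left_mono[OF W1(2)]]) simp
    have As: "space_smoothness q \<sigma> p ?f \<le> ennreal A * N"
      by (rule order_trans[OF A(3)[OF W0 W1(1)] mult_left_mono[OF W1(2)]]) simp
    have dm [measurable]: "diff2 h ?f \<in> borel_measurable borel" "diff2 h ?g \<in> borel_measurable borel" for h
      using fm gm by (auto simp: diff2_def intro: measurable_diff1)
    note [measurable] = measurable_Lp_norm_diff(2)[OF fm, of UNIV p] measurable_Lp_norm_diff(2)[OF gm, of UNIV p]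
    have le4: "x \<le> 4 * x" for x :: ennreal using mult_right_mono[of 1 4 x] by simp
    have "Lp_norm UNIV p (\<lambda>x. ?f x + ?g x) \<le> Lp_norm UNIV p ?f + Lp_norm UNIV p ?g"
      by (rule Lp_norm_triangle[OF p _ fm gm]) simp
    also have "\<dots> \<le> ennreal A * N + ennreal B * N" using IH Af by (intro add_mono) auto
    also have "\<dots> \<le> 4 * (ennreal A * N + ennreal B * N)" by (rule le4)
    also have "\<dots> = ennreal C * N" by (simp add: C(2) distrib_left distrib_right mult.assoc)
    finally have 1: "Lp_norm UNIV p (\<lambda>x. ?f x + ?g x) \<le> ennreal C * N" .
    have "space_smoothness q \<sigma> p (\<lambda>x. ?f x + ?g x)
        \<le> inc_norm q (UNIV - {0}) (\<lambda>h. ennreal (norm h powr (- \<sigma>)) * Lp_norm UNIV p (diff2 h ?f)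
            + ennreal (norm h powr (- \<sigma>)) * Lp_norm UNIV p (diff2 h ?g))"
    proof (rule inc_norm_mono[OF q])
      fix h :: "real^'n"
      have "Lp_norm UNIV p (diff2 h (\<lambda>x. ?f x + ?g x)) \<le> Lp_norm UNIV p (diff2 h ?f) + Lp_norm UNIV p (diff2 h ?g)"
        unfolding diff2_add by (rule Lp_norm_triangle[OF p _ dm]) simp
      from mult_left_mono[OF this, of "ennreal (norm h powr (- \<sigma>))"]
      show "ennreal (norm h powr (- \<sigma>)) * Lp_norm UNIV p (diff2 h (\<lambda>x. ?f x + ?g x))
        \<le> ennreal (norm h powr (- \<sigma>)) * Lp_norm UNIV p (diff2 h ?f)
            + ennreal (norm h powr (- \<sigma>)) * Lp_norm UNIV p (diff2 h ?g)"
        by (simp add: distrib_left)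
    qed
    also have "\<dots> \<le> 4 * (space_smoothness q \<sigma> p ?f
        + space_smoothness q \<sigma> p ?g)"
      by (rule inc_norm_add[OF q]) measurable
    also have "\<dots> \<le> 4 * (ennreal A * N + ennreal B * N)" using IH As by (intro mult_left_mono add_mono) auto
    also have "\<dots> = ennreal C * N" by (simp add: C(2) distrib_left distrib_right mult.assoc)
    finally have 2: "space_smoothness q \<sigma> p (\<lambda>x. ?f x + ?g x)
        \<le> ennreal C * N" .
    show "(combination (z # L) W) \<in> borel_measurable borel \<and>
      Lp_norm UNIV p (combination (z # L) W) \<le> ennreal C * N \<and>
      space_smoothness q \<sigma> p (combination (z # L) W)
        \<le> ennreal C * N"
      unfolding eq using 1 2 borel_measurable_add[OF fm gm] by blast
  qed
qed

section \<open>Smoothness of the lower-order derivatives\<close>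

text \<open>\<open>\<Delta>\<^sub>h\<^sup>2 w\<close> is the first difference of \<open>\<Delta>\<^sub>h w\<close>, whose gradient is \<open>\<Delta>\<^sub>h v\<close>.  The factor \<open>|h|\<close> gained turns
  the weight \<open>|h| powr (- \<sigma>)\<close> into the one of \<open>marchaud\<close>.\<close>

lemma smoothness_le_gradient:
  assumes q: "1 \<le> q" and p: "1 \<le> p" and \<sigma>: "0 < \<sigma>" "\<sigma> \<le> 1"
  shows "\<exists>C::real. 0 \<le> C \<and> (\<forall>(w::real^'n::finite \<Rightarrow> complex) v N. weak_gradient w v \<longrightarrow> w \<in> borel_measurable borel \<longrightarrow>
    (\<forall>i. v i \<in> borel_measurable borel \<and> periodic_2pi (v i) \<and> cell_norm q \<sigma> p (v i) \<le> N) \<longrightarrow>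
    smoothness q \<sigma> p w \<le> ennreal C * N)"
proof -
  obtain A where A: "0 \<le> A" "\<And>w::real^'n \<Rightarrow> complex. w \<in> borel_measurable borel \<Longrightarrow> periodic_2pi w \<Longrightarrow>
    inc_norm q near (\<lambda>h. ennreal (norm h powr (1 - \<sigma>)) * Lp_norm cell p (diff1 h w))
      \<le> ennreal A * (cell_norm q \<sigma> p w)"
    using marchaud[OF q p \<sigma>, where 'n='n] by blast
  have sum: "\<exists>C::real. 0 \<le> C \<and> (\<forall>F N. (\<forall>i\<in>I. F i \<in> borel_measurable borel \<and> inc_norm q near (F i :: real^'n \<Rightarrow> ennreal) \<le> N) \<longrightarrow>
      inc_norm q near (\<lambda>h. \<Sum>i\<in>I. F i h) \<le> ennreal C * N)" for I :: "'n set"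
  proof (induction I rule: infinite_finite_induct)
    case (insert i I)
    then obtain C where C: "0 \<le> C" "\<And>F N. (\<forall>i\<in>I. F i \<in> borel_measurable borel \<and> inc_norm q near (F i :: real^'n \<Rightarrow> ennreal) \<le> N) \<Longrightarrow>
      inc_norm q near (\<lambda>h. \<Sum>i\<in>I. F i h) \<le> ennreal C * N" by blast
    show ?case
    proof (intro exI[of _ "4 * (1 + C)"] conjI allI impI)
      fix F N assume F: "\<forall>i\<in>insert i I. F i \<in> borel_measurable borel \<and> inc_norm q near (F i :: real^'n \<Rightarrow> ennreal) \<le> N"
      have "inc_norm q near (\<lambda>h. \<Sum>i\<in>insert i I. F i h) = inc_norm q near (\<lambda>h. F i h + (\<Sum>i\<in>I. F i h))"
        using insert.hyps by simp
      also have "\<dots> \<le> 4 * (inc_norm q near (F i) + inc_norm q near (\<lambda>h. \<Sum>i\<in>I. F i h))"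
        using F by (intro inc_norm_add[OF q] borel_measurable_sum) auto
      also have "\<dots> \<le> 4 * (N + ennreal C * N)"
        using F by (intro mult_left_mono add_mono C(2)) auto
      also have "\<dots> = ennreal (4 * (1 + C)) * N"
      proof -
        have "ennreal (4 * (1 + C)) = 4 * (1 + ennreal C)" using C(1) by (simp add: ennreal_mult)
        then show ?thesis by (simp add: algebra_simps)
      qed
      finally show "inc_norm q near (\<lambda>h. \<Sum>i\<in>insert i I. F i h) \<le> ennreal (4 * (1 + C)) * N" .
    qed (use C in simp)
  qed (auto simp: inc_norm_0)
  obtain B where B: "0 \<le> B" "\<And>F N. (\<And>i. F i \<in> borel_measurable borel) \<Longrightarrow> (\<And>i. inc_norm q near (F i :: real^'n \<Rightarrow> ennreal) \<le> N) \<Longrightarrow>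
      inc_norm q near (\<lambda>h. \<Sum>i\<in>(UNIV::'n set). F i h) \<le> ennreal B * N" using sum[of UNIV] by auto
  show ?thesis
  proof (intro exI[of _ "B * A"] conjI allI impI)
    show "0 \<le> B * A" using A B by simp
    fix w :: "real^'n \<Rightarrow> complex" and v N
    assume wg: "weak_gradient w v" and w [measurable]: "w \<in> borel_measurable borel"
      and v: "\<forall>i. v i \<in> borel_measurable borel \<and> periodic_2pi (v i) \<and> cell_norm q \<sigma> p (v i) \<le> N"
    have vm [measurable]: "v i \<in> borel_measurable borel" for i using v by blast
    let ?G = "\<lambda>i h. ennreal (norm h powr (1 - \<sigma>)) * Lp_norm cell p (diff1 h (v i))"
    have "smoothness q \<sigma> p w \<le> inc_norm q near (\<lambda>h. \<Sum>i\<in>UNIV. ?G i h)"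
      unfolding smoothness_def
    proof (rule inc_norm_mono[OF q])
      fix h :: "real^'n" assume "h \<in> near"
      then have h: "0 < norm h" by (auto simp: annulus_def)
      have "Lp_norm cell p (diff2 h w) \<le> ennreal (norm h) * (\<Sum>i\<in>UNIV. Lp_norm cell p (diff1 h (v i)))"
        unfolding diff2_def
        by (rule Lp_norm_diff1_le_gradient[OF p weak_gradient_diff1[OF wg w vm]])
          (use v in \<open>auto intro: measurable_diff1 periodic_diff1\<close>)
      from mult_left_mono[OF this, of "ennreal (norm h powr (- \<sigma>))"]
      have "ennreal (norm h powr (- \<sigma>)) * Lp_norm cell p (diff2 h w)
          \<le> (ennreal (norm h powr (- \<sigma>)) * ennreal (norm h)) * (\<Sum>i\<in>UNIV. Lp_norm cell p (diff1 h (v i)))"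
        by (simp add: mult.assoc)
      also have "ennreal (norm h powr (- \<sigma>)) * ennreal (norm h) = ennreal (norm h powr (1 - \<sigma>))"
        using h by (simp add: ennreal_mult[symmetric] powr_diff powr_minus divide_inverse mult.commute)
      finally show "ennreal (norm h powr (- \<sigma>)) * Lp_norm cell p (diff2 h w) \<le> (\<Sum>i\<in>UNIV. ?G i h)"
        by (simp add: sum_distrib_left)
    qed
    also have "\<dots> \<le> ennreal B * (ennreal A * N)"
    proof (rule B(2))
      fix i
      show "?G i \<in> borel_measurable borel"
        using measurable_Lp_norm_diff(1)[OF vm sets_cell, of p i] by measurable
      have "inc_norm q near (?G i) \<le> ennreal A * (cell_norm q \<sigma> p (v i))"
        using v by (intro A(2)) auto
      also have "\<dots> \<le> ennreal A * N" using v by (intro mult_left_mono) auto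
      finally show "inc_norm q near (?G i) \<le> ennreal A * N" .
    qed
    also have "\<dots> = ennreal (B * A) * N" using A B by (simp add: ennreal_mult mult.assoc)
    finally show "smoothness q \<sigma> p w \<le> ennreal (B * A) * N" .
  qed
qed

section \<open>Besov norms in terms of representatives\<close>

lemma besov_seminorm_cong_AE:
  fixes f g :: "real^'n::finite \<Rightarrow> complex"
  assumes "AE x in lebesgue. f x = g x"
  shows "besov_seminorm \<Omega> \<sigma> p q f = besov_seminorm \<Omega> \<sigma> p q g"
proof -
  have ae: "AE x in lborel. f x = g x" using assms by (simp add: AE_completion_iff)
  have "Lp_norm \<Omega> p (diff2 h f) = Lp_norm \<Omega> p (diff2 h g)" for h
  proof (rule Lp_norm_cong_AE, rule AE_completion)
    show "AE x in lborel. diff2 h f x = diff2 h g x"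
      using ae AE_lborel_translate[OF ae, of h] AE_lborel_translate[OF ae, of "h + h"]
      by eventually_elim (simp add: diff2_def diff1_def add.assoc)
  qed
  then show ?thesis by (simp add: besov_seminorm_def)
qed

lemma besov_seminorm_eq_inc_norm:
  fixes g :: "real^'n::finite \<Rightarrow> complex"
  assumes q: "1 \<le> q" and g: "g \<in> borel_measurable borel" and \<Omega> [measurable]: "\<Omega> \<in> sets borel"
  shows "besov_seminorm \<Omega> \<sigma> p q g
    = inc_norm q (\<Omega> - {0}) (\<lambda>h. ennreal (norm h powr (- \<sigma>)) * Lp_norm \<Omega> p (diff2 h g))"
proof (cases "q = \<infinity>")
  case True
  then show ?thesis by (simp add: besov_seminorm_def inc_norm_def)
next
  case False
  define r where "r = enn2real q"
  have r: "1 \<le> r" using enn2real_ge_1[OF q False] by (simp add: r_def)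
  let ?L = "\<lambda>h. Lp_norm \<Omega> p (diff2 h g)"
  have Lm [measurable]: "?L \<in> borel_measurable borel" by (rule measurable_Lp_norm_diff[OF g \<Omega>])
  have m: "(\<lambda>h. ennreal_powr (ennreal (norm h powr (- \<sigma>)) * ?L h) r * indicator (\<Omega> - {0}) h) \<in> borel_measurable borel"
    by measurable
  have "(\<integral>\<^sup>+h\<in>\<Omega>. ennreal (norm h powr (-\<sigma> * r)) * ennreal_powr (?L h) r / ennreal (norm h ^ CARD('n)) \<partial>lebesgue)
      = (\<integral>\<^sup>+h. ennreal (1 / norm h ^ CARD('n)) *
          (ennreal_powr (ennreal (norm h powr (- \<sigma>)) * ?L h) r * indicator (\<Omega> - {0}) h) \<partial>lborel)"
    unfolding nn_integral_completion
  proof (rule nn_integral_cong)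
    fix h :: "real^'n"
    show "ennreal (norm h powr (-\<sigma> * r)) * ennreal_powr (?L h) r / ennreal (norm h ^ CARD('n)) * indicator \<Omega> h
        = ennreal (1 / norm h ^ CARD('n)) *
          (ennreal_powr (ennreal (norm h powr (- \<sigma>)) * ?L h) r * indicator (\<Omega> - {0}) h)"
    (* At the origin the left-hand side is 0 / 0, which is 0 in the extended reals. *)
    proof (cases "h = 0")
      case False
      then have "0 < norm h ^ CARD('n)" by simp
      then have "x / ennreal (norm h ^ CARD('n)) = ennreal (1 / norm h ^ CARD('n)) * x" for x
        by (simp only: divide_ennreal_def inverse_ennreal inverse_eq_divide mult.commute)
      then show ?thesis
        using False by (simp add: ennreal_powr_mult ennreal_powr_ennreal powr_powr indicator_def mult.assoc)
    qed (simp add: divide_ennreal_def)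
  qed
  also have "\<dots> = (\<integral>\<^sup>+h. ennreal_powr (ennreal (norm h powr (- \<sigma>)) * ?L h) r * indicator (\<Omega> - {0}) h \<partial>dilation_measure)"
    by (rule nn_integral_dilation_measure[OF m, symmetric])
  finally show ?thesis
    using False by (simp add: besov_seminorm_def inc_norm_def r_def)
qed

lemma sets_torus_cube [measurable, simp]: "torus_cube \<in> sets borel"
  by (simp add: torus_cube_def)

lemma near_subset_torus_cube: "near \<subseteq> torus_cube - {0 :: real^'n::finite}"
proof
  fix h :: "real^'n" assume "h \<in> near"
  then have h: "0 < norm h" "norm h \<le> 1" by (auto simp: annulus_def)
  have "\<bar>h $ i\<bar> \<le> pi" for i
    using component_le_norm_cart[of h i] h pi_gt3 by linarith
  then have "- pi \<le> h $ i \<and> h $ i \<le> pi" for i by (simp add: abs_le_iff minus_le_iff)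
  with h show "h \<in> torus_cube - {0}"
    by (auto simp: torus_cube_def mem_box_cart)
qed

lemma smoothness_le_besov_seminorm:
  assumes q: "1 \<le> q" and w: "w \<in> borel_measurable borel"
  shows "smoothness q \<sigma> p w \<le> besov_seminorm torus_cube \<sigma> p q w"
  unfolding smoothness_def besov_seminorm_eq_inc_norm[OF q w sets_torus_cube] Lp_norm_torus_cube
  by (rule inc_norm_subset[OF near_subset_torus_cube])

text \<open>Versions of the weak derivatives that are Borel measurable and periodic at every point, so that
  translates, differences and iterated integrals can be formed without exceptional sets.\<close>

definition representatives :: "nat \<Rightarrow> (real^'n::finite \<Rightarrow> complex) \<Rightarrow> (nat^'n \<Rightarrow> real^'n \<Rightarrow> complex) \<Rightarrow> bool" where
  "representatives m f W \<longleftrightarrow> (\<forall>\<beta>. multi_order \<beta> \<le> m \<longrightarrow>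
     W \<beta> \<in> borel_measurable borel \<and> periodic_2pi (W \<beta>) \<and> has_weak_partial \<beta> f (W \<beta>))"

lemma besov_space_representatives:
  assumes "f \<in> besov_space_Tn s p q"
  shows "\<exists>W. representatives (int_part s) f W"
proof -
  have per: "periodic_2pi f" and fin: "besov_norm torus_cube s p q f < \<infinity>"
    using assms by (auto simp: besov_space_Tn_def)
  have "sobolev_norm torus_cube (int_part s) p f \<noteq> \<infinity>"
    using fin by (auto simp: besov_norm_def)
  then have "\<forall>\<beta>. multi_order \<beta> \<le> int_part s \<longrightarrow> (\<exists>g. has_weak_partial \<beta> f g)"
    unfolding sobolev_norm_def by (metis)
  then have "\<exists>w. multi_order \<beta> \<le> int_part s \<longrightarrow>
      w \<in> borel_measurable borel \<and> periodic_2pi w \<and> has_weak_partial \<beta> f w" for \<beta>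
    using periodic_weak_partial[OF per] by blast
  then show ?thesis unfolding representatives_def by metis
qed

lemma besov_norm_bounds:
  fixes f :: "real^'n::finite \<Rightarrow> complex" and \<beta> :: "nat^'n"
  assumes q: "1 \<le> q" and W: "representatives (int_part s) f W"
  shows "multi_order \<beta> \<le> int_part s \<Longrightarrow> Lp_norm cell p (W \<beta>) \<le> besov_norm torus_cube s p q f"
    and "multi_order \<beta> = int_part s \<Longrightarrow> smoothness q (frac_part s) p (W \<beta>) \<le> besov_norm torus_cube s p q f"
proof -
  let ?m = "int_part s"
  have Wd: "W \<beta> \<in> borel_measurable borel" "has_weak_partial \<beta> f (W \<beta>)" if "multi_order \<beta> \<le> ?m" for \<beta> :: "nat^'n"
    using W that by (auto simp: representatives_def)
  have ae: "AE x in lebesgue. weak_partial \<beta> f x = W \<beta> x" if "multi_order \<beta> \<le> ?m" for \<beta> :: "nat^'n"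
    by (rule has_weak_partial_unique[OF has_weak_partial_weak_partial[OF Wd(2)[OF that]] Wd(2)[OF that]])
  have sob: "sobolev_norm torus_cube ?m p f = (\<Sum>\<alpha> | multi_order \<alpha> \<le> ?m. Lp_norm torus_cube p (weak_partial \<alpha> f))"
    unfolding sobolev_norm_def using Wd(2) by auto
  show "Lp_norm cell p (W \<beta>) \<le> besov_norm torus_cube s p q f" if \<beta>: "multi_order \<beta> \<le> ?m"
  proof -
    have "Lp_norm cell p (W \<beta>) = Lp_norm torus_cube p (weak_partial \<beta> f)"
      using Lp_norm_cong_AE[OF ae[OF \<beta>]] by (simp add: Lp_norm_torus_cube)
    also have "\<dots> \<le> sobolev_norm torus_cube ?m p f"
      unfolding sob using \<beta> by (intro member_le_sum[where f="\<lambda>\<alpha>. Lp_norm torus_cube p (weak_partial \<alpha> f)"])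
        (auto simp: finite_multi_order)
    also have "\<dots> \<le> besov_norm torus_cube s p q f" by (simp add: besov_norm_def)
    finally show ?thesis .
  qed
  show "smoothness q (frac_part s) p (W \<beta>) \<le> besov_norm torus_cube s p q f" if \<beta>: "multi_order \<beta> = ?m"
  proof -
    have \<beta>': "multi_order \<beta> \<le> ?m" using \<beta> by simp
    have fin: "finite {\<alpha>::nat^'n. multi_order \<alpha> = ?m}"
      by (rule finite_subset[OF _ finite_multi_order[of ?m]]) auto
    have "smoothness q (frac_part s) p (W \<beta>) \<le> besov_seminorm torus_cube (frac_part s) p q (W \<beta>)"
      by (rule smoothness_le_besov_seminorm[OF q Wd(1)[OF \<beta>']])
    also have "\<dots> = besov_seminorm torus_cube (frac_part s) p q (weak_partial \<beta> f)"
      by (rule besov_seminorm_cong_AE[OF ae[OF \<beta>'], symmetric])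
    also have "\<dots> \<le> (\<Sum>\<alpha> | multi_order \<alpha> = ?m. besov_seminorm torus_cube (frac_part s) p q (weak_partial \<alpha> f))"
      using \<beta> fin by (intro member_le_sum[where f="\<lambda>\<alpha>. besov_seminorm torus_cube (frac_part s) p q (weak_partial \<alpha> f)"]) auto
    also have "\<dots> \<le> besov_norm torus_cube s p q f" by (simp add: besov_norm_def)
    finally show ?thesis .
  qed
qed

lemma frac_part_bounds: "0 < frac_part s" "frac_part s \<le> 1"
  unfolding frac_part_def by linarith+

text \<open>Downward induction on the order \<open>int_part s - k\<close> of the derivative: the seminorm of \<open>f\<close> provides the
  top order, and \<open>smoothness_le_gradient\<close> descends by one order at a time.\<close>

lemma smoothness_of_all_orders:
  assumes q: "1 \<le> q" and p: "1 \<le> p" and k: "k \<le> int_part s"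
  shows "\<exists>C::real. 0 \<le> C \<and> (\<forall>(f::real^'n::finite \<Rightarrow> complex) W \<beta>. representatives (int_part s) f W \<longrightarrow>
    multi_order \<beta> = int_part s - k \<longrightarrow>
    cell_norm q (frac_part s) p (W \<beta>) \<le> ennreal C * besov_norm torus_cube s p q f)"
  using k
proof (induction k)
  case 0
  show ?case
  proof (intro exI[of _ 2] conjI allI impI)
    fix f :: "real^'n \<Rightarrow> complex" and W and \<beta> :: "nat^'n"
    assume "representatives (int_part s) f W" "multi_order \<beta> = int_part s - 0"
    then show "cell_norm q (frac_part s) p (W \<beta>) \<le> ennreal 2 * besov_norm torus_cube s p q f"
      using besov_norm_bounds[OF q, of s f W \<beta> p] by (simp add: mult_2 add_mono)
  qed simp
next
  case (Suc k)
  then obtain C where C: "0 \<le> C" "\<And>(f::real^'n \<Rightarrow> complex) W \<beta>. representatives (int_part s) f W \<Longrightarrow>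
    multi_order \<beta> = int_part s - k \<Longrightarrow>
    cell_norm q (frac_part s) p (W \<beta>) \<le> ennreal C * besov_norm torus_cube s p q f"
    by auto
  obtain A where A: "0 \<le> A" "\<And>(w::real^'n::finite \<Rightarrow> complex) v N. weak_gradient w v \<Longrightarrow> w \<in> borel_measurable borel \<Longrightarrow>
    (\<And>i. v i \<in> borel_measurable borel \<and> periodic_2pi (v i) \<and> cell_norm q (frac_part s) p (v i) \<le> N) \<Longrightarrow>
    smoothness q (frac_part s) p w \<le> ennreal A * N"
    using smoothness_le_gradient[OF q p frac_part_bounds, of s, where 'n='n] by blast
  show ?case
  proof (intro exI[of _ "1 + A * C"] conjI allI impI)
    show "0 \<le> 1 + A * C" using A C by simp
    fix f :: "real^'n \<Rightarrow> complex" and W and \<beta> :: "nat^'n"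
    assume W: "representatives (int_part s) f W" and \<beta>: "multi_order \<beta> = int_part s - Suc k"
    let ?N = "besov_norm torus_cube s p q f"
    obtain js where js: "\<beta> = list_index js" using list_index_surj by metis
    have len: "length js = int_part s - Suc k" using \<beta> by (simp add: js multi_order_list_index)
    have ord: "multi_order (list_index (i # js)) = int_part s - k" for i
      using len Suc.prems by (simp add: multi_order_list_index)
    have le: "multi_order \<beta> \<le> int_part s" "multi_order (list_index (i # js)) \<le> int_part s" for i
      using \<beta> ord[of i] by simp_all
    have "smoothness q (frac_part s) p (W \<beta>) \<le> ennreal A * (ennreal C * ?N)"
    proof (rule A(2)[where v="\<lambda>i. W (list_index (i # js))"])
      show "weak_gradient (W \<beta>) (\<lambda>i. W (list_index (i # js)))"
        unfolding js using W le by (intro weak_gradient_of_weak_partials[where f=f]) (auto simp: representatives_def js)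
      show "W \<beta> \<in> borel_measurable borel" using W le by (simp add: representatives_def)
      show "W (list_index (i # js)) \<in> borel_measurable borel \<and> periodic_2pi (W (list_index (i # js))) \<and>
          cell_norm q (frac_part s) p (W (list_index (i # js))) \<le> ennreal C * ?N" for i
        using W le C(2)[OF W ord] by (simp add: representatives_def)
    qed
    moreover have "Lp_norm cell p (W \<beta>) \<le> ?N" by (rule besov_norm_bounds(1)[OF q W le(1)])
    ultimately have "cell_norm q (frac_part s) p (W \<beta>) \<le> ?N + ennreal A * (ennreal C * ?N)"
      by (intro add_mono)
    also have "\<dots> = ennreal (1 + A * C) * ?N"
      using A C by (simp add: ennreal_mult distrib_right mult.assoc)
    finally show "cell_norm q (frac_part s) p (W \<beta>) \<le> ennreal (1 + A * C) * ?N" .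
  qed
qed

lemma smoothness_uniform:
  assumes q: "1 \<le> q" and p: "1 \<le> p"
  shows "\<exists>C::real. 0 \<le> C \<and> (\<forall>(f::real^'n::finite \<Rightarrow> complex) W \<beta>. representatives (int_part s) f W \<longrightarrow>
    multi_order \<beta> \<le> int_part s \<longrightarrow>
    cell_norm q (frac_part s) p (W \<beta>) \<le> ennreal C * besov_norm torus_cube s p q f)"
proof -
  define P where "P = (\<lambda>k (C::real). 0 \<le> C \<and> (\<forall>(f::real^'n::finite \<Rightarrow> complex) W \<beta>. representatives (int_part s) f W \<longrightarrow>
    multi_order \<beta> = int_part s - k \<longrightarrow>
    cell_norm q (frac_part s) p (W \<beta>) \<le> ennreal C * besov_norm torus_cube s p q f))"
  have "\<forall>k\<in>{..int_part s}. \<exists>C. P k C"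
    unfolding P_def using smoothness_of_all_orders[OF q p] by auto
  from bchoice[OF this] obtain C where C0: "\<forall>k\<in>{..int_part s}. P k (C k)" by blast
  have C: "0 \<le> C k" "representatives (int_part s) f W \<Longrightarrow> multi_order \<beta> = int_part s - k \<Longrightarrow>
    cell_norm q (frac_part s) p (W \<beta>) \<le> ennreal (C k) * besov_norm torus_cube s p q (f::real^'n \<Rightarrow> complex)"
    if "k \<le> int_part s" for k f W and \<beta> :: "nat^'n"
    using C0 that unfolding P_def by auto
  show ?thesis
  proof (intro exI[of _ "sum C {..int_part s}"] conjI allI impI)
    show "0 \<le> sum C {..int_part s}" using C(1) by (intro sum_nonneg) auto
    fix f :: "real^'n \<Rightarrow> complex" and W and \<beta> :: "nat^'n"
    assume W: "representatives (int_part s) f W" and \<beta>: "multi_order \<beta> \<le> int_part s"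
    let ?k = "int_part s - multi_order \<beta>"
    have "cell_norm q (frac_part s) p (W \<beta>) \<le> ennreal (C ?k) * besov_norm torus_cube s p q f"
      using \<beta> by (intro C(2) W) auto
    also have "\<dots> \<le> ennreal (sum C {..int_part s}) * besov_norm torus_cube s p q f"
      using C(1) by (intro mult_right_mono ennreal_leI member_le_sum) auto
    finally show "cell_norm q (frac_part s) p (W \<beta>)
        \<le> ennreal (sum C {..int_part s}) * besov_norm torus_cube s p q f" .
  qed
qed

section \<open>The product estimate\<close>

lemma product_derivative_bound:
  fixes \<rho> :: "real^'n::finite \<Rightarrow> complex"
  assumes q: "1 \<le> q" and p: "1 \<le> p" and \<rho>: "\<rho> \<in> Cc_infinity" and \<alpha>: "multi_order \<alpha> \<le> int_part s"
  shows "\<exists>C::real. 0 \<le> C \<and> (\<forall>f\<in>besov_space_Tn s p q.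
    (\<exists>g. has_weak_partial \<alpha> (\<lambda>x. \<rho> x * f x) g) \<and>
    Lp_norm UNIV p (weak_partial \<alpha> (\<lambda>x. \<rho> x * f x)) \<le> ennreal C * besov_norm torus_cube s p q f \<and>
    besov_seminorm UNIV (frac_part s) p q (weak_partial \<alpha> (\<lambda>x. \<rho> x * f x)) \<le> ennreal C * besov_norm torus_cube s p q f)"
proof -
  obtain L where L: "\<And>\<beta> r. (\<beta>, r) \<in> set L \<Longrightarrow> multi_order \<beta> \<le> multi_order \<alpha>"
    "\<And>\<beta> r. (\<beta>, r) \<in> set L \<Longrightarrow> r \<in> Cc_infinity"
    "\<And>f W. (\<And>\<beta>. multi_order \<beta> \<le> multi_order \<alpha> \<Longrightarrow> has_weak_partial \<beta> f (W \<beta>)) \<Longrightarrow>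
       has_weak_partial \<alpha> (\<lambda>x. \<rho> x * f x) (combination L W)"
    using weak_partial_product[OF \<rho>, of \<alpha>] by blast
  have L2: "\<forall>z\<in>set L. snd z \<in> Cc_infinity" using L(2) by auto
  obtain A where A: "0 \<le> A" "\<And>(f::real^'n \<Rightarrow> complex) W \<beta>. representatives (int_part s) f W \<Longrightarrow>
    multi_order \<beta> \<le> int_part s \<Longrightarrow>
    cell_norm q (frac_part s) p (W \<beta>) \<le> ennreal A * besov_norm torus_cube s p q f"
    using smoothness_uniform[OF q p, of s, where 'n='n] by blast
  obtain B where B: "0 \<le> B" "\<And>W N. (\<forall>(\<beta>, r)\<in>set L. W \<beta> \<in> borel_measurable borel \<and> periodic_2pi (W \<beta>) \<and>
        cell_norm q (frac_part s) p (W \<beta>) \<le> N) \<Longrightarrow>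
    (combination L W) \<in> borel_measurable borel \<and>
    Lp_norm UNIV p (combination L W) \<le> ennreal B * N \<and>
    space_smoothness q (frac_part s) p (combination L W)
      \<le> ennreal B * N"
    using product_sum_bound[OF q p frac_part_bounds[of s] L2] by blast
  show ?thesis
  proof (rule exI[of _ "B * A"], rule conjI, use A B in simp, rule ballI)
    fix f :: "real^'n \<Rightarrow> complex" assume f: "f \<in> besov_space_Tn s p q"
    let ?N = "besov_norm torus_cube s p q f" and ?g = "weak_partial \<alpha> (\<lambda>x. \<rho> x * f x)"
    obtain W where W: "representatives (int_part s) f W" using besov_space_representatives[OF f] by blast
    let ?G = "combination L W"
    have G: "has_weak_partial \<alpha> (\<lambda>x. \<rho> x * f x) ?G"
      using W \<alpha> by (intro L(3)) (auto simp: representatives_def)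
    have "\<forall>(\<beta>, r)\<in>set L. W \<beta> \<in> borel_measurable borel \<and> periodic_2pi (W \<beta>) \<and>
        cell_norm q (frac_part s) p (W \<beta>) \<le> ennreal A * ?N"
    proof (clarify, intro conjI)
      fix \<beta> r assume "(\<beta>, r) \<in> set L"
      from L(1)[OF this] \<alpha> have \<beta>: "multi_order \<beta> \<le> int_part s" by simp
      show "W \<beta> \<in> borel_measurable borel" "periodic_2pi (W \<beta>)" using W \<beta> by (auto simp: representatives_def)
      show "cell_norm q (frac_part s) p (W \<beta>) \<le> ennreal A * ?N" by (rule A(2)[OF W \<beta>])
    qed
    note b = B(2)[OF this]
    have BA: "ennreal B * (ennreal A * ?N) = ennreal (B * A) * ?N"
      using A B by (simp add: ennreal_mult mult.assoc)
    have Gm: "?G \<in> borel_measurable borel" using b by blast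
    have ae: "AE x in lebesgue. ?g x = ?G x"
      by (rule has_weak_partial_unique[OF has_weak_partial_weak_partial[OF G] G])
    have "Lp_norm UNIV p ?g = Lp_norm UNIV p ?G" by (rule Lp_norm_cong_AE[OF ae])
    moreover have "besov_seminorm UNIV (frac_part s) p q ?g
        = space_smoothness q (frac_part s) p ?G"
      unfolding besov_seminorm_cong_AE[OF ae] by (rule besov_seminorm_eq_inc_norm[OF q Gm]) simp
    ultimately show "(\<exists>g. has_weak_partial \<alpha> (\<lambda>x. \<rho> x * f x) g) \<and>
        Lp_norm UNIV p ?g \<le> ennreal (B * A) * ?N \<and>
        besov_seminorm UNIV (frac_part s) p q ?g \<le> ennreal (B * A) * ?N"
      using b G unfolding BA by auto
  qed
qed

theorem lemma5p2:
  fixes s p :: real and q :: ennreal and \<rho> :: "real^'n::finite \<Rightarrow> complex"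
  assumes "s > 0" and "p > 1" and "q \<ge> 1"
    and "\<rho> \<in> Cc_infinity"
  shows "\<exists>c::real. c > 0 \<and>
    (\<forall>f \<in> besov_space_Tn s p q.
       (\<lambda>x. \<rho> x * f x) \<in> besov_space_Rn s p q \<and>
       besov_norm UNIV s p q (\<lambda>x. \<rho> x * f x) \<le> ennreal c * besov_norm torus_cube s p q f)"
proof -
  let ?m = "int_part s"
  let ?S = "{\<alpha>::nat^'n. multi_order \<alpha> \<le> ?m}" and ?T = "{\<alpha>::nat^'n. multi_order \<alpha> = ?m}"
  have p: "1 \<le> p" using assms by simp
  have fin: "finite ?S" "finite ?T"
    by (rule finite_multi_order, rule finite_subset[OF _ finite_multi_order[of ?m]]) auto
  have "\<forall>\<alpha>\<in>?S. \<exists>C::real. 0 \<le> C \<and> (\<forall>f\<in>besov_space_Tn s p q.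
    (\<exists>g. has_weak_partial \<alpha> (\<lambda>x. \<rho> x * f x) g) \<and>
    Lp_norm UNIV p (weak_partial \<alpha> (\<lambda>x. \<rho> x * f x)) \<le> ennreal C * besov_norm torus_cube s p q f \<and>
    besov_seminorm UNIV (frac_part s) p q (weak_partial \<alpha> (\<lambda>x. \<rho> x * f x)) \<le> ennreal C * besov_norm torus_cube s p q f)"
    using product_derivative_bound[OF assms(3) p assms(4)] by blast
  from bchoice[OF this] obtain C where C: "\<And>\<alpha>. \<alpha> \<in> ?S \<Longrightarrow> 0 \<le> C \<alpha>"
    "\<And>\<alpha> f. \<alpha> \<in> ?S \<Longrightarrow> f \<in> besov_space_Tn s p q \<Longrightarrow> \<exists>g. has_weak_partial \<alpha> (\<lambda>x. \<rho> x * f x) g"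
    "\<And>\<alpha> f. \<alpha> \<in> ?S \<Longrightarrow> f \<in> besov_space_Tn s p q \<Longrightarrow>
      Lp_norm UNIV p (weak_partial \<alpha> (\<lambda>x. \<rho> x * f x)) \<le> ennreal (C \<alpha>) * besov_norm torus_cube s p q f"
    "\<And>\<alpha> f. \<alpha> \<in> ?S \<Longrightarrow> f \<in> besov_space_Tn s p q \<Longrightarrow>
      besov_seminorm UNIV (frac_part s) p q (weak_partial \<alpha> (\<lambda>x. \<rho> x * f x)) \<le> ennreal (C \<alpha>) * besov_norm torus_cube s p q f"
    by blast
  define c where "c = sum C ?S + sum C ?T + 1"
  have nn: "0 \<le> sum C ?S" "0 \<le> sum C ?T" using C(1) by (auto intro!: sum_nonneg)
  show ?thesis
  proof (intro exI[of _ c] conjI ballI)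
    show "0 < c" using nn by (simp add: c_def)
    fix f :: "real^'n \<Rightarrow> complex" assume f: "f \<in> besov_space_Tn s p q"
    let ?N = "besov_norm torus_cube s p q f" and ?u = "\<lambda>x. \<rho> x * f x"
    have "sobolev_norm UNIV ?m p ?u = (\<Sum>\<alpha>\<in>?S. Lp_norm UNIV p (weak_partial \<alpha> ?u))"
      unfolding sobolev_norm_def using C(2)[OF _ f] by auto
    also have "\<dots> \<le> (\<Sum>\<alpha>\<in>?S. ennreal (C \<alpha>) * ?N)"
      by (intro sum_mono C(3) f)
    also have "\<dots> = ennreal (sum C ?S) * ?N"
    proof -
      have "(\<Sum>\<alpha>\<in>?S. ennreal (C \<alpha>)) = ennreal (sum C ?S)"
        using C(1) by (intro sum_ennreal) auto
      then show ?thesis by (simp only: sum_distrib_right[symmetric])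
    qed
    finally have 1: "sobolev_norm UNIV ?m p ?u \<le> ennreal (sum C ?S) * ?N" .
    have "(\<Sum>\<alpha>\<in>?T. besov_seminorm UNIV (frac_part s) p q (weak_partial \<alpha> ?u)) \<le> (\<Sum>\<alpha>\<in>?T. ennreal (C \<alpha>) * ?N)"
      by (intro sum_mono C(4) f) auto
    also have "\<dots> = ennreal (sum C ?T) * ?N"
    proof -
      have "(\<Sum>\<alpha>\<in>?T. ennreal (C \<alpha>)) = ennreal (sum C ?T)"
        using C(1) by (intro sum_ennreal) auto
      then show ?thesis by (simp only: sum_distrib_right[symmetric])
    qed
    finally have "besov_norm UNIV s p q ?u \<le> ennreal (sum C ?S) * ?N + ennreal (sum C ?T) * ?N"
      unfolding besov_norm_def[of UNIV] by (rule add_mono[OF 1])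
    also have "\<dots> = ennreal (sum C ?S + sum C ?T) * ?N"
      using nn by (simp add: distrib_right)
    also have "\<dots> \<le> ennreal c * ?N"
      by (intro mult_right_mono ennreal_leI) (auto simp: c_def)
    finally show main: "besov_norm UNIV s p q ?u \<le> ennreal c * ?N" .
    have "?N < top" using f by (simp add: besov_space_Tn_def)
    then have "ennreal c * ?N < top" by (simp add: ennreal_mult_less_top)
    with main show "?u \<in> besov_space_Rn s p q"
      by (simp add: besov_space_Rn_def le_less_trans)
  qed
qed

end
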